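(* Let $n\ge 1$. The skew Schur function $s_{\delta_n/\delta_{n-2}}$ can be expressed as a nonnegative sum of Schur $P$-functions. Namely, $$ s_{\delta_n/\delta_{n-2}}=\sum_{U\in\mathsf{AltShSYT}(2n-1)}P_{\operatorname{sh}(U)},$$ where $\mathsf{AltShSYT}(2n-1)$ is the set of shifted standard Young tableaux of size $2n-1$ which are alternating, and $\operatorname{sh}(U)$ denotes the shifted shape (a strict partition) of $U$.
   Context: $\delta_n=(n,n-1,\ldots,2,1)$ is the staircase partition; $\delta_0$ and $\delta_{-1}$ are the empty partition. Diagrams use English (matrix) notation: rows are numbered top to bottom, columns left to right. The diagram of a partition $\lambda=(\lambda_1\ge\cdots\ge\lambda_l>0)$ has $\lambda_i$ cells in row $i$, left justified. For a strict partition $\lambda_1>\cdots>\lambda_l>0$, the shifted diagram (shifted shape) has $\lambda_i$ cells in row $i$, with row $i$ shifted $i-1$ units to the right. A skew shape $\lambda/\mu$ is obtained by removing the diagram of $\mu$ from the diagram of $\lambda\supseteq\mu$. Skew Schur functions: a semistandard Young tableau of shape $\lambda/\mu$ is a filling of its cells by positive integers, weakly increasing along rows and strictly increasing down columns; $s_{\lambda/\mu}=\sum_T x^T$ over all such $T$, where $x^T=\prod_i x_i^{a_i}$ and $a_i$ is the number of entries equal to $i$. Schur $P$-functions: for a strict partition $\lambda$, a shifted semistandard Young tableau of shape $\lambda$ is a filling of the shifted diagram of $\lambda$ by letters of the alphabet $1'<1<2'<2<\cdots$ such that rows and columns are weakly increasing, each unprimed $k$ appears at most once in every column, each primed $k'$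 appears at most once in every row, and there are no primed entries on the main diagonal (the first cells of the rows). $P_\lambda=\sum_T x^T$ over all such $T$, where $x^T=\prod_i x_i^{a_i}$ and $a_i$ is the number of entries equal to $i$ or $i'$. A shifted standard Young tableau of shifted shape $\lambda$ is a filling of the shifted diagram by the (unprimed) letters $1,2,\ldots,|\lambda|$, each exactly once, with rows and columns increasing; its size is $|\lambda|=\sum_i\lambda_i$. In a shifted standard Young tableau of size $N$, an entry $i$ ($1\le i\le N-1$) is an ascent if $i+1$ is located weakly north and strictly east of $i$, and a descent if $i+1$ is located strictly south and weakly west of $i$. The tableau is alternating if every odd $i\in\{1,\ldots,N-1\}$ is an ascent and every even $i\in\{1,\ldots,N-1\}$ is a descent. *)

theory Defs
  imports Main "HOL-Library.FuncSet" "HOL-Library.Poly_Mapping" "HOL-Library.Function_Algebras"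
begin

text \<open>
  Formal power series in infinitely many variables with integer coefficients, given by their
  coefficient functions; a monomial is its exponent vector.  Addition (hence \<open>\<Sum>\<close>) is the pointwise
  one of \<open>Function_Algebras\<close>.  Tableau entries are positive, so the variable
  with index \<open>0\<close> never occurs.
\<close>

type_synonym monomial = "nat \<Rightarrow>\<^sub>0 nat"
type_synonym power_series = "monomial \<Rightarrow> int"

text \<open>A cell is (row, column), both numbered from \<open>0\<close>.\<close>

type_synonym cell = "nat \<times> nat"
type_synonym 'a filling = "cell \<Rightarrow> 'a"

text \<open>
  The series \<open>\<Sum>T\<in>A. x\<^sup>T\<close>, where \<open>x\<^sup>T = \<Prod>i. x\<^sub>i ^ a\<^sub>i\<close> and \<open>a\<^sub>i\<close> counts the cells \<open>c\<close> of the shape \<open>D\<close>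
  with \<open>idx (T c) = i\<close>.  The sets whose cardinality is taken are finite in the uses below, see
  \<open>finite_skew_schur_coeff\<close> and \<open>finite_schur_P_coeff\<close>.
\<close>

definition tableau_series :: "cell set \<Rightarrow> ('a \<Rightarrow> nat) \<Rightarrow> 'a filling set \<Rightarrow> power_series" where
  "tableau_series D idx A =
     (\<lambda>a. int (card {T \<in> A. \<forall>i. Poly_Mapping.lookup a i = card {c \<in> D. idx (T c) = i}}))"

subsection \<open>Skew Schur functions\<close>

definition diagram :: "nat list \<Rightarrow> cell set" where
  "diagram lam = {(i, j). i < length lam \<and> j < lam ! i}"

text \<open>An integer argument is used so that \<open>staircase (- 1)\<close> is the empty partition.\<close>

definition staircase :: "int \<Rightarrow> nat list" where
  "staircase k = map nat (rev [1..k])"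

text \<open>Fillings are extensional functions, so that each one is counted once.\<close>

definition SSYT :: "cell set \<Rightarrow> nat filling set" where
  "SSYT D = {T \<in> D \<rightarrow>\<^sub>E {1..}.
     (\<forall>i j j'. (i, j) \<in> D \<and> (i, j') \<in> D \<and> j < j' \<longrightarrow> T (i, j) \<le> T (i, j')) \<and>
     (\<forall>i i' j. (i, j) \<in> D \<and> (i', j) \<in> D \<and> i < i' \<longrightarrow> T (i, j) < T (i', j))}"

definition skew_schur :: "nat list \<Rightarrow> nat list \<Rightarrow> power_series" where
  "skew_schur lam mu =
     (let D = diagram lam - diagram mu in tableau_series D id (SSYT D))"

subsection \<open>Schur \<open>P\<close>-functions\<close>

definition strict_partition :: "nat list \<Rightarrow> bool" where
  "strict_partition lam \<longleftrightarrow> sorted_wrt (>) lam \<and> 0 \<notin> set lam"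

definition shifted_diagram :: "nat list \<Rightarrow> cell set" where
  "shifted_diagram lam = {(i, j). i < length lam \<and> i \<le> j \<and> j < i + lam ! i}"

datatype letter = Primed (letter_index: nat) | Unprimed (letter_index: nat)

text \<open>The rank realises the order \<open>1' < 1 < 2' < 2 < \<dots>\<close>.\<close>

fun letter_rank :: "letter \<Rightarrow> nat" where
  "letter_rank (Primed k) = 2 * k"
| "letter_rank (Unprimed k) = 2 * k + 1"

lemma letter_rank_inj: "letter_rank x = letter_rank y \<longleftrightarrow> x = y"
  by (cases x; cases y; simp; presburger)

instantiation letter :: linorder
begin

definition less_eq_letter :: "letter \<Rightarrow> letter \<Rightarrow> bool" where
  "less_eq_letter x y \<longleftrightarrow> letter_rank x \<le> letter_rank y"

definition less_letter :: "letter \<Rightarrow> letter \<Rightarrow> bool" where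
  "less_letter x y \<longleftrightarrow> letter_rank x < letter_rank y"

instance
  by standard (auto simp: less_eq_letter_def less_letter_def letter_rank_inj)

end

definition ShSSYT :: "nat list \<Rightarrow> letter filling set" where
  "ShSSYT lam = (let D = shifted_diagram lam in
     {T \<in> D \<rightarrow>\<^sub>E {x. 1 \<le> letter_index x}.
       (\<forall>i j j'. (i, j) \<in> D \<and> (i, j') \<in> D \<and> j < j' \<longrightarrow> T (i, j) \<le> T (i, j')) \<and>
       (\<forall>i i' j. (i, j) \<in> D \<and> (i', j) \<in> D \<and> i < i' \<longrightarrow> T (i, j) \<le> T (i', j)) \<and>
       (\<forall>k i i' j. (i, j) \<in> D \<and> (i', j) \<in> D \<and> T (i, j) = Unprimed k \<and> T (i', j) = Unprimed k
          \<longrightarrow> i = i') \<and>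
       (\<forall>k i j j'. (i, j) \<in> D \<and> (i, j') \<in> D \<and> T (i, j) = Primed k \<and> T (i, j') = Primed k
          \<longrightarrow> j = j') \<and>
       (\<forall>k i. (i, i) \<in> D \<longrightarrow> T (i, i) \<noteq> Primed k)})"

definition schur_P :: "nat list \<Rightarrow> power_series" where
  "schur_P lam = tableau_series (shifted_diagram lam) letter_index (ShSSYT lam)"

subsection \<open>Alternating shifted standard Young tableaux\<close>

text \<open>A shifted standard tableau is a pair of its shape and its filling.\<close>

type_synonym shifted_tableau = "nat list \<times> nat filling"

abbreviation sh :: "shifted_tableau \<Rightarrow> nat list" where
  "sh U \<equiv> fst U"

definition ShSYT :: "nat \<Rightarrow> shifted_tableau set" where
  "ShSYT N = {(lam, T). strict_partition lam \<and> sum_list lam = N \<and>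
     (let D = shifted_diagram lam in
       T \<in> extensional D \<and> bij_betw T D {1..N} \<and>
       (\<forall>i j j'. (i, j) \<in> D \<and> (i, j') \<in> D \<and> j < j' \<longrightarrow> T (i, j) < T (i, j')) \<and>
       (\<forall>i i' j. (i, j) \<in> D \<and> (i', j) \<in> D \<and> i < i' \<longrightarrow> T (i, j) < T (i', j)))}"

definition is_ascent :: "shifted_tableau \<Rightarrow> nat \<Rightarrow> bool" where
  "is_ascent U i \<longleftrightarrow> (\<exists>r c r' c'. (r, c) \<in> shifted_diagram (sh U) \<and> (r', c') \<in> shifted_diagram (sh U) \<and>
     snd U (r, c) = i \<and> snd U (r', c') = i + 1 \<and> r' \<le> r \<and> c < c')"

definition is_descent :: "shifted_tableau \<Rightarrow> nat \<Rightarrow> bool" where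
  "is_descent U i \<longleftrightarrow> (\<exists>r c r' c'. (r, c) \<in> shifted_diagram (sh U) \<and> (r', c') \<in> shifted_diagram (sh U) \<and>
     snd U (r, c) = i \<and> snd U (r', c') = i + 1 \<and> r < r' \<and> c' \<le> c)"

definition AltShSYT :: "nat \<Rightarrow> shifted_tableau set" where
  "AltShSYT N = {U \<in> ShSYT N.
     \<forall>i\<in>{1..N - 1}. (odd i \<longrightarrow> is_ascent U i) \<and> (even i \<longrightarrow> is_descent U i)}"

subsection \<open>Finiteness\<close>

lemma finite_diagram: "finite (diagram lam)"
proof -
  have "diagram lam = (SIGMA i:{..<length lam}. {..<lam ! i})"
    by (auto simp: diagram_def)
  thus ?thesis by simp
qed

lemma finite_shifted_diagram: "finite (shifted_diagram lam)"
proof -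
  have "shifted_diagram lam = (SIGMA i:{..<length lam}. {i..<i + lam ! i})"
    by (auto simp: shifted_diagram_def)
  thus ?thesis by simp
qed

lemma finite_weight_set:
  fixes idx :: "'a \<Rightarrow> nat" and a :: monomial
  assumes D: "finite D" and A: "A \<subseteq> extensional D" and idx: "\<And>k. finite (idx -` {k})"
  shows "finite {T \<in> A. \<forall>i. Poly_Mapping.lookup a i = card {c \<in> D. idx (T c) = i}}"
proof (rule finite_subset)
  have "idx -` Poly_Mapping.keys a = (\<Union>k\<in>Poly_Mapping.keys a. idx -` {k})"
    by auto
  hence "finite (idx -` Poly_Mapping.keys a)"
    using idx by simp
  thus "finite (D \<rightarrow>\<^sub>E idx -` Poly_Mapping.keys a)"
    using D by (intro finite_PiE) auto
  show "{T \<in> A. \<forall>i. Poly_Mapping.lookup a i = card {c \<in> D. idx (T c) = i}}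
          \<subseteq> D \<rightarrow>\<^sub>E idx -` Poly_Mapping.keys a"
  proof
    fix T assume "T \<in> {T \<in> A. \<forall>i. Poly_Mapping.lookup a i = card {c \<in> D. idx (T c) = i}}"
    hence T: "T \<in> A" and w: "\<And>i. Poly_Mapping.lookup a i = card {c \<in> D. idx (T c) = i}"
      by auto
    have "idx (T c) \<in> Poly_Mapping.keys a" if "c \<in> D" for c
    proof -
      have "card {d \<in> D. idx (T d) = idx (T c)} \<noteq> 0"
        using D that by auto
      thus ?thesis by (simp add: in_keys_iff w)
    qed
    thus "T \<in> D \<rightarrow>\<^sub>E idx -` Poly_Mapping.keys a"
      using T A by (auto simp: PiE_def)
  qed
qed

lemma finite_skew_schur_coeff:
  assumes "D = diagram lam - diagram mu"
  shows "finite {T \<in> SSYT D. \<forall>i. Poly_Mapping.lookup a i = card {c \<in> D. id (T c) = i}}"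
  by (rule finite_weight_set) (auto simp: assms finite_diagram SSYT_def PiE_def)

lemma finite_schur_P_coeff:
  "finite {T \<in> ShSSYT lam. \<forall>i. Poly_Mapping.lookup a i
             = card {c \<in> shifted_diagram lam. letter_index (T c) = i}}"
proof (rule finite_weight_set)
  show "finite (letter_index -` {k})" for k
  proof (rule finite_subset)
    show "letter_index -` {k} \<subseteq> {Primed k, Unprimed k}"
    proof
      fix x assume "x \<in> letter_index -` {k}"
      thus "x \<in> {Primed k, Unprimed k}" by (cases x) auto
    qed
  qed simp
qed (auto simp: finite_shifted_diagram ShSSYT_def PiE_def Let_def)

lemma finite_ShSYT: "finite (ShSYT N)"
proof (rule finite_subset)
  let ?L = "{lam :: nat list. set lam \<subseteq> {..N} \<and> length lam \<le> N}"
  show "finite (SIGMA lam:?L. shifted_diagram lam \<rightarrow>\<^sub>E {1..N})"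
    by (intro finite_SigmaI finite_lists_length_le finite_PiE finite_shifted_diagram) auto
  have len: "length lam \<le> sum_list lam" if "0 \<notin> set lam" for lam :: "nat list"
    using that by (induction lam) auto
  have mem: "x \<le> sum_list lam" if "x \<in> set lam" for x and lam :: "nat list"
    using that by (induction lam) auto
  show "ShSYT N \<subseteq> (SIGMA lam:?L. shifted_diagram lam \<rightarrow>\<^sub>E {1..N})"
    using len mem
    by (auto simp: ShSYT_def Let_def strict_partition_def PiE_def bij_betw_def)
qed

lemma finite_AltShSYT: "finite (AltShSYT N)"
  using finite_ShSYT by (simp add: AltShSYT_def)

end

theory Submission
  imports Defs "HOL-Computational_Algebra.Polynomial"
begin

text \<open>
  Both sides are sums over zigzag words.  A filling of the zigzag shape is a zigzag word in the
  commuting variables; an alternating shifted standard tableau is the zigzag word of the contents of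
  its cells, a word in the operators that add a box of given content to a shifted shape.  For every
  relation \<open>R\<close> on letters, cutting a word that is zigzag on a prefix of odd length and has no peak
  afterwards expresses the sum over zigzag words recursively through the sums over peakless words.
  A peakless word is a weakly decreasing word followed by an increasing one in exactly two ways, so
  twice the sum over peakless words of length \<open>k\<close> is \<open>q\<^sub>k = \<Sum>\<^sub>i h\<^sub>i e\<^bsub>k - i\<^esub>\<close> in the first
  setting, and in the second one it is the operator that adds a strip of size \<open>k\<close> with the weights
  of the Schur \<open>Q\<close>-functions.  The two recursions agree by the Pieri rule for \<open>q\<^sub>k P\<^sub>\<mu>\<close>.

  The Pieri rule is proved by induction on the number of variables: the operators \<open>D(x)\<close> that
  removes and \<open>U(y)\<close> that adds a strip satisfy \<open>(1 - x y) D(x) U(y) = (1 + x y) U(y) D(x)\<close>, which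
  follows diagonal by diagonal from an intertwining relation between two by two transfer matrices.
\<close>

section \<open>Shapes and strips\<close>

text \<open>The operators that add a box do not commute, so the letters of a content word cannot be
  treated like variables. The recursion avoids this: a cut leaves the step at the junction free, and
  the factor on the right of the cut enters only through the sum over peakless words. Nothing is
  needed about its decreasing and increasing runs separately. After the linear map that sends a
  shape to its polynomial, that sum acts as multiplication by the ordinary q of the same degree, and
  this is the only fact that the two settings have to share. Recording diagonal lengths rather than
  parts makes both the shape condition and the strip condition local in the content, which is what a
  transfer matrix needs. The intertwining matrix has trace 0 and its square is (1 + t)^2 times the
  identity. So it carries each of the two sides to the other, and the two kinds of diagonal steps
  can exchange their roles. Shapes with infinitely many variables never occur in the argument: one
  coefficient of the series is computed with finitely many variables.\<close>

text \<open>
  A strict partition is encoded by the function that maps \<open>k\<close> to the number of its parts larger than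
  \<open>k\<close>, that is, to the length of the \<open>k\<close>-th diagonal of its shifted diagram.
\<close>

definition shape :: "(nat \<Rightarrow> nat) \<Rightarrow> bool" where
  "shape f \<longleftrightarrow> (\<forall>k. f (Suc k) \<le> f k \<and> f k \<le> Suc (f (Suc k))) \<and> (\<exists>K. f K = 0)"

definition area :: "(nat \<Rightarrow> nat) \<Rightarrow> nat" where
  "area f = (\<Sum>k | f k \<noteq> 0. f k)"

text \<open>At most one new box on each diagonal, that is, no two by two square: the region that the
  letters of a single index can fill.\<close>

definition strip :: "(nat \<Rightarrow> nat) \<Rightarrow> (nat \<Rightarrow> nat) \<Rightarrow> bool" where
  "strip f g \<longleftrightarrow> (\<forall>k. f k \<le> g k \<and> g k \<le> Suc (f k))"

text \<open>
  In a strip the mark of a box is forced by its neighbour of the preceding content, and otherwise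
  free.  So \<open>P_weight\<close> counts the ways to mark the strip by \<open>k'\<close> and \<open>k\<close> without a mark on the main
  diagonal, where the box is unprimed, and \<open>Q_weight\<close> counts them without this restriction.
\<close>

definition strip_starts :: "(nat \<Rightarrow> nat) \<Rightarrow> (nat \<Rightarrow> nat) \<Rightarrow> nat set" where
  "strip_starts f g = {k. f k = g k \<and> f (Suc k) < g (Suc k)}"

definition P_weight :: "(nat \<Rightarrow> nat) \<Rightarrow> (nat \<Rightarrow> nat) \<Rightarrow> int" where
  "P_weight f g = (if strip f g then 2 ^ card (strip_starts f g) else 0)"

definition Q_weight :: "(nat \<Rightarrow> nat) \<Rightarrow> (nat \<Rightarrow> nat) \<Rightarrow> int" where
  "Q_weight f g = (if f 0 < g 0 then 2 else 1) * P_weight f g"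

lemma shape_step: "shape f \<Longrightarrow> f (Suc k) \<le> f k" "shape f \<Longrightarrow> f k \<le> Suc (f (Suc k))"
  by (auto simp: shape_def)

lemma shape_antimono:
  assumes "shape f" "k \<le> l"
  shows "f l \<le> f k"
  using assms(2)
proof (induction rule: dec_induct)
  case (step n)
  then show ?case using shape_step(1)[OF assms(1), of n] by linarith
qed simp

lemma shape_drop:
  assumes "shape f" "k \<le> l"
  shows "f k \<le> f l + (l - k)"
  using assms(2)
proof (induction rule: dec_induct)
  case (step n)
  then show ?case using shape_step(2)[OF assms(1), of n] by linarith
qed simp

lemma shape_zero: "shape f \<Longrightarrow> f K = 0 \<Longrightarrow> K \<le> k \<Longrightarrow> f k = 0"
  using shape_antimono[of f K k] by simp

lemma area_eq:
  assumes "shape f" "f K = 0"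
  shows "area f = sum f {..<K}"
  unfolding area_def
proof (rule sum.mono_neutral_left)
  show "{k. f k \<noteq> 0} \<subseteq> {..<K}"
  proof
    fix k assume "k \<in> {k. f k \<noteq> 0}"
    thus "k \<in> {..<K}" using shape_zero[OF assms, of k] by (cases "K \<le> k") auto
  qed
qed auto

text \<open>Each of the diagonals \<open>0\<close> to \<open>k\<close> contributes at least one box.
  The bound of contents by the area makes the sets of shapes and the alphabets of contents
  finite.\<close>

lemma shape_support:
  assumes "shape f" "f k \<noteq> 0"
  shows "k < area f"
proof -
  obtain K where K: "f K = 0" using assms(1) by (auto simp: shape_def)
  have "k < K" using shape_zero[OF assms(1) K, of k] assms(2) by (cases "K \<le> k") auto
  have "Suc k = (\<Sum>j<Suc k. 1)" by simp
  also have "\<dots> \<le> (\<Sum>j<Suc k. f j)"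
  proof (rule sum_mono)
    fix j assume "j \<in> {..<Suc k}"
    hence "f k \<le> f j" using shape_antimono[OF assms(1), of j k] by simp
    thus "1 \<le> f j" using assms(2) by simp
  qed
  also have "\<dots> \<le> sum f {..<K}" using \<open>k < K\<close> by (intro sum_mono2) auto
  finally show ?thesis using area_eq[OF assms(1) K] by simp
qed

lemma shape_vanish: "shape f \<Longrightarrow> area f \<le> k \<Longrightarrow> f k = 0"
  using shape_support[of f k] by (cases "f k = 0") auto

lemma shape_le_size: "shape f \<Longrightarrow> f k \<le> area f"
proof -
  assume f: "shape f"
  show "f k \<le> area f"
  proof (cases "f k = 0")
    case False
    have "f k \<le> sum f {..<area f}"
      using shape_support[OF f False] by (intro member_le_sum) auto
    then show ?thesis using area_eq[OF f shape_vanish[OF f order.refl]] by linarith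
  qed simp
qed

lemma finite_shapes: "finite {f. shape f \<and> area f \<le> N}"
proof (rule finite_subset)
  let ?S = "{f. \<forall>k. (k \<in> {..<N} \<longrightarrow> f k \<in> {..N}) \<and> (k \<notin> {..<N} \<longrightarrow> f k = (0::nat))}"
  show "finite ?S" by (rule finite_set_of_finite_funs) auto
  show "{f. shape f \<and> area f \<le> N} \<subseteq> ?S"
  proof
    fix f assume "f \<in> {f. shape f \<and> area f \<le> N}"
    hence f: "shape f" "area f \<le> N" by auto
    have "f k \<le> N" for k using shape_le_size[OF f(1), of k] f(2) by simp
    moreover have "f k = 0" if "N \<le> k" for k using shape_vanish[OF f(1), of k] f(2) that by simp
    ultimately show "f \<in> ?S" by auto
  qed
qed

lemma finite_shapes_eq: "finite {f. shape f \<and> area f = N}"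
  by (rule finite_subset[OF _ finite_shapes[of N]]) auto

lemma strip_area_le:
  assumes "shape f" "shape g" "strip f g"
  shows "area f \<le> area g"
proof -
  have z: "g (area g) = 0" by (rule shape_vanish[OF assms(2) order.refl])
  have z': "f (area g) = 0" using assms(3)[unfolded strip_def, rule_format, of "area g"] z by simp
  have "sum f {..<area g} \<le> sum g {..<area g}"
    by (rule sum_mono) (use assms(3) in \<open>auto simp: strip_def\<close>)
  thus ?thesis using area_eq[OF assms(1) z'] area_eq[OF assms(2) z] by linarith
qed


section \<open>Commuting the removal and the addition of a strip\<close>

primrec transfer :: "(bool \<Rightarrow> 'a) \<Rightarrow> (nat \<Rightarrow> bool \<Rightarrow> bool \<Rightarrow> 'a) \<Rightarrow> nat \<Rightarrow> bool \<Rightarrow> 'a::comm_ring_1" where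
  "transfer ini \<phi> 0 e = ini e"
| "transfer ini \<phi> (Suc k) e = transfer ini \<phi> k False * \<phi> k False e + transfer ini \<phi> k True * \<phi> k True e"

text \<open>A weight that factors over neighbouring diagonals can be summed one diagonal at a time,
  since the next factor depends only on the membership of the last diagonal.\<close>

lemma transfer_sum:
  "(\<Sum>A | A \<subseteq> {..k} \<and> (k \<in> A \<longleftrightarrow> e). ini (0 \<in> A) * (\<Prod>j<k. \<phi> j (j \<in> A) (Suc j \<in> A)))
    = transfer ini \<phi> k e"
proof (induction k arbitrary: e)
  case 0
  have "{A. A \<subseteq> {..0::nat} \<and> (0 \<in> A \<longleftrightarrow> e)} = {if e then {0} else {}}"
    by (auto simp: subset_singleton_iff)
  then show ?case by simp
next
  case (Suc k)
  let ?F = "\<lambda>k A. ini (0 \<in> A) * (\<Prod>j<k. \<phi> j (j \<in> A) (Suc j \<in> A))"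
  let ?S = "\<lambda>d. {A. A \<subseteq> {..k} \<and> (k \<in> A \<longleftrightarrow> d)}"
  let ?ins = "\<lambda>A. if e then insert (Suc k) A else A"
  have fin: "finite (?S d)" for d by (rule finite_subset[of _ "Pow {..k}"]) auto
  have img: "{A. A \<subseteq> {..Suc k} \<and> (Suc k \<in> A \<longleftrightarrow> e)} = ?ins ` (?S False \<union> ?S True)"
  proof (intro set_eqI iffI)
    fix A assume A: "A \<in> {A. A \<subseteq> {..Suc k} \<and> (Suc k \<in> A \<longleftrightarrow> e)}"
    hence "A = ?ins (A - {Suc k})" "A - {Suc k} \<in> ?S False \<union> ?S True"
      by (auto simp: subset_iff le_Suc_eq)
    thus "A \<in> ?ins ` (?S False \<union> ?S True)" by blast
  qed (auto simp: subset_iff le_Suc_eq split: if_splits)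
  have inj: "inj_on ?ins (?S False \<union> ?S True)"
  proof (rule inj_onI)
    fix A B assume AB: "A \<in> ?S False \<union> ?S True" "B \<in> ?S False \<union> ?S True" "?ins A = ?ins B"
    hence "Suc k \<notin> A" "Suc k \<notin> B" by auto
    thus "A = B" using AB(3) by (metis insert_ident)
  qed
  have step: "?F (Suc k) (?ins A) = ?F k A * \<phi> k d e" if "A \<in> ?S d" for A d
  proof -
    have "Suc k \<notin> A" using that by auto
    moreover have "(\<Prod>j<k. \<phi> j (j \<in> ?ins A) (Suc j \<in> ?ins A)) = (\<Prod>j<k. \<phi> j (j \<in> A) (Suc j \<in> A))"
      by (rule prod.cong) auto
    ultimately show ?thesis using that by (auto simp: mult.assoc)
  qed
  have "(\<Sum>A | A \<subseteq> {..Suc k} \<and> (Suc k \<in> A \<longleftrightarrow> e). ?F (Suc k) A)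
      = (\<Sum>A\<in>?S False \<union> ?S True. ?F (Suc k) (?ins A))"
    unfolding img by (subst sum.reindex[OF inj]) simp
  also have "\<dots> = (\<Sum>A\<in>?S False. ?F (Suc k) (?ins A)) + (\<Sum>A\<in>?S True. ?F (Suc k) (?ins A))"
    by (rule sum.union_disjoint) (use fin in auto)
  also have "\<dots> = (\<Sum>A\<in>?S False. ?F k A * \<phi> k False e) + (\<Sum>A\<in>?S True. ?F k A * \<phi> k True e)"
    using step[of _ False] step[of _ True] by (intro arg_cong2[of _ _ _ _ "(+)"] sum.cong refl)
  also have "\<dots> = transfer ini \<phi> (Suc k) e"
    by (simp only: sum_distrib_right[symmetric] Suc transfer.simps)
  finally show ?case .
qed

section \<open>Local weights of a pair of shapes\<close>

abbreviation tvar :: "int poly" where "tvar \<equiv> [:0, 1:]"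

text \<open>
  A shape \<open>\<nu>\<close> with strips from \<open>f\<close> and \<open>g\<close> to \<open>\<nu>\<close> is determined by the set \<open>A\<close> of diagonals on which
  \<open>f\<close> and \<open>g\<close> agree and \<open>\<nu>\<close> is larger; a shape \<open>\<rho>\<close> with strips from \<open>\<rho>\<close> to \<open>f\<close> and \<open>g\<close> likewise.  The
  weights of \<open>\<nu>\<close> (\<open>up = True\<close>) and of \<open>\<rho>\<close> (\<open>up = False\<close>) are products over neighbouring diagonals, with
  a variable marking the elements of \<open>A\<close>.
\<close>

definition start_wt :: "(nat \<Rightarrow> nat) \<Rightarrow> (nat \<Rightarrow> nat) \<Rightarrow> bool \<Rightarrow> int poly" where
  "start_wt f g a = (if f 0 = g 0 then (if a then 2 * tvar else 1)
                 else if a then 0 else if f 0 < g 0 then 2 else 1)"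

text \<open>Every strip that starts on diagonal \<open>Suc k\<close> gives a factor 2:
  \<open>4 * tvar\<close> belongs to a start in both strips, \<open>2\<close> and
  \<open>2 * tvar\<close> to a start in one. The zeros exclude diagonals in \<open>A\<close> on
  which \<open>f\<close> and \<open>g\<close> differ, and sets for which the shape condition between
  the two diagonals fails. Where \<open>f\<close> and \<open>g\<close> agree on both diagonals,
  switching \<open>up\<close> exchanges the matrices of the cases \<open>f k = f (Suc k)\<close> and
  \<open>f k \<noteq> f (Suc k)\<close>.\<close>

definition step_wt :: "(nat \<Rightarrow> nat) \<Rightarrow> (nat \<Rightarrow> nat) \<Rightarrow> bool \<Rightarrow> nat \<Rightarrow> bool \<Rightarrow> bool \<Rightarrow> int poly" where
  "step_wt f g up k a b =
    (if f k = g k then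
       if f (Suc k) = g (Suc k) then
         if a then if b then tvar else if (f k = f (Suc k)) = up then 1 else 0
         else if b then if (f k = f (Suc k)) = up then 0 else 4 * tvar else 1
       else if b then 0 else if a then 1 else 2
     else if a then 0
     else if f (Suc k) = g (Suc k) then if b then 2 * tvar else 1
     else if b then 0 else 1)"

abbreviation path_wt :: "(nat \<Rightarrow> nat) \<Rightarrow> (nat \<Rightarrow> nat) \<Rightarrow> nat \<Rightarrow> bool \<Rightarrow> nat set \<Rightarrow> int poly" where
  "path_wt f g K up A \<equiv> start_wt f g (0 \<in> A) * (\<Prod>j<K. step_wt f g up j (j \<in> A) (Suc j \<in> A))"

text \<open>
  The matrix with rows \<open>(1 - t, 4 t)\<close> and \<open>(1, t - 1)\<close> intertwines the transfer matrices of the two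
  sides.
\<close>

lemma transfer_invariant:
  fixes f g
  defines "v \<equiv> transfer (start_wt f g) (step_wt f g True)"
    and "u \<equiv> transfer (start_wt f g) (step_wt f g False)"
  shows "if f k = g k then (1 - tvar) * v k False + v k True = (1 + tvar) * u k False \<and>
            4 * tvar * v k False + (tvar - 1) * v k True = (1 + tvar) * u k True
         else v k False = u k False \<and> v k True = 0 \<and> u k True = 0"
proof (induction k)
  case 0
  define T where "T = tvar"
  show ?case unfolding v_def u_def T_def[symmetric]
    by (simp add: start_wt_def T_def[symmetric] algebra_simps)
next
  case (Suc k)
  define a b c d where "a = v k False" and "b = v k True" and "c = u k False" and "d = u k True"
  define T where "T = tvar"
  have T0: "1 + T \<noteq> 0" unfolding T_def by (simp add: one_pCons)
  have v: "v (Suc k) e = a * step_wt f g True k False e + b * step_wt f g True k True e" for e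
    unfolding v_def a_def b_def by simp
  have u: "u (Suc k) e = c * step_wt f g False k False e + d * step_wt f g False k True e" for e
    unfolding u_def c_def d_def by simp
  show ?case
  proof (cases "f k = g k")
    case True
    have 1: "(1 - T) * a + b = (1 + T) * c" and 2: "4 * T * a + (T - 1) * b = (1 + T) * d"
      using Suc True unfolding a_def b_def c_def d_def T_def by auto
    show ?thesis
    proof (cases "f (Suc k) = g (Suc k)")
      case False
      \<comment> \<open>Twice the first relation plus the second; the common factor
        \<open>1 + T\<close> can be cancelled.\<close>
      have "(1 + T) * (2 * c + d) = (1 + T) * (2 * a + b)"
        using 1 2 by algebra
      hence "2 * c + d = 2 * a + b" using T0 by simp
      thus ?thesis using True False unfolding v u by (simp add: step_wt_def T_def[symmetric] algebra_simps)
    next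
      case E: True
      show ?thesis
      proof (cases "f k = f (Suc k)")
        \<comment> \<open>Here the matrix for \<open>up = True\<close> is lower triangular and the
          one for \<open>up = False\<close> upper triangular; in the other case they change
          places.\<close>
        case eq: True
        have "(1 - T) * (a + b) + T * b = (1 + T) * c" using 1 by algebra
        moreover have "4 * T * (a + b) + (T - 1) * (T * b) = (1 + T) * (4 * T * c + T * d)"
          using 1 2 by algebra
        ultimately show ?thesis using E True eq unfolding v u
          by (simp add: step_wt_def T_def[symmetric] mult_ac)
      next
        case neq: False
        have "(1 - T) * a + (4 * T * a + T * b) = (1 + T) * (c + d)" using 1 2 by algebra
        moreover have "4 * T * a + (T - 1) * (4 * T * a + T * b) = (1 + T) * (T * d)"
          using 1 2 by algebra
        ultimately show ?thesis using E True neq unfolding v u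
          by (simp add: step_wt_def T_def[symmetric] mult_ac)
      qed
    qed
  next
    case False
    hence "a = c" "b = 0" "d = 0" using Suc unfolding a_def b_def c_def d_def by auto
    thus ?thesis using False unfolding v u
      by (simp add: step_wt_def T_def[symmetric] algebra_simps)
  qed
qed

text \<open>Beyond both shapes a box of the upper shape can only continue a run from the preceding
  diagonal, and each continuation costs a factor \<open>tvar\<close>. So the component
  \<open>True\<close>, an error term in the invariant, is pushed beyond any given degree.\<close>

lemma transfer_tail:
  assumes "\<And>k. K \<le> k \<Longrightarrow> f k = 0" "\<And>k. K \<le> k \<Longrightarrow> g k = 0"
  shows "tvar ^ L dvd transfer (start_wt f g) (step_wt f g True) (K + L) True"
proof (induction L)
  case (Suc L)
  then show ?case using assms by (simp add: step_wt_def mult.commute mult_dvd_mono del: mult_pCons_left mult_pCons_right)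
qed simp

section \<open>Upper and lower shapes as sets of diagonals\<close>

definition outer :: "(nat \<Rightarrow> nat) \<Rightarrow> (nat \<Rightarrow> nat) \<Rightarrow> nat set \<Rightarrow> nat \<Rightarrow> nat" where
  "outer f g A k = max (f k) (g k) + of_bool (k \<in> A)"

text \<open>The subtraction is truncated, so this describes a lower shape only if \<open>f\<close>
  is positive on \<open>A\<close>; \<open>core_posI\<close> derives that from a nonzero
  weight.\<close>

definition core :: "(nat \<Rightarrow> nat) \<Rightarrow> (nat \<Rightarrow> nat) \<Rightarrow> nat set \<Rightarrow> nat \<Rightarrow> nat" where
  "core f g A k = min (f k) (g k) - of_bool (k \<in> A)"

lemma prod_if_card:
  fixes c :: "'a::comm_semiring_1"
  shows "finite S \<Longrightarrow> (\<Prod>j\<in>S. if P j then c else 1) = c ^ card {j \<in> S. P j}"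
  by (simp add: prod.If_cases Int_def)

lemma P_weight_prod:
  assumes "strip f g" "\<And>k. K \<le> k \<Longrightarrow> g k = 0"
  shows "of_int (P_weight f g) = (\<Prod>j<K. if f j = g j \<and> f (Suc j) < g (Suc j) then 2 else (1 :: 'a::comm_ring_1))"
proof -
  have "strip_starts f g = {j \<in> {..<K}. f j = g j \<and> f (Suc j) < g (Suc j)}"
  proof -
    have "k < K" if "f (Suc k) < g (Suc k)" for k
      using assms(2)[of "Suc k"] that by (cases "k < K") auto
    thus ?thesis by (auto simp: strip_starts_def)
  qed
  thus ?thesis using assms(1) by (simp add: P_weight_def prod_if_card)
qed

lemma prod_mark_card:
  fixes t :: "'a::comm_semiring_1"
  assumes "A \<subseteq> {..<K}"
  shows "(if 0 \<in> A then t else 1) * (\<Prod>j<K. if Suc j \<in> A then t else 1) = t ^ card A"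
proof -
  have "(if 0 \<in> A then t else 1) * (\<Prod>j<K. if Suc j \<in> A then t else 1) = (\<Prod>j<Suc K. if j \<in> A then t else 1)"
    by (subst prod.lessThan_Suc_shift) simp
  also have "\<dots> = t ^ card {j \<in> {..<Suc K}. j \<in> A}" by (rule prod_if_card) simp
  also have "{j \<in> {..<Suc K}. j \<in> A} = A" using assms by auto
  finally show ?thesis .
qed

context
  fixes f g :: "nat \<Rightarrow> nat" and K :: nat and A :: "nat set"
  assumes f: "shape f" and g: "shape g" and fK: "f K = 0" and gK: "g K = 0"
    and near: "\<And>k. f k \<le> Suc (g k)" "\<And>k. g k \<le> Suc (f k)"
    and A: "A \<subseteq> {..<K}"
begin

lemma strip_outer_shape:
  assumes "\<And>k. k \<in> A \<Longrightarrow> f k = g k"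
  shows "strip f (outer f g A)" "strip g (outer f g A)"
  using near assms by (auto simp: strip_def outer_def max_def)

lemma strip_core_shape:
  assumes "\<And>k. k \<in> A \<Longrightarrow> f k = g k \<and> 0 < f k"
  shows "strip (core f g A) f" "strip (core f g A) g"
  using near assms by (force simp: strip_def core_def min_def le_Suc_eq)+

text \<open>The two drops and the difference on diagonal \<open>Suc j\<close> admit twelve
  combinations, two of which would make \<open>f j\<close> and \<open>g j\<close> differ by 2. With
  the smallest value named \<open>x\<close>, claims about the remaining ten become arithmetic of
  successors.\<close>

lemma step_cases:
  obtains
    (1) x where "f j = x" "g j = x" "f (Suc j) = x" "g (Suc j) = x"
  | (2) x where "f j = Suc x" "g j = Suc x" "f (Suc j) = x" "g (Suc j) = x"
  | (3) x where "f j = Suc x" "g j = x" "f (Suc j) = x" "g (Suc j) = x"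
  | (4) x where "f j = x" "g j = Suc x" "f (Suc j) = x" "g (Suc j) = x"
  | (5) x where "f j = Suc x" "g j = x" "f (Suc j) = Suc x" "g (Suc j) = x"
  | (6) x where "f j = Suc x" "g j = Suc x" "f (Suc j) = Suc x" "g (Suc j) = x"
  | (7) x where "f j = Suc (Suc x)" "g j = Suc x" "f (Suc j) = Suc x" "g (Suc j) = x"
  | (8) x where "f j = x" "g j = Suc x" "f (Suc j) = x" "g (Suc j) = Suc x"
  | (9) x where "f j = Suc x" "g j = Suc x" "f (Suc j) = x" "g (Suc j) = Suc x"
  | (10) x where "f j = Suc x" "g j = Suc (Suc x)" "f (Suc j) = x" "g (Suc j) = Suc x"
proof -
  have "f j = f (Suc j) \<or> f j = Suc (f (Suc j))" "g j = g (Suc j) \<or> g j = Suc (g (Suc j))"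
    "f (Suc j) = g (Suc j) \<or> f (Suc j) = Suc (g (Suc j)) \<or> g (Suc j) = Suc (f (Suc j))"
    using shape_step[OF f, of j] shape_step[OF g, of j] near[of "Suc j"] by linarith+
  thus ?thesis using that near[of j] by (elim disjE) simp_all
qed

lemma step_wt_outer:
  assumes E: "\<And>k. k \<in> A \<Longrightarrow> f k = g k" and S: "shape (outer f g A)"
  shows "step_wt f g True j (j \<in> A) (Suc j \<in> A) =
    (if f j = outer f g A j \<and> f (Suc j) < outer f g A (Suc j) then 2 else 1) *
    (if g j = outer f g A j \<and> g (Suc j) < outer f g A (Suc j) then 2 else 1) *
    (if Suc j \<in> A then tvar else 1)"
proof -
  define T where "T = tvar"
  note st = shape_step[OF f, of j] shape_step[OF g, of j] near[of j] near[of "Suc j"]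
    shape_step[OF S, of j] E[of j] E[of "Suc j"]
  show ?thesis unfolding T_def[symmetric] step_wt_def
    using st unfolding outer_def
    by - (rule step_cases[of j]; cases "j \<in> A"; cases "Suc j \<in> A"; simp)
qed

lemma start_wt_outer:
  assumes E: "\<And>k. k \<in> A \<Longrightarrow> f k = g k"
  shows "start_wt f g (0 \<in> A) = (if f 0 < outer f g A 0 then 2 else 1) * (if 0 \<in> A then tvar else 1)"
  using E[of 0] by (auto simp: start_wt_def outer_def)

lemma step_wt_core:
  assumes E: "\<And>k. k \<in> A \<Longrightarrow> f k = g k \<and> 0 < f k" and S: "shape (core f g A)"
  shows "step_wt f g False j (j \<in> A) (Suc j \<in> A) =
    (if core f g A j = g j \<and> core f g A (Suc j) < g (Suc j) then 2 else 1) *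
    (if core f g A j = f j \<and> core f g A (Suc j) < f (Suc j) then 2 else 1) *
    (if Suc j \<in> A then tvar else 1)"
proof -
  define T where "T = tvar"
  note st = shape_step[OF f, of j] shape_step[OF g, of j] near[of j] near[of "Suc j"]
    shape_step[OF S, of j] E[of j] E[of "Suc j"]
  show ?thesis unfolding T_def[symmetric] step_wt_def
    using st unfolding core_def
    by - (rule step_cases[of j]; cases "j \<in> A"; cases "Suc j \<in> A"; simp)
qed

lemma start_wt_core:
  assumes E: "\<And>k. k \<in> A \<Longrightarrow> f k = g k \<and> 0 < f k"
  shows "start_wt f g (0 \<in> A) = (if core f g A 0 < g 0 then 2 else 1) * (if 0 \<in> A then tvar else 1)"
  using E[of 0] by (auto simp: start_wt_def core_def min_def)

text \<open>The zeros of the weights encode the constraints on \<open>A\<close>; here the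
  constraints are read back from a product that does not vanish.\<close>

lemma path_wt_nonzero:
  assumes nz: "path_wt f g K up A \<noteq> 0"
  shows "k \<in> A \<Longrightarrow> f k = g k" "j < K \<Longrightarrow> step_wt f g up j (j \<in> A) (Suc j \<in> A) \<noteq> 0"
proof -
  have 0: "start_wt f g (0 \<in> A) \<noteq> 0" using nz by auto
  have s: "step_wt f g up j (j \<in> A) (Suc j \<in> A) \<noteq> 0" if "j < K" for j
    using nz that by auto
  show "j < K \<Longrightarrow> step_wt f g up j (j \<in> A) (Suc j \<in> A) \<noteq> 0" by (rule s)
  show "f k = g k" if k: "k \<in> A"
  proof (cases k)
    case 0
    then show ?thesis using \<open>start_wt f g (0 \<in> A) \<noteq> 0\<close> k by (auto simp: start_wt_def split: if_splits)
  next
    case (Suc j)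
    then show ?thesis using s[of j] k A by (auto simp: step_wt_def split: if_splits)
  qed
qed

lemma shape_zero_tail: "K \<le> k \<Longrightarrow> f k = 0" "K \<le> k \<Longrightarrow> g k = 0"
  using shape_zero[OF f fK] shape_zero[OF g gK] by auto

lemma outer_tail: "K \<le> k \<Longrightarrow> outer f g A k = 0"
  using shape_zero_tail[of k] A by (auto simp: outer_def)

lemma core_tail: "K \<le> k \<Longrightarrow> core f g A k = 0"
  using shape_zero_tail[of k] by (auto simp: core_def)

lemma shape_outer_shapeI:
  assumes nz: "path_wt f g K True A \<noteq> 0"
  shows "shape (outer f g A)"
  unfolding shape_def
proof (intro conjI allI exI)
  show "outer f g A K = 0" by (rule outer_tail) simp
  fix j
  note st = shape_step[OF f, of j] shape_step[OF g, of j] near[of j] near[of "Suc j"]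
    path_wt_nonzero(1)[OF nz, of j] path_wt_nonzero(1)[OF nz, of "Suc j"]
  have "outer f g A (Suc j) \<le> outer f g A j \<and> outer f g A j \<le> Suc (outer f g A (Suc j))"
  proof (cases "j < K")
    case True
    show ?thesis using path_wt_nonzero(2)[OF nz True] st unfolding outer_def step_wt_def
      by - (rule step_cases[of j]; cases "j \<in> A"; cases "Suc j \<in> A"; simp)
  qed (simp add: outer_tail)
  thus "outer f g A (Suc j) \<le> outer f g A j" "outer f g A j \<le> Suc (outer f g A (Suc j))" by auto
qed

text \<open>If both shapes vanish on a diagonal of \<open>A\<close>, the zero entry for leaving
  \<open>A\<close> forces all later diagonals up to \<open>K\<close> into \<open>A\<close>, but
  \<open>A\<close> stays below \<open>K\<close>.\<close>

lemma core_posI: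
  assumes nz: "path_wt f g K False A \<noteq> 0"
    and k: "k \<in> A"
  shows "0 < f k"
proof (rule ccontr)
  assume "\<not> 0 < f k"
  hence z: "f k = 0" "g k = 0" using path_wt_nonzero(1)[OF nz k] by auto
  have "k < K" using A k by auto
  have "l \<le> K \<Longrightarrow> l \<in> A" if "k \<le> l" for l
    using that
  proof (induction rule: dec_induct)
    case (step l)
    have "f l = 0" "f (Suc l) = 0" "g l = 0" "g (Suc l) = 0"
      using shape_zero[OF f z(1)] shape_zero[OF g z(2)] step(1) by auto
    thus ?case using step path_wt_nonzero(2)[OF nz, of l] by (auto simp: step_wt_def split: if_splits)
  qed (use k in simp)
  hence "K \<in> A" using \<open>k < K\<close> by auto
  thus False using A by auto
qed

lemma shape_core_shapeI:
  assumes nz: "path_wt f g K False A \<noteq> 0"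
  shows "shape (core f g A)"
  unfolding shape_def
proof (intro conjI allI exI)
  show "core f g A K = 0" by (rule core_tail) simp
  fix j
  note st = shape_step[OF f, of j] shape_step[OF g, of j] near[of j] near[of "Suc j"]
    path_wt_nonzero(1)[OF nz, of j] path_wt_nonzero(1)[OF nz, of "Suc j"]
    core_posI[OF nz, of j] core_posI[OF nz, of "Suc j"]
  have "core f g A (Suc j) \<le> core f g A j \<and> core f g A j \<le> Suc (core f g A (Suc j))"
  proof (cases "j < K")
    case True
    show ?thesis using path_wt_nonzero(2)[OF nz True] st unfolding core_def step_wt_def
      by - (rule step_cases[of j]; cases "j \<in> A"; cases "Suc j \<in> A"; simp)
  qed (simp add: core_tail)
  thus "core f g A (Suc j) \<le> core f g A j" "core f g A j \<le> Suc (core f g A (Suc j))" by auto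
qed

text \<open>A sum of path weights over all subsets is therefore a sum over upper shapes only, the
  other subsets contributing zero.\<close>

lemma outer_weight:
  "path_wt f g K True A =
    (if (\<forall>k\<in>A. f k = g k) \<and> shape (outer f g A)
     then of_int (Q_weight f (outer f g A) * P_weight g (outer f g A)) * tvar ^ card A else 0)"
proof (cases "(\<forall>k\<in>A. f k = g k) \<and> shape (outer f g A)")
  case True
  hence E: "\<And>k. k \<in> A \<Longrightarrow> f k = g k" and S: "shape (outer f g A)" by auto
  let ?m = "\<lambda>j. if j \<in> A then tvar else 1" and ?c = "if f 0 < outer f g A 0 then 2 else 1 :: int poly"
  have p1: "(\<Prod>j<K. if f j = outer f g A j \<and> f (Suc j) < outer f g A (Suc j) then 2 else 1) = (of_int (P_weight f (outer f g A)) :: int poly)"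
    by (rule P_weight_prod[OF strip_outer_shape(1)[OF E] outer_tail, symmetric])
  have p2: "(\<Prod>j<K. if g j = outer f g A j \<and> g (Suc j) < outer f g A (Suc j) then 2 else 1) = (of_int (P_weight g (outer f g A)) :: int poly)"
    by (rule P_weight_prod[OF strip_outer_shape(2)[OF E] outer_tail, symmetric])
  have "path_wt f g K True A =
      ?c * (\<Prod>j<K. if f j = outer f g A j \<and> f (Suc j) < outer f g A (Suc j) then 2 else 1) * (\<Prod>j<K. if g j = outer f g A j \<and> g (Suc j) < outer f g A (Suc j) then 2 else 1) * (?m 0 * (\<Prod>j<K. ?m (Suc j)))"
    by (simp only: start_wt_outer[OF E] step_wt_outer[OF E S] prod.distrib mult_ac)
  also have "\<dots> = ?c * of_int (P_weight f (outer f g A)) * of_int (P_weight g (outer f g A)) * tvar ^ card A"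
    unfolding p1 p2 prod_mark_card[OF A] ..
  also have "?c * of_int (P_weight f (outer f g A)) = of_int (Q_weight f (outer f g A))"
    by (simp add: Q_weight_def)
  finally show ?thesis unfolding if_P[OF True] of_int_mult .
next
  case False
  then show ?thesis using shape_outer_shapeI path_wt_nonzero(1)[of True] by auto
qed

lemma core_weight:
  "path_wt f g K False A =
    (if (\<forall>k\<in>A. f k = g k \<and> 0 < f k) \<and> shape (core f g A)
     then of_int (Q_weight (core f g A) g * P_weight (core f g A) f) * tvar ^ card A else 0)"
proof (cases "(\<forall>k\<in>A. f k = g k \<and> 0 < f k) \<and> shape (core f g A)")
  case True
  hence E: "\<And>k. k \<in> A \<Longrightarrow> f k = g k \<and> 0 < f k" and S: "shape (core f g A)" by auto
  let ?m = "\<lambda>j. if j \<in> A then tvar else 1" and ?c = "if core f g A 0 < g 0 then 2 else 1 :: int poly"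
  have p1: "(\<Prod>j<K. if core f g A j = g j \<and> core f g A (Suc j) < g (Suc j) then 2 else 1) = (of_int (P_weight (core f g A) g) :: int poly)"
    by (rule P_weight_prod[OF strip_core_shape(2)[OF E] shape_zero_tail(2), symmetric])
  have p2: "(\<Prod>j<K. if core f g A j = f j \<and> core f g A (Suc j) < f (Suc j) then 2 else 1) = (of_int (P_weight (core f g A) f) :: int poly)"
    by (rule P_weight_prod[OF strip_core_shape(1)[OF E] shape_zero_tail(1), symmetric])
  have "path_wt f g K False A =
      ?c * (\<Prod>j<K. if core f g A j = g j \<and> core f g A (Suc j) < g (Suc j) then 2 else 1) * (\<Prod>j<K. if core f g A j = f j \<and> core f g A (Suc j) < f (Suc j) then 2 else 1) * (?m 0 * (\<Prod>j<K. ?m (Suc j)))"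
    by (simp only: start_wt_core[OF E] step_wt_core[OF E S] prod.distrib mult_ac)
  also have "\<dots> = ?c * of_int (P_weight (core f g A) g) * of_int (P_weight (core f g A) f) * tvar ^ card A"
    unfolding p1 p2 prod_mark_card[OF A] ..
  also have "?c * of_int (P_weight (core f g A) g) = of_int (Q_weight (core f g A) g)"
    by (simp add: Q_weight_def)
  finally show ?thesis unfolding if_P[OF True] of_int_mult .
next
  case False
  have "path_wt f g K False A = 0"
  proof (rule ccontr)
    assume nz: "path_wt f g K False A \<noteq> 0"
    show False
      using False path_wt_nonzero(1)[OF nz] core_posI[OF nz] shape_core_shapeI[OF nz] by blast
  qed
  thus ?thesis unfolding if_not_P[OF False] .
qed

end

section \<open>Sums over shapes of fixed area as coefficients\<close>

lemma tvar_power: "tvar ^ e = monom 1 e"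
  by (simp add: monom_altdef)

lemma coeff_of_int_X_power: "coeff (of_int w * tvar ^ e) m = (if m = e then w else 0)"
  by (auto simp: tvar_power of_int_poly)

text \<open>The component \<open>False\<close> at \<open>K\<close> collects the sets
  \<open>A\<close> below \<open>K\<close>. The shift by \<open>D\<close> turns the number of
  elements of \<open>A\<close> into a degree that is determined by the area of the shape.\<close>

lemma coeff_transfer:
  assumes "\<And>A. A \<subseteq> {..<K} \<Longrightarrow> path_wt f g K up A =
    (if P A then of_int (w A) * tvar ^ card A else 0)"
  shows "coeff (tvar ^ D * transfer (start_wt f g) (step_wt f g up) K False) m =
    (\<Sum>A\<in>{A \<in> Pow {..<K}. P A \<and> D + card A = m}. w A)"
proof -
  have "transfer (start_wt f g) (step_wt f g up) K False
      = (\<Sum>A | A \<subseteq> {..K} \<and> (K \<in> A \<longleftrightarrow> False). path_wt f g K up A)"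
    by (rule transfer_sum[symmetric])
  also have "{A. A \<subseteq> {..K} \<and> (K \<in> A \<longleftrightarrow> False)} = Pow {..<K}"
    by (auto simp: subset_iff order.order_iff_strict)
  finally have "tvar ^ D * transfer (start_wt f g) (step_wt f g up) K False
      = (\<Sum>A\<in>Pow {..<K}. tvar ^ D * (path_wt f g K up A))"
    by (simp only: sum_distrib_left)
  also have "\<dots> = (\<Sum>A\<in>Pow {..<K}. if P A then of_int (w A) * tvar ^ (D + card A) else 0)"
  proof (rule sum.cong[OF refl])
    fix A assume "A \<in> Pow {..<K}"
    hence "A \<subseteq> {..<K}" by simp
    thus "tvar ^ D * (path_wt f g K up A) = (if P A then of_int (w A) * tvar ^ (D + card A) else 0)"
      by (cases "P A") (simp_all only: assms if_True if_False power_add mult.left_commute[of "tvar ^ D"] mult_zero_right)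
  qed
  finally have "coeff (tvar ^ D * transfer (start_wt f g) (step_wt f g up) K False) m
      = (\<Sum>A\<in>Pow {..<K}. coeff (if P A then of_int (w A) * tvar ^ (D + card A) else 0) m)"
    by (simp only: coeff_sum)
  also have "\<dots> = (\<Sum>A\<in>Pow {..<K}. if P A \<and> D + card A = m then w A else 0)"
    by (rule sum.cong[OF refl]) (auto simp only: if_True if_False coeff_of_int_X_power coeff_0 split: if_splits)
  also have "\<dots> = (\<Sum>A\<in>{A \<in> Pow {..<K}. P A \<and> D + card A = m}. w A)"
    by (rule sum.inter_filter[symmetric]) simp
  finally show ?thesis .
qed

text \<open>The sum of the maxima counts the boxes that every upper shape must contain, and each
  element of \<open>A\<close> adds one more. The bound \<open>m \<le> K\<close> keeps the support of
  every \<open>\<nu>\<close> of area \<open>m\<close> below \<open>K\<close>.\<close>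

lemma sum_outer_eq_coeff:
  assumes f: "shape f" and g: "shape g" and K: "f K = 0" "g K = 0"
    and near: "\<And>k. f k \<le> Suc (g k)" "\<And>k. g k \<le> Suc (f k)" and m: "m \<le> K"
  shows "(\<Sum>\<nu> | shape \<nu> \<and> area \<nu> = m. Q_weight f \<nu> * P_weight g \<nu>)
    = coeff (tvar ^ (\<Sum>k<K. max (f k) (g k)) * transfer (start_wt f g) (step_wt f g True) K False) m"
proof -
  let ?D = "\<Sum>k<K. max (f k) (g k)"
  let ?P = "\<lambda>A. (\<forall>k\<in>A. f k = g k) \<and> shape (outer f g A)"
  let ?w = "\<lambda>\<nu>. Q_weight f \<nu> * P_weight g \<nu>"
  have area: "area (outer f g A) = ?D + card A" if "?P A" "A \<subseteq> {..<K}" for A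
  proof -
    have "area (outer f g A) = sum (outer f g A) {..<K}"
      using that K by (intro area_eq) (auto simp: outer_def)
    also have "\<dots> = ?D + (\<Sum>k<K. of_bool (k \<in> A))" by (simp add: outer_def sum.distrib)
    also have "(\<Sum>k<K. of_bool (k \<in> A)) = card A"
      using that(2) by (simp add: sum.If_cases of_bool_def Int_absorb1)
    finally show ?thesis .
  qed
  have "coeff (tvar ^ ?D * transfer (start_wt f g) (step_wt f g True) K False) m
      = (\<Sum>A\<in>{A \<in> Pow {..<K}. ?P A \<and> ?D + card A = m}. ?w (outer f g A))"
    by (rule coeff_transfer, rule outer_weight[OF f g K near])
  also have "\<dots> = (\<Sum>A\<in>{A \<in> Pow {..<K}. ?P A \<and> area (outer f g A) = m}. ?w (outer f g A))"
    by (rule sum.cong[OF Collect_cong refl]) (simp cong: conj_cong add: area)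
  also have "\<dots> = (\<Sum>\<nu> | shape \<nu> \<and> area \<nu> = m \<and> strip f \<nu> \<and> strip g \<nu>. ?w \<nu>)"
  proof (rule sum.reindex_bij_witness[where i="\<lambda>\<nu>. {k. f k = g k \<and> f k < \<nu> k}" and j="outer f g"])
    fix A assume A: "A \<in> {A \<in> Pow {..<K}. ?P A \<and> area (outer f g A) = m}"
    show "{k. f k = g k \<and> f k < outer f g A k} = A" using A by (auto simp: outer_def)
    show "outer f g A \<in> {\<nu>. shape \<nu> \<and> area \<nu> = m \<and> strip f \<nu> \<and> strip g \<nu>}"
      using A strip_outer_shape[OF f g K near, of A] by auto
  next
    fix \<nu> assume \<nu>: "\<nu> \<in> {\<nu>. shape \<nu> \<and> area \<nu> = m \<and> strip f \<nu> \<and> strip g \<nu>}"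
    have eq: "outer f g {k. f k = g k \<and> f k < \<nu> k} = \<nu>"
    proof
      fix k
      have "f k \<le> \<nu> k" "\<nu> k \<le> Suc (f k)" "g k \<le> \<nu> k" "\<nu> k \<le> Suc (g k)"
        using \<nu> by (auto simp: strip_def)
      thus "outer f g {k. f k = g k \<and> f k < \<nu> k} k = \<nu> k"
        by (auto simp: outer_def)
    qed
    show "outer f g {k. f k = g k \<and> f k < \<nu> k} = \<nu>" by (rule eq)
    have "k < K" if "f k < \<nu> k" for k
      using shape_support[of \<nu> k] \<nu> that m by auto
    thus "{k. f k = g k \<and> f k < \<nu> k} \<in> {A \<in> Pow {..<K}. ?P A \<and> area (outer f g A) = m}"
      using \<nu> eq by auto
  qed auto
  also have "\<dots> = (\<Sum>\<nu> | shape \<nu> \<and> area \<nu> = m. ?w \<nu>)"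
    using finite_shapes_eq by (intro sum.mono_neutral_left) (auto simp: Q_weight_def P_weight_def)
  finally show ?thesis ..
qed

text \<open>Maxima and minima add up to \<open>f k + g k\<close>, so the same power of
  \<open>tvar\<close> records \<open>area f + area g - area \<rho>\<close> for a lower shape. This
  puts both sums over a common prefactor.\<close>

lemma sum_core_eq_coeff:
  assumes f: "shape f" and g: "shape g" and K: "f K = 0" "g K = 0"
    and near: "\<And>k. f k \<le> Suc (g k)" "\<And>k. g k \<le> Suc (f k)"
  shows "(\<Sum>\<rho> | shape \<rho> \<and> area \<rho> + m = area f + area g. Q_weight \<rho> g * P_weight \<rho> f)
    = coeff (tvar ^ (\<Sum>k<K. max (f k) (g k)) * transfer (start_wt f g) (step_wt f g False) K False) m"
proof -
  let ?D = "\<Sum>k<K. max (f k) (g k)"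
  let ?P = "\<lambda>A. (\<forall>k\<in>A. f k = g k \<and> 0 < f k) \<and> shape (core f g A)"
  let ?w = "\<lambda>\<rho>. Q_weight \<rho> g * P_weight \<rho> f"
  have area: "area (core f g A) + (?D + card A) = area f + area g" if "?P A" "A \<subseteq> {..<K}" for A
  proof -
    have "area (core f g A) = sum (core f g A) {..<K}"
      using that K by (intro area_eq) (auto simp: core_def)
    moreover have "card A = (\<Sum>k<K. of_bool (k \<in> A))"
      using that(2) by (simp add: sum.If_cases of_bool_def Int_absorb1)
    ultimately have "area (core f g A) + (?D + card A)
        = (\<Sum>k<K. core f g A k + (max (f k) (g k) + of_bool (k \<in> A)))"
      by (simp add: sum.distrib)
    also have "\<dots> = (\<Sum>k<K. f k + g k)"
      by (rule sum.cong[OF refl]) (use that(1) in \<open>auto simp: core_def\<close>)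
    finally show ?thesis using area_eq[OF f K(1)] area_eq[OF g K(2)] by (simp add: sum.distrib)
  qed
  have "coeff (tvar ^ ?D * transfer (start_wt f g) (step_wt f g False) K False) m
      = (\<Sum>A\<in>{A \<in> Pow {..<K}. ?P A \<and> ?D + card A = m}. ?w (core f g A))"
    by (rule coeff_transfer, rule core_weight[OF f g K near])
  also have "\<dots> = (\<Sum>A\<in>{A \<in> Pow {..<K}. ?P A \<and> area (core f g A) + m = area f + area g}. ?w (core f g A))"
    by (rule sum.cong[OF Collect_cong refl]) (auto cong: conj_cong simp: area[symmetric])
  also have "\<dots> = (\<Sum>\<rho> | shape \<rho> \<and> area \<rho> + m = area f + area g \<and> strip \<rho> f \<and> strip \<rho> g. ?w \<rho>)"
  proof (rule sum.reindex_bij_witness[where i="\<lambda>\<rho>. {k. f k = g k \<and> \<rho> k < f k}" and j="core f g"])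
    fix A assume A: "A \<in> {A \<in> Pow {..<K}. ?P A \<and> area (core f g A) + m = area f + area g}"
    show "{k. f k = g k \<and> core f g A k < f k} = A" using A by (auto simp: core_def)
    show "core f g A \<in> {\<rho>. shape \<rho> \<and> area \<rho> + m = area f + area g \<and> strip \<rho> f \<and> strip \<rho> g}"
      using A strip_core_shape[OF f g K near, of A] by blast
  next
    fix \<rho> assume \<rho>: "\<rho> \<in> {\<rho>. shape \<rho> \<and> area \<rho> + m = area f + area g \<and> strip \<rho> f \<and> strip \<rho> g}"
    have eq: "core f g {k. f k = g k \<and> \<rho> k < f k} = \<rho>"
    proof
      fix k
      have "\<rho> k \<le> f k" "f k \<le> Suc (\<rho> k)" "\<rho> k \<le> g k" "g k \<le> Suc (\<rho> k)"
        using \<rho> by (auto simp: strip_def)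
      thus "core f g {k. f k = g k \<and> \<rho> k < f k} k = \<rho> k"
        by (auto simp: core_def)
    qed
    show "core f g {k. f k = g k \<and> \<rho> k < f k} = \<rho>" by (rule eq)
    have "k < K" if "\<rho> k < f k" for k
      using shape_zero[OF f K(1), of k] that by (cases "k < K") auto
    thus "{k. f k = g k \<and> \<rho> k < f k} \<in> {A \<in> Pow {..<K}. ?P A \<and> area (core f g A) + m = area f + area g}"
      using \<rho> eq by auto
  qed auto
  also have "\<dots> = (\<Sum>\<rho> | shape \<rho> \<and> area \<rho> + m = area f + area g. ?w \<rho>)"
  proof (rule sum.mono_neutral_left)
    show "finite {\<rho>. shape \<rho> \<and> area \<rho> + m = area f + area g}"
      by (rule finite_subset[OF _ finite_shapes[of "area f + area g"]]) auto
  qed (auto simp: Q_weight_def P_weight_def)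
  finally show ?thesis ..
qed

text \<open>One coefficient of (1 - t) V = (1 + t) W, where V and W run over upper and lower shapes.
  For fixed \<open>f\<close> and \<open>g\<close> the exponents of the variables x and y differ by a
  constant, the same on both sides, so the single variable t = x y carries all the
  information.\<close>

theorem strip_commute:
  assumes f: "shape f" and g: "shape g"
  shows "(\<Sum>\<nu> | shape \<nu> \<and> area \<nu> = Suc n. Q_weight f \<nu> * P_weight g \<nu>) =
    (\<Sum>\<nu> | shape \<nu> \<and> area \<nu> = n. Q_weight f \<nu> * P_weight g \<nu>) +
    (\<Sum>\<rho> | shape \<rho> \<and> area \<rho> + Suc n = area f + area g. Q_weight \<rho> g * P_weight \<rho> f) +
    (\<Sum>\<rho> | shape \<rho> \<and> area \<rho> + n = area f + area g. Q_weight \<rho> g * P_weight \<rho> f)"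
proof (cases "\<forall>k. f k \<le> Suc (g k) \<and> g k \<le> Suc (f k)")
  case False
  have n1: "Q_weight f \<nu> * P_weight g \<nu> = 0" for \<nu>
  proof (rule ccontr)
    assume "Q_weight f \<nu> * P_weight g \<nu> \<noteq> 0"
    hence "strip f \<nu>" "strip g \<nu>" by (auto simp: Q_weight_def P_weight_def split: if_splits)
    thus False using False unfolding strip_def by (meson le_trans Suc_le_mono)
  qed
  have n2: "Q_weight \<rho> g * P_weight \<rho> f = 0" for \<rho>
  proof (rule ccontr)
    assume "Q_weight \<rho> g * P_weight \<rho> f \<noteq> 0"
    hence "strip \<rho> f" "strip \<rho> g" by (auto simp: Q_weight_def P_weight_def split: if_splits)
    thus False using False unfolding strip_def by (meson le_trans Suc_le_mono)
  qed
  show ?thesis unfolding n1 n2 by simp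
next
  case True
  hence near: "\<And>k. f k \<le> Suc (g k)" "\<And>k. g k \<le> Suc (f k)" by auto
  define K0 where "K0 = max (area f) (area g)"
  \<comment> \<open>The tail of length \<open>n + 2\<close> makes the error term \<open>b\<close>
    divisible by a power of \<open>tvar\<close> higher than the degree \<open>Suc n\<close> that is
    compared.\<close>
  define K where "K = K0 + (n + 2)"
  have z: "f k = 0" "g k = 0" if "K0 \<le> k" for k
    using shape_vanish[OF f, of k] shape_vanish[OF g, of k] that by (auto simp: K0_def)
  have K: "f K = 0" "g K = 0" using z[of K] by (auto simp: K_def)
  define a b c D where "a = transfer (start_wt f g) (step_wt f g True) K False"
    and "b = transfer (start_wt f g) (step_wt f g True) K True"
    and "c = transfer (start_wt f g) (step_wt f g False) K False"
    and "D = tvar ^ (\<Sum>k<K. max (f k) (g k))"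
  define T where "T = tvar"
  have "(1 - T) * a + b = (1 + T) * c"
    using transfer_invariant[of f K g] K unfolding a_def b_def c_def T_def by simp
  hence eq: "D * a + D * b = T * (D * a) + D * c + T * (D * c)"
    by algebra
  have "tvar ^ (n + 2) dvd b" unfolding b_def K_def using z by (rule transfer_tail)
  then obtain d where "b = monom 1 (n + 2) * d" unfolding tvar_power by (auto simp: dvd_def)
  hence "coeff (D * b) (Suc n) = coeff (monom 1 (n + 2) * (D * d)) (Suc n)" by (simp only: mult_ac)
  hence b0: "coeff (D * b) (Suc n) = 0" by (simp only: coeff_monom_mult) simp
  have sh: "coeff (T * p) (Suc n) = coeff p n" for p unfolding T_def by simp
  have "coeff (D * a) (Suc n) = coeff (D * a) n + coeff (D * c) (Suc n) + coeff (D * c) n"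
    using arg_cong[OF eq, of "\<lambda>p. coeff p (Suc n)"] by (simp add: b0 sh)
  moreover have "Suc n \<le> K" "n \<le> K" by (simp_all add: K_def)
  ultimately show ?thesis
    by (simp only: sum_outer_eq_coeff[OF f g K near] sum_core_eq_coeff[OF f g K near] a_def c_def D_def)
qed

section \<open>The Pieri rule\<close>

lemma strip_refl: "strip f f" by (simp add: strip_def)

lemma Q_weight_self: "Q_weight f f = 1"
  by (simp add: Q_weight_def P_weight_def strip_refl strip_starts_def)

lemma P_weight_eq_0: "\<not> strip f g \<Longrightarrow> P_weight f g = 0" by (simp add: P_weight_def)

lemma strip_area_eq:
  assumes "shape f" "shape g" "strip f g" "area f = area g"
  shows "f = g"
proof
  fix k
  define K where "K = Suc (k + area f)"
  have z: "f K = 0" "g K = 0" using shape_vanish assms by (simp_all add: K_def)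
  have "sum f {..<K} = sum g {..<K}" using area_eq[OF assms(1) z(1)] area_eq[OF assms(2) z(2)] assms(4) by simp
  moreover have "f i \<le> g i" for i using assms(3) by (simp add: strip_def)
  ultimately show "f k = g k"
    using sum_mono_inv[of f "{..<K}" g k] by (simp add: K_def)
qed

lemma shape_const0: "shape (\<lambda>_. 0)" by (simp add: shape_def)

lemma area_zero: "area (\<lambda>_. 0) = 0" by (simp add: area_def)

lemma area_eq_0:
  assumes "shape f"
  shows "area f = 0 \<longleftrightarrow> f = (\<lambda>_. 0)"
proof
  assume "area f = 0"
  hence "f k = 0" for k by (intro shape_vanish[OF assms]) simp
  thus "f = (\<lambda>_. 0)" by blast
qed (simp add: area_zero)

text \<open>The branching rule of the Schur P-polynomial in \<open>x 1\<close>, ...,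
  \<open>x m\<close>: the boxes of index \<open>Suc m\<close> form a strip, and what remains
  involves fewer variables. The link to tableaux is \<open>sum_marked_tabs\<close>.\<close>

primrec P_poly :: "(nat \<Rightarrow> 'a::comm_ring_1) \<Rightarrow> nat \<Rightarrow> (nat \<Rightarrow> nat) \<Rightarrow> 'a" where
  "P_poly x 0 \<mu> = (if \<mu> = (\<lambda>_. 0) then 1 else 0)"
| "P_poly x (Suc m) \<mu> = (\<Sum>h | shape h \<and> area h \<le> area \<mu>. of_int (P_weight h \<mu>) * x (Suc m) ^ (area \<mu> - area h) * P_poly x m h)"

text \<open>A range of summation that does not depend on \<open>\<mu>\<close> allows sums over
  \<open>\<mu>\<close> and over \<open>h\<close> to be exchanged.\<close>

lemma P_poly_Suc_extend:
  assumes "shape \<mu>" "area \<mu> \<le> N"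
  shows "P_poly x (Suc m) \<mu> = (\<Sum>h | shape h \<and> area h \<le> N. of_int (P_weight h \<mu>) * x (Suc m) ^ (area \<mu> - area h) * P_poly x m h)"
  unfolding P_poly.simps
proof (rule sum.mono_neutral_left)
  show "\<forall>h\<in>{h. shape h \<and> area h \<le> N} - {h. shape h \<and> area h \<le> area \<mu>}.
      of_int (P_weight h \<mu>) * x (Suc m) ^ (area \<mu> - area h) * P_poly x m h = 0"
  proof
    fix h assume "h \<in> {h. shape h \<and> area h \<le> N} - {h. shape h \<and> area h \<le> area \<mu>}"
    hence "\<not> strip h \<mu>" using strip_area_le[OF _ assms(1), of h] by auto
    thus "of_int (P_weight h \<mu>) * x (Suc m) ^ (area \<mu> - area h) * P_poly x m h = 0" by (simp add: P_weight_eq_0)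
  qed
qed (use assms finite_shapes in auto)

lemma pieri_0:
  assumes "shape h"
  shows "(\<Sum>\<nu> | shape \<nu> \<and> area \<nu> = area h. of_int (Q_weight h \<nu>) * P_poly x m \<nu>) = P_poly x m h"
proof -
  have "(\<Sum>\<nu> | shape \<nu> \<and> area \<nu> = area h. of_int (Q_weight h \<nu>) * P_poly x m \<nu>)
      = (\<Sum>\<nu>\<in>{h}. of_int (Q_weight h \<nu>) * P_poly x m \<nu>)"
  proof (rule sum.mono_neutral_right)
    show "\<forall>\<nu>\<in>{\<nu>. shape \<nu> \<and> area \<nu> = area h} - {h}. of_int (Q_weight h \<nu>) * P_poly x m \<nu> = 0"
    proof
      fix \<nu> assume \<nu>: "\<nu> \<in> {\<nu>. shape \<nu> \<and> area \<nu> = area h} - {h}"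
      hence "\<not> strip h \<nu>" using strip_area_eq[OF assms, of \<nu>] by auto
      thus "of_int (Q_weight h \<nu>) * P_poly x m \<nu> = 0" by (simp add: Q_weight_def P_weight_def)
    qed
  qed (use assms finite_shapes_eq in auto)
  thus ?thesis by (simp add: Q_weight_self)
qed

text \<open>The recursion of \<open>q\<close> says that its generating series gains the factor (1 +
  x t) / (1 - x t) with each variable. The same factor arises in \<open>strip_commute\<close> when
  the addition of a strip is moved past the strip of the last variable. The outer induction removes
  that variable, the inner one on \<open>k\<close> accounts for the denominator.\<close>

theorem pieri:
  fixes x :: "nat \<Rightarrow> 'a::comm_ring_1" and q :: "nat \<Rightarrow> nat \<Rightarrow> 'a"
  assumes q0: "\<And>m. q m 0 = 1" and q0S: "\<And>k. q 0 (Suc k) = 0"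
    and qS: "\<And>m k. q (Suc m) (Suc k) = x (Suc m) * q (Suc m) k + q m (Suc k) + x (Suc m) * q m k"
    and h: "shape h"
  shows "(\<Sum>\<nu> | shape \<nu> \<and> area \<nu> = area h + k. of_int (Q_weight h \<nu>) * P_poly x m \<nu>) = q m k * P_poly x m h"
  using h
proof (induction m arbitrary: h k)
  case 0
  show ?case
  proof (cases k)
    case 0
    thus ?thesis using pieri_0[OF \<open>shape h\<close>, of x 0] by (simp add: q0)
  next
    case (Suc k')
    have "P_poly x 0 \<nu> = 0" if "shape \<nu> \<and> area \<nu> = area h + k" for \<nu>
      using that area_eq_0[of \<nu>] Suc by auto
    thus ?thesis by (simp add: Suc q0S)
  qed
next
  case (Suc m)
  let ?X = "x (Suc m)"
  note h = Suc.prems and IH = Suc.IH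
  show ?case
  proof (induction k)
    case 0
    show ?case using pieri_0[OF h, of x "Suc m"] by (simp add: q0 del: P_poly.simps)
  next
    case (Suc k)
    define N where "N = area h + Suc k"
    let ?G = "{g. shape g \<and> area g \<le> N}" and ?R = "{\<rho>. shape \<rho> \<and> area \<rho> \<le> area h}"
    \<comment> \<open>Between \<open>h\<close> and \<open>g\<close>, \<open>V\<close> goes up and
      then down, and \<open>W\<close> goes down and then up.\<close>
    define V where "V n g = (\<Sum>\<nu> | shape \<nu> \<and> area \<nu> = n. Q_weight h \<nu> * P_weight g \<nu>)" for n g
    define W where "W j g = (\<Sum>\<rho> | shape \<rho> \<and> area \<rho> + j = area h + area g. Q_weight \<rho> g * P_weight \<rho> h)" for j g
    have L: "(\<Sum>\<nu> | shape \<nu> \<and> area \<nu> = n. of_int (Q_weight h \<nu>) * P_poly x (Suc m) \<nu>)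
        = (\<Sum>g\<in>?G. ?X ^ (n - area g) * of_int (V n g) * P_poly x m g)" if "n \<le> N" for n
    proof -
      have "(\<Sum>\<nu> | shape \<nu> \<and> area \<nu> = n. of_int (Q_weight h \<nu>) * P_poly x (Suc m) \<nu>)
          = (\<Sum>\<nu> | shape \<nu> \<and> area \<nu> = n. \<Sum>g\<in>?G. ?X ^ (n - area g) * of_int (Q_weight h \<nu> * P_weight g \<nu>) * P_poly x m g)"
      proof (rule sum.cong[OF refl])
        fix \<nu> assume "\<nu> \<in> {\<nu>. shape \<nu> \<and> area \<nu> = n}"
        hence \<nu>: "shape \<nu>" "area \<nu> \<le> N" "area \<nu> = n" using that by auto
        show "of_int (Q_weight h \<nu>) * P_poly x (Suc m) \<nu> = (\<Sum>g\<in>?G. ?X ^ (n - area g) * of_int (Q_weight h \<nu> * P_weight g \<nu>) * P_poly x m g)"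
          unfolding P_poly_Suc_extend[OF \<nu>(1,2)] sum_distrib_left \<nu>(3)
          by (rule sum.cong[OF refl]) (simp add: mult_ac)
      qed
      also have "\<dots> = (\<Sum>g\<in>?G. \<Sum>\<nu> | shape \<nu> \<and> area \<nu> = n. ?X ^ (n - area g) * of_int (Q_weight h \<nu> * P_weight g \<nu>) * P_poly x m g)"
        by (rule sum.swap)
      also have "\<dots> = (\<Sum>g\<in>?G. ?X ^ (n - area g) * of_int (V n g) * P_poly x m g)"
        unfolding V_def of_int_sum sum_distrib_left sum_distrib_right ..
      finally show ?thesis .
    qed
    \<comment> \<open>Going down first strips \<open>h\<close> of the last variable, so the
      induction hypothesis for \<open>m\<close> applies to the smaller shape
      \<open>\<rho>\<close>.\<close>
    have Wsum: "q m j * P_poly x (Suc m) h = (\<Sum>g\<in>?G. ?X ^ (area h + j - area g) * of_int (W (area h + j) g) * P_poly x m g)"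
      if "j \<le> Suc k" for j
    proof -
      have "q m j * P_poly x (Suc m) h = (\<Sum>\<rho>\<in>?R. of_int (P_weight \<rho> h) * ?X ^ (area h - area \<rho>) * (q m j * P_poly x m \<rho>))"
        unfolding P_poly.simps sum_distrib_left by (rule sum.cong[OF refl]) (simp only: mult_ac)
      also have "\<dots> = (\<Sum>\<rho>\<in>?R. \<Sum>g\<in>?G. if area g = area \<rho> + j then
          ?X ^ (area h + j - area g) * of_int (Q_weight \<rho> g * P_weight \<rho> h) * P_poly x m g else 0)"
      proof (rule sum.cong[OF refl])
        fix \<rho> assume \<rho>: "\<rho> \<in> ?R"
        have "of_int (P_weight \<rho> h) * ?X ^ (area h - area \<rho>) * (q m j * P_poly x m \<rho>)
          = (\<Sum>g | shape g \<and> area g = area \<rho> + j. of_int (P_weight \<rho> h) * ?X ^ (area h - area \<rho>) * (of_int (Q_weight \<rho> g) * P_poly x m g))"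
        proof -
          have "q m j * P_poly x m \<rho> = (\<Sum>g | shape g \<and> area g = area \<rho> + j. of_int (Q_weight \<rho> g) * P_poly x m g)"
            using IH[of \<rho> j] \<rho> by simp
          thus ?thesis by (simp only: sum_distrib_left)
        qed
        also have "\<dots> = (\<Sum>g\<in>{g \<in> ?G. area g = area \<rho> + j}. ?X ^ (area h + j - area g) * of_int (Q_weight \<rho> g * P_weight \<rho> h) * P_poly x m g)"
        proof (rule sum.cong)
          show "{g. shape g \<and> area g = area \<rho> + j} = {g \<in> ?G. area g = area \<rho> + j}"
            using \<rho> that by (auto simp: N_def)
          fix g assume "g \<in> {g \<in> ?G. area g = area \<rho> + j}"
          hence "area g = area \<rho> + j" by simp
          thus "of_int (P_weight \<rho> h) * ?X ^ (area h - area \<rho>) * (of_int (Q_weight \<rho> g) * P_poly x m g)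
            = ?X ^ (area h + j - area g) * of_int (Q_weight \<rho> g * P_weight \<rho> h) * P_poly x m g"
            by (simp add: mult_ac)
        qed
        finally show "of_int (P_weight \<rho> h) * ?X ^ (area h - area \<rho>) * (q m j * P_poly x m \<rho>) = (\<Sum>g\<in>?G. if area g = area \<rho> + j then
          ?X ^ (area h + j - area g) * of_int (Q_weight \<rho> g * P_weight \<rho> h) * P_poly x m g else 0)"
          by (simp only: sum.inter_filter[OF finite_shapes])
      qed
      also have "\<dots> = (\<Sum>g\<in>?G. \<Sum>\<rho>\<in>?R. if area g = area \<rho> + j then
          ?X ^ (area h + j - area g) * of_int (Q_weight \<rho> g * P_weight \<rho> h) * P_poly x m g else 0)"
        by (rule sum.swap)
      also have "\<dots> = (\<Sum>g\<in>?G. ?X ^ (area h + j - area g) * of_int (W (area h + j) g) * P_poly x m g)"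
      proof (rule sum.cong[OF refl])
        fix g assume g: "g \<in> ?G"
        have set: "{\<rho> \<in> ?R. area g = area \<rho> + j} = {\<rho>. shape \<rho> \<and> area \<rho> + (area h + j) = area h + area g}" if "area g \<le> area h + j"
          using that by auto
        show "(\<Sum>\<rho>\<in>?R. if area g = area \<rho> + j then
            ?X ^ (area h + j - area g) * of_int (Q_weight \<rho> g * P_weight \<rho> h) * P_poly x m g else 0)
          = ?X ^ (area h + j - area g) * of_int (W (area h + j) g) * P_poly x m g"
        proof (cases "area g \<le> area h + j")
          case True
          show ?thesis unfolding sum.inter_filter[OF finite_shapes, symmetric] set[OF True] W_def
              of_int_sum sum_distrib_left sum_distrib_right ..
        next
          \<comment> \<open>The exponent \<open>area h + j - area g\<close> is truncated here. It
            does no harm: \<open>\<rho>\<close> would have larger area than \<open>h\<close>, and no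
            strip leads from such a shape to \<open>h\<close>.\<close>
          case False
          have "Q_weight \<rho> g * P_weight \<rho> h = 0" if "shape \<rho>" "area \<rho> + (area h + j) = area h + area g" for \<rho>
          proof (rule ccontr)
            assume "Q_weight \<rho> g * P_weight \<rho> h \<noteq> 0"
            hence "strip \<rho> h" by (auto simp: P_weight_def split: if_splits)
            hence "area \<rho> \<le> area h" using strip_area_le[OF that(1) h] by simp
            thus False using that(2) False by simp
          qed
          hence "W (area h + j) g = 0" unfolding W_def by (intro sum.neutral) auto
          moreover have "(\<Sum>\<rho>\<in>?R. if area g = area \<rho> + j then
            ?X ^ (area h + j - area g) * of_int (Q_weight \<rho> g * P_weight \<rho> h) * P_poly x m g else 0) = 0"
            using False by (intro sum.neutral) auto
          ultimately show ?thesis by simp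
        qed
      qed
      finally show ?thesis .
    qed
    have Lk: "(\<Sum>\<nu> | shape \<nu> \<and> area \<nu> = area h + k. of_int (Q_weight h \<nu>) * P_poly x (Suc m) \<nu>)
        = (\<Sum>g\<in>?G. ?X ^ (area h + k - area g) * of_int (V (area h + k) g) * P_poly x m g)"
      by (rule L) (simp add: N_def)
    have "(\<Sum>\<nu> | shape \<nu> \<and> area \<nu> = N. of_int (Q_weight h \<nu>) * P_poly x (Suc m) \<nu>)
        = (\<Sum>g\<in>?G. ?X ^ (N - area g) * of_int (V N g) * P_poly x m g)"
      by (rule L) simp
    also have "\<dots> = (\<Sum>g\<in>?G. ?X * (?X ^ (area h + k - area g) * of_int (V (area h + k) g) * P_poly x m g) +
        ?X ^ (area h + Suc k - area g) * of_int (W (area h + Suc k) g) * P_poly x m g +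
        ?X * (?X ^ (area h + k - area g) * of_int (W (area h + k) g) * P_poly x m g))"
    proof (rule sum.cong[OF refl])
      fix g assume g: "g \<in> ?G"
      have V: "V N g = V (area h + k) g + W (area h + Suc k) g + W (area h + k) g"
        using strip_commute[OF h, of g "area h + k"] g unfolding V_def W_def N_def by simp
      show "?X ^ (N - area g) * of_int (V N g) * P_poly x m g =
        ?X * (?X ^ (area h + k - area g) * of_int (V (area h + k) g) * P_poly x m g) +
        ?X ^ (area h + Suc k - area g) * of_int (W (area h + Suc k) g) * P_poly x m g +
        ?X * (?X ^ (area h + k - area g) * of_int (W (area h + k) g) * P_poly x m g)"
      proof (cases "area g \<le> area h + k")
        case True
        hence e: "?X ^ (N - area g) = ?X * ?X ^ (area h + k - area g)"
          by (simp add: N_def Suc_diff_le)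
        show ?thesis unfolding V N_def[symmetric] e of_int_add
          by (simp only: distrib_left distrib_right mult.assoc)
      next
        \<comment> \<open>Now \<open>area g = N\<close>, and truncation prevents the exponents from
          differing by one; the two terms of degree \<open>area h + k\<close> vanish
          instead.\<close>
        case False
        have "P_weight g \<nu> = 0" if "shape \<nu>" "area \<nu> = area h + k" for \<nu>
          using that False g strip_area_le[of g \<nu>] by (auto simp: P_weight_def)
        hence "V (area h + k) g = 0" unfolding V_def by (intro sum.neutral) auto
        moreover have "W (area h + k) g = 0" unfolding W_def
        proof (rule sum.neutral, rule ballI)
          fix \<rho> assume \<rho>: "\<rho> \<in> {\<rho>. shape \<rho> \<and> area \<rho> + (area h + k) = area h + area g}"
          hence "\<not> strip \<rho> h" using False strip_area_le[of \<rho> h] h by auto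
          thus "Q_weight \<rho> g * P_weight \<rho> h = 0" by (simp add: P_weight_def)
        qed
        ultimately show ?thesis unfolding V N_def[symmetric] by simp
      qed
    qed
    also have "\<dots> = ?X * (\<Sum>\<nu> | shape \<nu> \<and> area \<nu> = area h + k. of_int (Q_weight h \<nu>) * P_poly x (Suc m) \<nu>)
        + q m (Suc k) * P_poly x (Suc m) h + ?X * (q m k * P_poly x (Suc m) h)"
      unfolding Wsum[of "Suc k", OF order.refl] Wsum[of k, OF le_SucI[OF order.refl]]
        Lk sum.distrib sum_distrib_left N_def ..
    also have "\<dots> = q (Suc m) (Suc k) * P_poly x (Suc m) h"
      unfolding Suc.IH qS by (simp only: distrib_right mult.assoc)
    finally show ?case unfolding N_def .
  qed
qed

section \<open>Zigzag words and words without peaks\<close>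

definition zigzag :: "('a \<Rightarrow> 'a \<Rightarrow> bool) \<Rightarrow> 'a list \<Rightarrow> bool" where
  "zigzag R w \<longleftrightarrow> (\<forall>i. Suc i < length w \<longrightarrow> (R (w ! i) (w ! Suc i) \<longleftrightarrow> even i))"

definition peakless :: "('a \<Rightarrow> 'a \<Rightarrow> bool) \<Rightarrow> 'a list \<Rightarrow> bool" where
  "peakless R w \<longleftrightarrow>
    (\<forall>i. Suc (Suc i) < length w \<longrightarrow> R (w ! i) (w ! Suc i) \<longrightarrow> R (w ! Suc i) (w ! Suc (Suc i)))"

definition words :: "'a set \<Rightarrow> nat \<Rightarrow> 'a list set" where
  "words A n = {w. set w \<subseteq> A \<and> length w = n}"

lemma finite_words: "finite A \<Longrightarrow> finite (words A n)"
  by (simp add: words_def finite_lists_length_eq)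

lemma successively_iff_nth:
  "successively P xs \<longleftrightarrow> (\<forall>i. Suc i < length xs \<longrightarrow> P (xs ! i) (xs ! Suc i))"
proof (induction xs rule: induct_list012)
  case (3 x y zs)
  show ?case
    by (simp add: 3) (auto simp: nth_Cons less_Suc_eq_0_disj split: nat.splits)
qed auto

lemma sum_words_append:
  fixes G :: "'a list \<Rightarrow> 'r::comm_monoid_add"
  assumes "finite A"
  shows "(\<Sum>w | w \<in> words A (j + k) \<and> P (take j w) \<and> Q (drop j w). G w)
    = (\<Sum>u | u \<in> words A j \<and> P u. \<Sum>v | v \<in> words A k \<and> Q v. G (u @ v))"
proof -
  have "(\<Sum>u | u \<in> words A j \<and> P u. \<Sum>v | v \<in> words A k \<and> Q v. G (u @ v))
      = (\<Sum>(u, v)\<in>{u. u \<in> words A j \<and> P u} \<times> {v. v \<in> words A k \<and> Q v}. G (u @ v))"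
    by (rule sum.cartesian_product)
  also have "\<dots> = (\<Sum>w | w \<in> words A (j + k) \<and> P (take j w) \<and> Q (drop j w). G w)"
    by (rule sum.reindex_bij_witness[where i="\<lambda>w. (take j w, drop j w)" and j="\<lambda>(u, v). u @ v"])
      (auto simp: words_def dest: in_set_takeD in_set_dropD)
  finally show ?thesis ..
qed

text \<open>The letter at which the word turns may either end the first run or begin the
  second.\<close>

lemma card_monotone_splits:
  assumes "v \<noteq> []"
  shows "card {i. i \<le> length v \<and> successively (\<lambda>x y. \<not> R x y) (take i v) \<and> successively R (drop i v)}
    = (if peakless R v then 2 else 0)"
proof -
  define k where "k = length v"
  have k: "0 < k" using assms by (simp add: k_def)
  let ?r = "\<lambda>l. R (v ! l) (v ! Suc l)"
  let ?S = "{i. i \<le> k \<and> (\<forall>l. Suc l < i \<longrightarrow> \<not> ?r l) \<and> (\<forall>l. i \<le> l \<longrightarrow> Suc l < k \<longrightarrow> ?r l)}"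
  have e1: "successively (\<lambda>x y. \<not> R x y) (take i v) = (\<forall>l. Suc l < i \<longrightarrow> \<not> ?r l)" if "i \<le> k" for i
    using that by (auto simp: successively_iff_nth k_def)
  have e2: "successively R (drop i v) = (\<forall>l. i \<le> l \<longrightarrow> Suc l < k \<longrightarrow> ?r l)" if "i \<le> k" for i
  proof
    assume *: "successively R (drop i v)"
    show "\<forall>l. i \<le> l \<longrightarrow> Suc l < k \<longrightarrow> ?r l"
    proof (intro allI impI)
      fix l assume "i \<le> l" "Suc l < k"
      thus "?r l" using *[unfolded successively_iff_nth, rule_format, of "l - i"] that by (simp add: k_def)
    qed
  qed (use that in \<open>auto simp: successively_iff_nth k_def\<close>)
  have S: "{i. i \<le> length v \<and> successively (\<lambda>x y. \<not> R x y) (take i v) \<and> successively R (drop i v)} = ?S"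
    unfolding k_def[symmetric] using e1 e2 by blast
  show ?thesis
  proof (cases "peakless R v")
    case True
    \<comment> \<open>\<open>p\<close> is the position of the turning letter. The guard lets the
      last position qualify when no step satisfies \<open>R\<close>.\<close>
    define p where "p = (LEAST l. Suc l < k \<longrightarrow> ?r l)"
    have last: "Suc (k - 1) < k \<longrightarrow> ?r (k - 1)" using k by simp
    have p: "Suc p < k \<longrightarrow> ?r p" unfolding p_def by (rule LeastI[where P="\<lambda>l. Suc l < k \<longrightarrow> ?r l", OF last])
    have "p \<le> k - 1" unfolding p_def by (rule Least_le[where P="\<lambda>l. Suc l < k \<longrightarrow> ?r l", OF last])
    hence pk: "p < k" using k by simp
    have before: "\<not> ?r l" if "l < p" for l
      using not_less_Least[of l "\<lambda>l. Suc l < k \<longrightarrow> ?r l"] that unfolding p_def by blast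
    have after: "Suc l < k \<longrightarrow> ?r l" if "p \<le> l" for l
      using that
    proof (induction rule: dec_induct)
      case (step l)
      then show ?case using True unfolding peakless_def k_def by auto
    qed (use p in simp)
    have "?S = {p, Suc p}"
    proof (intro set_eqI iffI)
      fix i assume i: "i \<in> ?S"
      have "\<not> i < p"
      proof
        assume "i < p"
        hence "i \<le> p - 1" "Suc (p - 1) < k" using pk by auto
        hence "?r (p - 1)" using i by blast
        thus False using before[of "p - 1"] \<open>i < p\<close> by simp
      qed
      moreover have "\<not> Suc p < i"
      proof
        assume "Suc p < i"
        moreover from this have "Suc p < k" using i by auto
        ultimately show False using i after[of p] by auto
      qed
      ultimately show "i \<in> {p, Suc p}" by auto
    next
      fix i assume "i \<in> {p, Suc p}"
      thus "i \<in> ?S" using before after pk by auto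
    qed
    thus ?thesis using True S by simp
  next
    case False
    then obtain l where l: "Suc (Suc l) < k" "?r l" "\<not> ?r (Suc l)"
      unfolding peakless_def k_def by blast
    have "?S = {}"
    proof (rule ccontr)
      assume "?S \<noteq> {}"
      then obtain i where i: "i \<in> ?S" by blast
      have "\<not> Suc l < i" using i l(2) by blast
      moreover have "\<not> i \<le> Suc l" using i l by blast
      ultimately show False by simp
    qed
    thus ?thesis using False S by simp
  qed
qed

text \<open>Pairs of a peakless word and one of its two splittings are counted in two ways. The
  empty word has a single splitting, hence \<open>0 < k\<close>.\<close>

lemma sum_peakless:
  fixes G :: "'a list \<Rightarrow> 'r::comm_ring_1"
  assumes "finite A" "0 < k"
  shows "(\<Sum>v | v \<in> words A k \<and> peakless R v. 2 * G v) =
    (\<Sum>i\<le>k. \<Sum>a | a \<in> words A i \<and> successively (\<lambda>x y. \<not> R x y) a.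
      \<Sum>b | b \<in> words A (k - i) \<and> successively R b. G (a @ b))"
proof -
  let ?ok = "\<lambda>v i. successively (\<lambda>x y. \<not> R x y) (take i v) \<and> successively R (drop i v)"
  have "(\<Sum>i\<le>k. \<Sum>a | a \<in> words A i \<and> successively (\<lambda>x y. \<not> R x y) a.
      \<Sum>b | b \<in> words A (k - i) \<and> successively R b. G (a @ b))
    = (\<Sum>i\<le>k. \<Sum>v | v \<in> words A k \<and> ?ok v i. G v)"
    by (rule sum.cong[OF refl], subst sum_words_append[OF assms(1), symmetric]) auto
  also have "\<dots> = (\<Sum>i\<le>k. \<Sum>v\<in>words A k. if ?ok v i then G v else 0)"
    by (simp add: sum.inter_filter[OF finite_words[OF assms(1)], symmetric])
  also have "\<dots> = (\<Sum>v\<in>words A k. \<Sum>i\<le>k. if ?ok v i then G v else 0)"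
    by (rule sum.swap)
  also have "\<dots> = (\<Sum>v\<in>words A k. if peakless R v then 2 * G v else 0)"
  proof (rule sum.cong[OF refl])
    fix v assume v: "v \<in> words A k"
    have "(\<Sum>i\<le>k. if ?ok v i then G v else 0) = (\<Sum>i\<in>{i \<in> {..k}. ?ok v i}. G v)"
      by (rule sum.inter_filter[symmetric]) simp
    also have "{i \<in> {..k}. ?ok v i} = {i. i \<le> length v \<and> ?ok v i}"
      using v by (auto simp: words_def)
    also have "(\<Sum>i\<in>\<dots>. G v) = of_nat (if peakless R v then 2 else 0) * G v"
      unfolding sum_constant using v assms(2) by (subst card_monotone_splits) (auto simp: words_def)
    finally show "(\<Sum>i\<le>k. if ?ok v i then G v else 0) = (if peakless R v then 2 * G v else 0)"
      by simp
  qed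
  also have "\<dots> = (\<Sum>v | v \<in> words A k \<and> peakless R v. 2 * G v)"
    by (simp add: sum.inter_filter[OF finite_words[OF assms(1)], symmetric])
  finally show ?thesis ..
qed

text \<open>Interpolates between peakless words (\<open>i = 0\<close>) and zigzag words
  (\<open>n = Suc (2 * i)\<close>). The two parts share the letter at position \<open>2 * i\<close>,
  so every step belongs to one of them.\<close>

definition zig_prefix :: "('a \<Rightarrow> 'a \<Rightarrow> bool) \<Rightarrow> 'a set \<Rightarrow> nat \<Rightarrow> nat \<Rightarrow> 'a list set" where
  "zig_prefix R A n i = {w \<in> words A n. zigzag R (take (Suc (2 * i)) w) \<and> peakless R (drop (2 * i) w)}"

lemma peakless_drop:
  "peakless R (drop d w) \<longleftrightarrow> (\<forall>l\<ge>d. Suc (Suc l) < length w \<longrightarrow> R (w ! l) (w ! Suc l) \<longrightarrow> R (w ! Suc l) (w ! Suc (Suc l)))"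
proof
  assume *: "peakless R (drop d w)"
  show "\<forall>l\<ge>d. Suc (Suc l) < length w \<longrightarrow> R (w ! l) (w ! Suc l) \<longrightarrow> R (w ! Suc l) (w ! Suc (Suc l))"
  proof (intro allI impI)
    fix l assume "d \<le> l" "Suc (Suc l) < length w" "R (w ! l) (w ! Suc l)"
    thus "R (w ! Suc l) (w ! Suc (Suc l))"
      using *[unfolded peakless_def, rule_format, of "l - d"] by simp
  qed
qed (auto simp: peakless_def)

lemma zigzag_take:
  "zigzag R (take j w) \<longleftrightarrow> (\<forall>l. Suc l < j \<longrightarrow> Suc l < length w \<longrightarrow> (R (w ! l) (w ! Suc l) \<longleftrightarrow> even l))"
  by (auto simp: zigzag_def)

text \<open>Beginning the peakless part one letter later frees the step at the cut. Either position
  \<open>Suc (2 * i)\<close> is no peak, and the peakless part extends to the left, or it is a peak,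
  and the zigzag part extends by two letters.\<close>

lemma zig_prefix_split:
  assumes "2 * i + 3 \<le> n"
  shows "{w \<in> words A n. zigzag R (take (Suc (2 * i)) w) \<and> peakless R (drop (Suc (2 * i)) w)}
      = zig_prefix R A n i \<union> zig_prefix R A n (Suc i)" (is "?L = ?R")
    and "zig_prefix R A n i \<inter> zig_prefix R A n (Suc i) = {}"
proof -
  show "?L = ?R"
  proof (intro set_eqI iffI)
    fix w assume w: "w \<in> ?L"
    show "w \<in> ?R"
    proof (cases "R (w ! (2 * i)) (w ! Suc (2 * i)) \<and> \<not> R (w ! Suc (2 * i)) (w ! Suc (Suc (2 * i)))")
      case True
      hence "w \<in> zig_prefix R A n (Suc i)"
        using w by (auto simp: zig_prefix_def zigzag_take peakless_drop less_Suc_eq)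
      thus ?thesis by simp
    next
      case False
      have "peakless R (drop (2 * i) w)" unfolding peakless_drop
      proof (intro allI impI)
        fix l assume l: "2 * i \<le> l" "Suc (Suc l) < length w" "R (w ! l) (w ! Suc l)"
        show "R (w ! Suc l) (w ! Suc (Suc l))"
          using False l w by (cases "l = 2 * i") (auto simp: peakless_drop)
      qed
      hence "w \<in> zig_prefix R A n i"
        using w by (simp add: zig_prefix_def)
      thus ?thesis by simp
    qed
  next
    fix w assume w: "w \<in> ?R"
    show "w \<in> ?L"
    proof (cases "w \<in> zig_prefix R A n i")
      case False
      hence w: "w \<in> zig_prefix R A n (Suc i)" using w by simp
      have nR: "\<not> R (w ! Suc (2 * i)) (w ! Suc (Suc (2 * i)))"
        using w assms by (auto simp: zig_prefix_def zigzag_take words_def)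
      have "peakless R (drop (Suc (2 * i)) w)" unfolding peakless_drop
      proof (intro allI impI)
        fix l assume l: "Suc (2 * i) \<le> l" "Suc (Suc l) < length w" "R (w ! l) (w ! Suc l)"
        have "l \<noteq> Suc (2 * i)" using l(3) nR by blast
        hence "2 * Suc i \<le> l" using l(1) by simp
        thus "R (w ! Suc l) (w ! Suc (Suc l))"
          using w l(2,3) unfolding zig_prefix_def peakless_drop by blast
      qed
      moreover have "zigzag R (take (Suc (2 * i)) w)"
        using w unfolding zig_prefix_def zigzag_take by simp
      ultimately show ?thesis using w by (simp add: zig_prefix_def)
    qed (auto simp: zig_prefix_def peakless_drop)
  qed
  show "zig_prefix R A n i \<inter> zig_prefix R A n (Suc i) = {}"
    using assms by (auto simp: zig_prefix_def zigzag_take peakless_drop words_def)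
qed

lemma finite_zig_prefix: "finite A \<Longrightarrow> finite (zig_prefix R A n i)"
  by (simp add: zig_prefix_def finite_words)

lemma zig_prefix_full: "zig_prefix R A (Suc (2 * i)) i = {w \<in> words A (Suc (2 * i)). zigzag R w}"
  by (auto simp: zig_prefix_def words_def peakless_def)

lemma zig_prefix_0: "zig_prefix R A n 0 = {w \<in> words A n. peakless R w}"
  by (auto simp: zig_prefix_def words_def zigzag_def)

text \<open>Words with a free step at the cut factor, so \<open>H\<close> evaluates their sum;
  subtracting those without a peak there leaves the family with the longer zigzag part.\<close>

lemma zig_prefix_sum_Suc:
  fixes F :: "'a list \<Rightarrow> 'r::comm_ring_1"
  assumes A: "finite A" and n: "2 * i + 3 \<le> n" "n \<le> N"
    and H: "\<And>u k. u \<in> words A (length u) \<Longrightarrow> 0 < k \<Longrightarrow> length u + k \<le> N \<Longrightarrow>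
      (\<Sum>v | v \<in> words A k \<and> peakless R v. 2 * F (u @ v)) = q k * F u"
  shows "2 * sum F (zig_prefix R A n (Suc i)) =
    q (n - Suc (2 * i)) * sum F (zig_prefix R A (Suc (2 * i)) i) - 2 * sum F (zig_prefix R A n i)"
proof -
  let ?j = "Suc (2 * i)"
  define k where "k = n - ?j"
  have nk: "n = ?j + k" "0 < k" using n by (simp_all add: k_def)
  have "2 * sum F (zig_prefix R A n i) + 2 * sum F (zig_prefix R A n (Suc i))
      = (\<Sum>w | w \<in> words A n \<and> zigzag R (take ?j w) \<and> peakless R (drop ?j w). 2 * F w)"
    unfolding zig_prefix_split(1)[OF n(1)]
    using zig_prefix_split(2)[OF n(1)] finite_zig_prefix[OF A]
    by (subst sum.union_disjoint) (auto simp: sum_distrib_left)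
  also have "\<dots> = (\<Sum>u | u \<in> words A ?j \<and> zigzag R u. \<Sum>v | v \<in> words A k \<and> peakless R v. 2 * F (u @ v))"
    unfolding nk(1) by (rule sum_words_append[OF A])
  also have "\<dots> = (\<Sum>u | u \<in> words A ?j \<and> zigzag R u. q k * F u)"
    by (rule sum.cong[OF refl], rule H) (use nk n in \<open>auto simp: words_def\<close>)
  also have "\<dots> = q k * sum F (zig_prefix R A ?j i)"
    by (simp add: zig_prefix_full sum_distrib_left)
  finally show ?thesis by (simp add: k_def algebra_simps)
qed

text \<open>The recursion does not look inside the words, so equal multipliers \<open>q\<close> and
  equal values at the empty word determine the sums. The bound by \<open>N\<close> is there for
  contents: the alphabet below \<open>N\<close> contains all of them only as long as the area is at
  most \<open>N\<close>.\<close>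

theorem zigzag_sum_determined:
  fixes F :: "'a list \<Rightarrow> 'r::{idom, ring_char_0}" and F' :: "'b list \<Rightarrow> 'r"
  assumes A: "finite A" and A': "finite A'" and F0: "F [] = F' []"
    and H: "\<And>u k. u \<in> words A (length u) \<Longrightarrow> 0 < k \<Longrightarrow> length u + k \<le> N \<Longrightarrow>
      (\<Sum>v | v \<in> words A k \<and> peakless R v. 2 * F (u @ v)) = q k * F u"
    and H': "\<And>u k. u \<in> words A' (length u) \<Longrightarrow> 0 < k \<Longrightarrow> length u + k \<le> N \<Longrightarrow>
      (\<Sum>v | v \<in> words A' k \<and> peakless R' v. 2 * F' (u @ v)) = q k * F' u"
    and N: "odd N"
  shows "(\<Sum>w | w \<in> words A N \<and> zigzag R w. F w) = (\<Sum>w | w \<in> words A' N \<and> zigzag R' w. F' w)"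
proof -
  have main: "2 * i + 1 \<le> n \<longrightarrow> n \<le> N \<longrightarrow> sum F (zig_prefix R A n i) = sum F' (zig_prefix R' A' n i)" for n i
  \<comment> \<open>The value at \<open>n\<close> and \<open>Suc i\<close> refers to the shorter
    length \<open>Suc (2 * i)\<close>, and at length \<open>n\<close> itself to \<open>i\<close>;
    hence the nested inductions.\<close>
  proof (induction n arbitrary: i rule: less_induct)
    case (less n)
    show ?case
    proof (induction i)
      case 0
      show ?case
      proof (intro impI)
        assume n: "2 * 0 + 1 \<le> n" "n \<le> N"
        have "2 * sum F (zig_prefix R A n 0) = 2 * sum F' (zig_prefix R' A' n 0)"
          using H[of "[]" n] H'[of "[]" n] n F0
          by (simp add: zig_prefix_0 sum_distrib_left words_def)
        thus "sum F (zig_prefix R A n 0) = sum F' (zig_prefix R' A' n 0)" by simp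
      qed
    next
      case (Suc i)
      show ?case
      proof (intro impI)
        assume n: "2 * Suc i + 1 \<le> n" "n \<le> N"
        have "2 * sum F (zig_prefix R A n (Suc i)) = 2 * sum F' (zig_prefix R' A' n (Suc i))"
        proof -
          have n': "2 * i + 3 \<le> n" using n by simp
          have "sum F (zig_prefix R A (Suc (2 * i)) i) = sum F' (zig_prefix R' A' (Suc (2 * i)) i)"
            using less.IH[of "Suc (2 * i)" i] n by simp
          moreover have "sum F (zig_prefix R A n i) = sum F' (zig_prefix R' A' n i)"
            using Suc n by simp
          ultimately show ?thesis
            using zig_prefix_sum_Suc[where F=F and R=R and q=q, OF A n' n(2) H]
              zig_prefix_sum_Suc[where F=F' and R=R' and q=q, OF A' n' n(2) H']
            by simp
        qed
        thus "sum F (zig_prefix R A n (Suc i)) = sum F' (zig_prefix R' A' n (Suc i))" by simp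
      qed
    qed
  qed
  obtain i where i: "N = Suc (2 * i)" using N by (auto elim: oddE)
  show ?thesis using main[of i N] unfolding i zig_prefix_full by simp
qed

section \<open>Adding boxes one at a time\<close>

definition boxes :: "(nat \<Rightarrow> nat) \<Rightarrow> (nat \<Rightarrow> nat) \<Rightarrow> nat set" where
  "boxes f g = {k. f k < g k}"

text \<open>\<open>M\<close> is the set of primed boxes. Of two boxes on consecutive diagonals the
  one of larger content is to the right if \<open>f k = f (Suc k)\<close>, and must be unprimed;
  otherwise it is above, and must be primed.\<close>

definition marks :: "(nat \<Rightarrow> nat) \<Rightarrow> (nat \<Rightarrow> nat) \<Rightarrow> nat set set" where
  "marks f g = {M. M \<subseteq> boxes f g \<and>
     (\<forall>k. k \<in> boxes f g \<longrightarrow> Suc k \<in> boxes f g \<longrightarrow> (Suc k \<in> M \<longleftrightarrow> f k \<noteq> f (Suc k)))}"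

definition free_boxes :: "(nat \<Rightarrow> nat) \<Rightarrow> (nat \<Rightarrow> nat) \<Rightarrow> nat set" where
  "free_boxes f g = {k \<in> boxes f g. \<forall>j. k = Suc j \<longrightarrow> j \<notin> boxes f g}"

lemma finite_boxes:
  assumes "shape g"
  shows "finite (boxes f g)"
proof (rule finite_subset)
  show "boxes f g \<subseteq> {..<area g}"
  proof
    fix k assume "k \<in> boxes f g"
    hence "g k \<noteq> 0" by (simp add: boxes_def)
    thus "k \<in> {..<area g}" using shape_support[OF assms, of k] by simp
  qed
qed simp

text \<open>A marking consists of an arbitrary set of free boxes and the forced marks
  \<open>?D\<close>. Allowing all free boxes, or all except content 0, yields the two
  weights.\<close>

lemma card_marks_restrict:
  assumes g: "shape g" and C: "C \<subseteq> free_boxes f g"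
  shows "card {M \<in> marks f g. M \<inter> free_boxes f g \<subseteq> C} = 2 ^ card C"
proof -
  let ?X = "boxes f g" and ?F = "free_boxes f g"
  let ?D = "{l. \<exists>k. l = Suc k \<and> k \<in> ?X \<and> Suc k \<in> ?X \<and> f k \<noteq> f (Suc k)}"
  have FX: "?F \<subseteq> ?X" by (auto simp: free_boxes_def)
  have DF: "?D \<inter> ?F = {}" by (auto simp: free_boxes_def)
  have DX: "?D \<subseteq> ?X" by auto
  have rest: "\<exists>j. k = Suc j \<and> j \<in> ?X" if "k \<in> ?X" "k \<notin> ?F" for k
    using that by (auto simp: free_boxes_def)
  have "bij_betw (\<lambda>S. S \<union> ?D) (Pow C) {M \<in> marks f g. M \<inter> ?F \<subseteq> C}"
  proof (rule bij_betw_byWitness[where f'="\<lambda>M. M \<inter> ?F"])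
    show "\<forall>S\<in>Pow C. (S \<union> ?D) \<inter> ?F = S" using C DF by blast
    show "\<forall>M\<in>{M \<in> marks f g. M \<inter> ?F \<subseteq> C}. M \<inter> ?F \<union> ?D = M"
    proof
      fix M assume M: "M \<in> {M \<in> marks f g. M \<inter> ?F \<subseteq> C}"
      have MX: "M \<subseteq> ?X" using M by (auto simp: marks_def)
      have Mk: "Suc k \<in> M \<longleftrightarrow> f k \<noteq> f (Suc k)" if "k \<in> ?X" "Suc k \<in> ?X" for k
        using M that by (auto simp: marks_def)
      have "?D \<subseteq> M" using Mk by auto
      moreover have "M \<subseteq> ?F \<union> ?D"
      proof
        fix k assume k: "k \<in> M"
        show "k \<in> ?F \<union> ?D"
        proof (cases "k \<in> ?F")
          case False
          then obtain j where "k = Suc j" "j \<in> ?X" using rest[of k] k MX by auto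
          thus ?thesis using Mk[of j] k MX by auto
        qed simp
      qed
      ultimately show "M \<inter> ?F \<union> ?D = M" by blast
    qed
    show "(\<lambda>S. S \<union> ?D) ` Pow C \<subseteq> {M \<in> marks f g. M \<inter> ?F \<subseteq> C}"
    proof (rule image_subsetI)
      fix S assume S: "S \<in> Pow C"
      have "S \<union> ?D \<in> marks f g"
        unfolding marks_def using S C FX DX by (auto simp: free_boxes_def)
      thus "S \<union> ?D \<in> {M \<in> marks f g. M \<inter> ?F \<subseteq> C}" using S DF by blast
    qed
    show "(\<lambda>M. M \<inter> ?F) ` {M \<in> marks f g. M \<inter> ?F \<subseteq> C} \<subseteq> Pow C" by blast
  qed
  hence "card {M \<in> marks f g. M \<inter> ?F \<subseteq> C} = card (Pow C)" by (simp add: bij_betw_same_card)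
  also have "\<dots> = 2 ^ card C"
    by (rule card_Pow) (use C FX finite_subset[OF _ finite_boxes[OF g]] in blast)
  finally show ?thesis .
qed

lemma free_boxes_eq:
  assumes "strip f g"
  shows "free_boxes f g - {0} = Suc ` strip_starts f g"
proof -
  have s: "k \<notin> boxes f g \<longleftrightarrow> f k = g k" for k
    using assms[unfolded strip_def, rule_format, of k] by (auto simp: boxes_def)
  show ?thesis
  proof (intro set_eqI iffI)
    fix k assume k: "k \<in> free_boxes f g - {0}"
    then obtain j where j: "k = Suc j" by (cases k) auto
    have "f j = g j" using k j s[of j] by (auto simp: free_boxes_def)
    thus "k \<in> Suc ` strip_starts f g" using k j by (auto simp: free_boxes_def boxes_def strip_starts_def)
  qed (auto simp: free_boxes_def boxes_def strip_starts_def)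
qed

lemma card_marks:
  assumes "shape g" "strip f g"
  shows "int (card (marks f g)) = Q_weight f g"
    and "int (card {M \<in> marks f g. 0 \<notin> M}) = P_weight f g"
proof -
  have fin: "finite (free_boxes f g)"
    by (rule finite_subset[OF _ finite_boxes[OF assms(1)]]) (auto simp: free_boxes_def)
  have c: "card (free_boxes f g - {0}) = card (strip_starts f g)"
    unfolding free_boxes_eq[OF assms(2)] by (simp add: card_image)
  have 0: "0 \<in> free_boxes f g \<longleftrightarrow> f 0 < g 0" by (auto simp: free_boxes_def boxes_def)
  have "{M \<in> marks f g. M \<inter> free_boxes f g \<subseteq> free_boxes f g} = marks f g" by blast
  hence "card (marks f g) = 2 ^ card (free_boxes f g)"
    using card_marks_restrict[OF assms(1), of "free_boxes f g" f] by simp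
  also have "card (free_boxes f g) = of_bool (f 0 < g 0) + card (strip_starts f g)"
    unfolding c[symmetric] using 0 fin card_Suc_Diff1[of "free_boxes f g" 0] by (cases "f 0 < g 0") auto
  finally show "int (card (marks f g)) = Q_weight f g" using assms(2) by (simp add: Q_weight_def P_weight_def)
  have "{M \<in> marks f g. M \<inter> free_boxes f g \<subseteq> free_boxes f g - {0}} = {M \<in> marks f g. 0 \<notin> M}"
    by (auto simp: marks_def free_boxes_def)
  hence "card {M \<in> marks f g. 0 \<notin> M} = 2 ^ card (free_boxes f g - {0})"
    using card_marks_restrict[OF assms(1), of "free_boxes f g - {0}" f] by auto
  thus "int (card {M \<in> marks f g. 0 \<notin> M}) = P_weight f g" using assms(2) c by (simp add: P_weight_def)
qed

section \<open>Growing shapes as words of contents\<close>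

primrec chain :: "(nat \<Rightarrow> nat) \<Rightarrow> nat list \<Rightarrow> bool" where
  "chain f [] \<longleftrightarrow> True"
| "chain f (k # w) \<longleftrightarrow> shape (f(k := Suc (f k))) \<and> chain (f(k := Suc (f k))) w"

definition fill :: "(nat \<Rightarrow> nat) \<Rightarrow> nat list \<Rightarrow> nat \<Rightarrow> nat" where
  "fill f w = (\<lambda>k. f k + count_list w k)"

abbreviation chain0 :: "nat list \<Rightarrow> bool" where "chain0 \<equiv> chain (\<lambda>_. 0)"
abbreviation fill0 :: "nat list \<Rightarrow> nat \<Rightarrow> nat" where "fill0 \<equiv> fill (\<lambda>_. 0)"

lemma fill_Nil [simp]: "fill f [] = f" by (simp add: fill_def)

lemma fill_Cons [simp]: "fill f (k # w) = fill (f(k := Suc (f k))) w"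
  by (auto simp: fill_def)

lemma fill_append: "fill f (u @ v) = fill (fill f u) v"
  by (auto simp: fill_def)

lemma chain_append: "chain f (u @ v) \<longleftrightarrow> chain f u \<and> chain (fill f u) v"
  by (induction u arbitrary: f) (simp_all del: fun_upd_apply)

lemma shape_fill: "shape f \<Longrightarrow> chain f w \<Longrightarrow> shape (fill f w)"
proof (induction w arbitrary: f)
  case (Cons k w)
  have s: "shape (f(k := Suc (f k)))" "chain (f(k := Suc (f k))) w" using Cons.prems(2) by simp_all
  show ?case unfolding fill_Cons by (rule Cons.IH[OF s])
qed simp

lemma shape_add_box:
  assumes f: "shape f"
  shows "shape (f(k := Suc (f k))) \<longleftrightarrow> f k = f (Suc k) \<and> (\<forall>j. k = Suc j \<longrightarrow> f j = Suc (f k))"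
proof
  assume s: "shape (f(k := Suc (f k)))"
  have "f k = f (Suc k)" using shape_step(2)[OF s, of k] shape_step(1)[OF f, of k] by simp
  moreover have "f j = Suc (f k)" if "k = Suc j" for j
    using shape_step(1)[OF s, of j] shape_step(2)[OF f, of j] that by simp
  ultimately show "f k = f (Suc k) \<and> (\<forall>j. k = Suc j \<longrightarrow> f j = Suc (f k))" by simp
next
  assume a: "f k = f (Suc k) \<and> (\<forall>j. k = Suc j \<longrightarrow> f j = Suc (f k))"
  show "shape (f(k := Suc (f k)))" unfolding shape_def
  proof (intro conjI allI)
    fix i
    show "(f(k := Suc (f k))) (Suc i) \<le> (f(k := Suc (f k))) i"
      using a shape_step(1)[OF f, of i] by auto
    show "(f(k := Suc (f k))) i \<le> Suc ((f(k := Suc (f k))) (Suc i))"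
      using a shape_step(2)[OF f, of i] by auto
    obtain K where "f K = 0" using f by (auto simp: shape_def)
    hence "(f(k := Suc (f k))) (Suc (max K k)) = 0"
      using shape_zero[OF f, of K "Suc (max K k)"] by simp
    thus "\<exists>K. (f(k := Suc (f k))) K = 0" by blast
  qed
qed

lemma area_add_box:
  assumes f: "shape f" and s: "shape (f(k := Suc (f k)))"
  shows "area (f(k := Suc (f k))) = Suc (area f)"
proof -
  obtain K where K: "f K = 0" using f by (auto simp: shape_def)
  define L where "L = Suc (max K k)"
  have z: "f L = 0" "(f(k := Suc (f k))) L = 0"
    using shape_zero[OF f K, of L] by (auto simp: L_def)
  have "sum (f(k := Suc (f k))) {..<L} = (\<Sum>i<L. f i + of_bool (i = k))"
    by (rule sum.cong) auto
  also have "\<dots> = sum f {..<L} + 1"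
    by (simp add: sum.distrib of_bool_def L_def)
  finally show ?thesis using area_eq[OF f z(1)] area_eq[OF s z(2)] by linarith
qed

lemma area_fill: "shape f \<Longrightarrow> chain f w \<Longrightarrow> area (fill f w) = area f + length w"
proof (induction w arbitrary: f)
  case (Cons k w)
  have s: "shape (f(k := Suc (f k)))" "chain (f(k := Suc (f k))) w" using Cons.prems(2) by simp_all
  show ?case unfolding fill_Cons Cons.IH[OF s] area_add_box[OF Cons.prems(1) s(1)] by simp
qed simp

text \<open>After a box has been added on diagonal \<open>k\<close>, the next diagonal is too short
  for a second one. Hence weakly decreasing runs of contents are strictly decreasing, and a step
  that is no ascent is a descent.\<close>

lemma chain_no_repeat: "shape f \<Longrightarrow> chain f w \<Longrightarrow> successively (\<noteq>) w"
proof (induction w arbitrary: f rule: induct_list012)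
  case (3 k l w)
  let ?f' = "f(k := Suc (f k))"
  have s: "shape ?f'" using 3(4) by simp
  have "k \<noteq> l"
  proof
    assume "k = l"
    hence s2: "shape (?f'(k := Suc (?f' k)))" using 3(4) by simp
    have "Suc (f k) = f (Suc k)" using iffD1[OF shape_add_box[OF s] s2] by simp
    moreover have "f k = f (Suc k)" using iffD1[OF shape_add_box[OF 3(3)] s] by simp
    ultimately show False by simp
  qed
  moreover have "chain ?f' (l # w)" using 3(4) by (simp only: chain.simps)
  hence "successively (\<noteq>) (l # w)" by (rule 3(2)[OF s])
  ultimately show ?case by simp
qed auto

text \<open>In decreasing order the box on \<open>Suc k\<close> has been added before the one on
  \<open>k\<close>, and the box on the preceding diagonal has not. This turns the running condition
  of \<open>shape_add_box\<close> into a condition on the initial shape.\<close>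

lemma chain_decreasing:
  assumes "sorted_wrt (>) a" "shape f"
  shows "chain f a \<longleftrightarrow> (\<forall>k\<in>set a. f k = f (Suc k) + of_bool (Suc k \<in> set a) \<and> (\<forall>j. k = Suc j \<longrightarrow> f j = Suc (f k)))"
  using assms
proof (induction a arbitrary: f)
  case (Cons k a)
  define g where "g = f(k := Suc (f k))"
  have less: "\<And>l. l \<in> set a \<Longrightarrow> l < k" and a: "sorted_wrt (>) a" using Cons.prems(1) by auto
  have k: "k \<notin> set a" "Suc k \<notin> set a" using less by force+
  have sg: "shape g \<longleftrightarrow> f k = f (Suc k) \<and> (\<forall>j. k = Suc j \<longrightarrow> f j = Suc (f k))"
    unfolding g_def by (rule shape_add_box[OF Cons.prems(2)])
  have "(\<forall>l\<in>set a. g l = g (Suc l) + of_bool (Suc l \<in> set a) \<and> (\<forall>j. l = Suc j \<longrightarrow> g j = Suc (g l)))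
      \<longleftrightarrow> (\<forall>l\<in>set a. f l = f (Suc l) + of_bool (Suc l \<in> set (k # a)) \<and> (\<forall>j. l = Suc j \<longrightarrow> f j = Suc (f l)))"
    if "shape g"
  proof (rule ball_cong[OF refl])
    fix l assume l: "l \<in> set a"
    have 1: "g l = f l" using less[OF l] by (simp add: g_def)
    have 2: "g (Suc l) + of_bool (Suc l \<in> set a) = f (Suc l) + of_bool (Suc l \<in> set (k # a))"
      using k by (auto simp: g_def)
    have 3: "g j = f j" if "l = Suc j" for j using less[OF l] that by (simp add: g_def)
    show "(g l = g (Suc l) + of_bool (Suc l \<in> set a) \<and> (\<forall>j. l = Suc j \<longrightarrow> g j = Suc (g l))) =
      (f l = f (Suc l) + of_bool (Suc l \<in> set (k # a)) \<and> (\<forall>j. l = Suc j \<longrightarrow> f j = Suc (f l)))"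
      unfolding 1 2 using 3 by metis
  qed
  hence "chain f (k # a) \<longleftrightarrow> shape g \<and>
      (\<forall>l\<in>set a. f l = f (Suc l) + of_bool (Suc l \<in> set (k # a)) \<and> (\<forall>j. l = Suc j \<longrightarrow> f j = Suc (f l)))"
    unfolding chain.simps g_def[symmetric] using Cons.IH[OF a, of g] by blast
  thus ?case unfolding sg using k by simp
qed simp

lemma chain_increasing:
  assumes "sorted_wrt (<) b" "shape f"
  shows "chain f b \<longleftrightarrow> (\<forall>k\<in>set b. f k = f (Suc k) \<and> (\<forall>j. k = Suc j \<longrightarrow> f j + of_bool (j \<in> set b) = Suc (f k)))"
  using assms
proof (induction b arbitrary: f)
  case (Cons k b)
  define g where "g = f(k := Suc (f k))"
  have less: "\<And>l. l \<in> set b \<Longrightarrow> k < l" and b: "sorted_wrt (<) b" using Cons.prems(1) by auto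
  have k: "k \<notin> set b" "\<And>j. k = Suc j \<Longrightarrow> j \<notin> set b" using less by force+
  have sg: "shape g \<longleftrightarrow> f k = f (Suc k) \<and> (\<forall>j. k = Suc j \<longrightarrow> f j = Suc (f k))"
    unfolding g_def by (rule shape_add_box[OF Cons.prems(2)])
  have "(\<forall>l\<in>set b. g l = g (Suc l) \<and> (\<forall>j. l = Suc j \<longrightarrow> g j + of_bool (j \<in> set b) = Suc (g l)))
      \<longleftrightarrow> (\<forall>l\<in>set b. f l = f (Suc l) \<and> (\<forall>j. l = Suc j \<longrightarrow> f j + of_bool (j \<in> set (k # b)) = Suc (f l)))"
    if "shape g"
  proof (rule ball_cong[OF refl])
    fix l assume l: "l \<in> set b"
    have 1: "g l = f l" "g (Suc l) = f (Suc l)" using less[OF l] by (simp_all add: g_def)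
    have 2: "g j + of_bool (j \<in> set b) = f j + of_bool (j \<in> set (k # b))" for j
      using k by (auto simp: g_def)
    show "(g l = g (Suc l) \<and> (\<forall>j. l = Suc j \<longrightarrow> g j + of_bool (j \<in> set b) = Suc (g l))) =
      (f l = f (Suc l) \<and> (\<forall>j. l = Suc j \<longrightarrow> f j + of_bool (j \<in> set (k # b)) = Suc (f l)))"
      unfolding 1 2 ..
  qed
  hence "chain f (k # b) \<longleftrightarrow> shape g \<and>
      (\<forall>l\<in>set b. f l = f (Suc l) \<and> (\<forall>j. l = Suc j \<longrightarrow> f j + of_bool (j \<in> set (k # b)) = Suc (f l)))"
    unfolding chain.simps g_def[symmetric] using Cons.IH[OF b, of g] by blast
  moreover have "f j + of_bool (j \<in> set (k # b)) = f j" if "k = Suc j" for j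
    using k(2)[OF that] that by simp
  ultimately show ?case unfolding sg by auto
qed simp

lemma count_list_distinct: "distinct w \<Longrightarrow> count_list w k = of_bool (k \<in> set w)"
  by (induction w) auto

lemma strict_sorted_distinct:
  "sorted_wrt (<) (b::nat list) \<Longrightarrow> distinct b" "sorted_wrt (>) (b::nat list) \<Longrightarrow> distinct b"
  by (induction b) auto

lemma fill_valley:
  assumes "sorted_wrt (>) a" "sorted_wrt (<) b"
  shows "fill f (a @ b) k = f k + of_bool (k \<in> set a) + of_bool (k \<in> set b)"
  using assms by (simp add: fill_def count_list_distinct strict_sorted_distinct)

lemma chain_valley:
  assumes f: "shape f" and a: "sorted_wrt (>) a" and b: "sorted_wrt (<) b"
  shows "chain f (a @ b) \<longleftrightarrow>
    (\<forall>k\<in>set a. f k = f (Suc k) + of_bool (Suc k \<in> set a) \<and> (\<forall>j. k = Suc j \<longrightarrow> f j = Suc (f k))) \<and>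
    (\<forall>k\<in>set b. f k + of_bool (k \<in> set a) = f (Suc k) + of_bool (Suc k \<in> set a) \<and>
      (\<forall>j. k = Suc j \<longrightarrow> f j + of_bool (j \<in> set a) + of_bool (j \<in> set b) = Suc (f k + of_bool (k \<in> set a))))"
proof -
  have fa: "fill f a = (\<lambda>k. f k + of_bool (k \<in> set a))"
    using fill_valley[OF a, of "[]" f] by auto
  show ?thesis
  proof (cases "chain f a")
    case True
    show ?thesis
      unfolding chain_append chain_increasing[OF b shape_fill[OF f True], unfolded fa] chain_decreasing[OF a f] fa
      by (rule refl)
  next
    case False
    thus ?thesis unfolding chain_append chain_decreasing[OF a f] by blast
  qed
qed

text \<open>The decreasing run supplies the primed boxes. A box on \<open>Suc k\<close> to the right
  of the box on \<open>k\<close> has to be added after it, and one above it before it; in a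
  decreasing run followed by an increasing one, \<open>Suc k\<close> precedes \<open>k\<close>
  exactly when it lies in the first run.\<close>

lemma valley_marks:
  assumes f: "shape f" and a: "sorted_wrt (>) a" and b: "sorted_wrt (<) b" and c: "chain f (a @ b)"
  defines "\<nu> \<equiv> fill f (a @ b)"
  shows "set a \<inter> set b = {}" "strip f \<nu>" "boxes f \<nu> = set a \<union> set b" "set a \<in> marks f \<nu>"
proof -
  have A: "f k = f (Suc k) + of_bool (Suc k \<in> set a)" if "k \<in> set a" for k
    using c that unfolding chain_valley[OF f a b] by blast
  have A': "f j = Suc (f (Suc j))" if "Suc j \<in> set a" for j
    using c that unfolding chain_valley[OF f a b] by blast
  have B: "f k + of_bool (k \<in> set a) = f (Suc k) + of_bool (Suc k \<in> set a)" if "k \<in> set b" for k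
    using c that unfolding chain_valley[OF f a b] by blast
  have B': "f j + of_bool (j \<in> set a) + of_bool (j \<in> set b) = Suc (f (Suc j) + of_bool (Suc j \<in> set a))"
    if "Suc j \<in> set b" for j
    using c that unfolding chain_valley[OF f a b] by blast
  show dis: "set a \<inter> set b = {}"
  proof (rule equals0I)
    fix k assume "k \<in> set a \<inter> set b"
    thus False using A[of k] B[of k] by simp
  qed
  have \<nu>: "\<nu> k = f k + of_bool (k \<in> set a) + of_bool (k \<in> set b)" for k
    unfolding \<nu>_def by (rule fill_valley[OF a b])
  have "f k \<le> \<nu> k \<and> \<nu> k \<le> Suc (f k)" for k
    using dis unfolding \<nu> by (cases "k \<in> set a"; cases "k \<in> set b") auto
  thus "strip f \<nu>" by (simp add: strip_def)
  show X: "boxes f \<nu> = set a \<union> set b"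
    by (auto simp: boxes_def \<nu>)
  have "Suc k \<in> set a \<longleftrightarrow> f k \<noteq> f (Suc k)" if "k \<in> set a \<union> set b" "Suc k \<in> set a \<union> set b" for k
  proof (cases "Suc k \<in> set a")
    case True
    thus ?thesis using A'[of k] by simp
  next
    case False
    hence S: "Suc k \<in> set b" using that(2) by simp
    show ?thesis
    proof (cases "k \<in> set a")
      case True
      thus ?thesis using A[of k] False by simp
    next
      case kb: False
      hence "k \<in> set b" using that(1) by simp
      thus ?thesis using B[of k] kb False by simp
    qed
  qed
  thus "set a \<in> marks f \<nu>" unfolding marks_def X by blast
qed

text \<open>Marked boxes by decreasing content and then the others by increasing content is a legal
  order of insertion. This inverts \<open>valley_marks\<close>.\<close>

lemma marks_valley:
  assumes f: "shape f" and g: "shape g" and s: "strip f g" and M: "M \<in> marks f g"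
  defines "a \<equiv> rev (sorted_list_of_set M)" and "b \<equiv> sorted_list_of_set (boxes f g - M)"
  shows "sorted_wrt (>) a" "sorted_wrt (<) b" "set a = M" "set b = boxes f g - M"
    and "chain f (a @ b)" "fill f (a @ b) = g"
proof -
  let ?X = "boxes f g"
  have fin: "finite ?X" by (rule finite_boxes[OF g])
  have MX: "M \<subseteq> ?X" using M by (auto simp: marks_def)
  have finM: "finite M" by (rule finite_subset[OF MX fin])
  show a: "sorted_wrt (>) a" unfolding a_def by (simp add: sorted_wrt_rev)
  show b: "sorted_wrt (<) b" unfolding b_def by simp
  show sa: "set a = M" using finM by (simp add: a_def)
  show sb: "set b = ?X - M" using fin by (simp add: b_def)
  have gX: "g k = f k + of_bool (k \<in> ?X)" for k
    using s[unfolded strip_def, rule_format, of k] by (auto simp: boxes_def)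
  have Mk: "Suc k \<in> M \<longleftrightarrow> f k \<noteq> f (Suc k)" if "k \<in> ?X" "Suc k \<in> ?X" for k
    using M that by (auto simp: marks_def)
  show "fill f (a @ b) = g"
  proof
    fix k
    show "fill f (a @ b) k = g k"
    proof -
      have "k \<in> M \<Longrightarrow> k \<in> ?X" using MX by blast
      thus ?thesis unfolding fill_valley[OF a b] sa sb gX[of k]
        by (cases "k \<in> M"; cases "k \<in> ?X") simp_all
    qed
  qed
  have st: "f (Suc k) \<le> f k" "f k \<le> Suc (f (Suc k))" "g (Suc k) \<le> g k" "g k \<le> Suc (g (Suc k))" for k
    by (rule shape_step[OF f] shape_step[OF g])+
  show "chain f (a @ b)" unfolding chain_valley[OF f a b] sa sb
  proof (intro conjI ballI allI impI)
    fix k assume k: "k \<in> M"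
    hence kX: "k \<in> ?X" using MX by auto
    show "f k = f (Suc k) + of_bool (Suc k \<in> M)"
    proof (cases "Suc k \<in> ?X")
      case True
      thus ?thesis using Mk[OF kX True] st[of k] by auto
    next
      case False
      hence "Suc k \<notin> M" using MX by auto
      thus ?thesis using False kX st[of k] gX[of k] gX[of "Suc k"] by simp
    qed
    show "f j = Suc (f k)" if j: "k = Suc j" for j
    proof (cases "j \<in> ?X")
      case True
      thus ?thesis using Mk[of j] k kX j st[of j] by auto
    next
      case False
      thus ?thesis using kX st[of j] gX[of j] gX[of k] j by simp
    qed
  next
    fix k assume k: "k \<in> ?X - M"
    show "f k + of_bool (k \<in> M) = f (Suc k) + of_bool (Suc k \<in> M)"
    proof (cases "Suc k \<in> ?X")
      case True
      thus ?thesis using Mk[of k] k st[of k] by auto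
    next
      case False
      hence "Suc k \<notin> M" using MX by auto
      thus ?thesis using False k st[of k] gX[of k] gX[of "Suc k"] by simp
    qed
    show "f j + of_bool (j \<in> M) + of_bool (j \<in> ?X - M) = Suc (f k + of_bool (k \<in> M))" if j: "k = Suc j" for j
    proof (cases "j \<in> ?X")
      case True
      thus ?thesis using Mk[of j] k j by auto
    next
      case False
      hence "j \<notin> M" using MX by auto
      thus ?thesis using False k st[of j] gX[of j] gX[of k] j by simp
    qed
  qed
qed

text \<open>The pairs of runs that lead to \<open>\<nu>\<close> correspond to the markings of its
  strip. The alphabet below \<open>B\<close> contains every content that occurs, since contents are
  smaller than the final area.\<close>

lemma sum_valley_chains:
  fixes G :: "(nat \<Rightarrow> nat) \<Rightarrow> 'r::comm_ring_1"
  assumes f: "shape f" and B: "area f + k \<le> B"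
  shows "(\<Sum>i\<le>k. \<Sum>a | a \<in> words {..<B} i \<and> successively (\<lambda>x y. \<not> x < y) a.
      \<Sum>b | b \<in> words {..<B} (k - i) \<and> successively (<) b. if chain f (a @ b) then G (fill f (a @ b)) else 0)
    = (\<Sum>\<nu> | shape \<nu> \<and> area \<nu> = area f + k. of_int (Q_weight f \<nu>) * G \<nu>)"
proof -
  let ?W = "words {..<B}"
  let ?A = "\<lambda>i. {a \<in> ?W i. successively (\<lambda>x y. \<not> x < y) a}"
  let ?B = "\<lambda>i. {b \<in> ?W (k - i). successively (<) b}"
  let ?T = "{(a, b). a \<in> ?W (length a) \<and> b \<in> ?W (length b) \<and> length a + length b = k \<and>
      sorted_wrt (>) a \<and> sorted_wrt (<) b \<and> chain f (a @ b)}"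
  have fin: "finite (?A i)" "finite (?B i)" for i by (simp_all add: finite_words)
  have "(\<Sum>i\<le>k. \<Sum>a\<in>?A i. \<Sum>b\<in>?B i. if chain f (a @ b) then G (fill f (a @ b)) else 0)
      = (\<Sum>i\<le>k. \<Sum>(a, b)\<in>?A i \<times> ?B i. if chain f (a @ b) then G (fill f (a @ b)) else 0)"
    by (simp add: sum.cartesian_product)
  also have "\<dots> = (\<Sum>(i, a, b)\<in>(SIGMA i:{..k}. ?A i \<times> ?B i). if chain f (a @ b) then G (fill f (a @ b)) else 0)"
    by (subst sum.Sigma) (use fin in auto)
  also have "\<dots> = (\<Sum>(i, a, b)\<in>{(i, a, b). (a, b) \<in> ?T \<and> i = length a}. G (fill f (a @ b)))"
  proof (rule sum.mono_neutral_cong_right)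
    show "finite (SIGMA i:{..k}. ?A i \<times> ?B i)" using fin by auto
    show sub: "{(i, a, b). (a, b) \<in> ?T \<and> i = length a} \<subseteq> (SIGMA i:{..k}. ?A i \<times> ?B i)"
      by (auto simp: words_def successively_iff_sorted_wrt_strong
          intro!: successively_if_sorted_wrt elim: sorted_wrt_mono_rel[rotated])
    show "\<forall>p\<in>(SIGMA i:{..k}. ?A i \<times> ?B i) - {(i, a, b). (a, b) \<in> ?T \<and> i = length a}.
        (case p of (i, a, b) \<Rightarrow> if chain f (a @ b) then G (fill f (a @ b)) else 0) = 0"
    proof (rule ballI)
      fix p assume pin: "p \<in> (SIGMA i:{..k}. ?A i \<times> ?B i) - {(i, a, b). (a, b) \<in> ?T \<and> i = length a}"
      obtain i a b where p: "p = (i, a, b)" by (cases p) auto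
      have i: "i \<in> {..k}" and a: "a \<in> ?W i" "successively (\<lambda>x y. \<not> x < y) a"
        and b: "b \<in> ?W (k - i)" "successively (<) b" and n: "\<not> ((a, b) \<in> ?T \<and> i = length a)"
        using pin unfolding p by blast+
      have "\<not> chain f (a @ b)"
      proof
        assume c: "chain f (a @ b)"
        \<comment> \<open>The first run is only known to be weakly decreasing; the absence of
          repetitions makes it strict.\<close>
        hence "successively (\<noteq>) a" by (intro chain_no_repeat[OF f]) (simp add: chain_append)
        hence "successively (>) a" using a(2) unfolding successively_iff_nth by (meson linorder_neqE_nat)
        hence "sorted_wrt (>) a" by (simp add: successively_conv_sorted_wrt transp_def)
        moreover have "sorted_wrt (<) b" using b(2) by (simp add: successively_conv_sorted_wrt)
        ultimately show False using n a(1) b(1) c i by (auto simp: words_def)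
      qed
      thus "(case p of (i, a, b) \<Rightarrow> if chain f (a @ b) then G (fill f (a @ b)) else 0) = 0"
        unfolding p by simp
    qed
  qed auto
  also have "\<dots> = (\<Sum>(a, b)\<in>?T. G (fill f (a @ b)))"
    by (rule sum.reindex_bij_witness[where i="\<lambda>(a, b). (length a, a, b)" and j="\<lambda>(i, a, b). (a, b)"]) auto
  also have "\<dots> = (\<Sum>(\<nu>, M)\<in>(SIGMA \<nu>:{\<nu>. shape \<nu> \<and> area \<nu> = area f + k \<and> strip f \<nu>}. marks f \<nu>). G \<nu>)"
  proof (rule sum.reindex_bij_witness[where i="\<lambda>(\<nu>, M). (rev (sorted_list_of_set M), sorted_list_of_set (boxes f \<nu> - M))"
        and j="\<lambda>(a, b). (fill f (a @ b), set a)"])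
    fix p assume "p \<in> ?T"
    then obtain a b where p: "p = (a, b)" and ab: "sorted_wrt (>) a" "sorted_wrt (<) b" "chain f (a @ b)"
      and len: "length a + length b = k" by auto
    note v = valley_marks[OF f ab]
    have "sorted_wrt (<) (rev a)" using ab(1) by (simp add: sorted_wrt_rev)
    hence "sorted_list_of_set (set (rev a)) = rev a"
      by (metis sorted_list_of_set.idem_if_sorted_distinct strict_sorted_iff)
    hence "sorted_list_of_set (set a) = rev a" by simp
    moreover have "sorted_list_of_set (set b) = b"
      using ab(2) by (metis sorted_list_of_set.idem_if_sorted_distinct strict_sorted_iff)
    moreover have "boxes f (fill f (a @ b)) - set a = set b" using v(1,3) by blast
    ultimately show "(case case p of (a, b) \<Rightarrow> (fill f (a @ b), set a) of
        (\<nu>, M) \<Rightarrow> (rev (sorted_list_of_set M), sorted_list_of_set (boxes f \<nu> - M))) = p"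
      by (simp add: p)
    show "(case p of (a, b) \<Rightarrow> (fill f (a @ b), set a)) \<in> (SIGMA \<nu>:{\<nu>. shape \<nu> \<and> area \<nu> = area f + k \<and> strip f \<nu>}. marks f \<nu>)"
      using v(2,4) shape_fill[OF f ab(3)] area_fill[OF f ab(3)] len by (simp add: p)
    show "(case case p of (a, b) \<Rightarrow> (fill f (a @ b), set a) of (\<nu>, M) \<Rightarrow> G \<nu>) = (case p of (a, b) \<Rightarrow> G (fill f (a @ b)))"
      by (simp add: p)
  next
    fix p assume "p \<in> (SIGMA \<nu>:{\<nu>. shape \<nu> \<and> area \<nu> = area f + k \<and> strip f \<nu>}. marks f \<nu>)"
    then obtain \<nu> M where p: "p = (\<nu>, M)" and \<nu>: "shape \<nu>" "area \<nu> = area f + k" "strip f \<nu>" "M \<in> marks f \<nu>"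
      by auto
    note m = marks_valley[OF f \<nu>(1,3,4)]
    let ?a = "rev (sorted_list_of_set M)" and ?b = "sorted_list_of_set (boxes f \<nu> - M)"
    have bx: "x < B" if "x \<in> boxes f \<nu>" for x
    proof -
      have "\<nu> x \<noteq> 0" using that by (simp add: boxes_def)
      thus ?thesis using shape_support[OF \<nu>(1), of x] \<nu>(2) B by simp
    qed
    have MX: "M \<subseteq> boxes f \<nu>" using \<nu>(4) by (auto simp: marks_def)
    show "(case case p of (\<nu>, M) \<Rightarrow> (rev (sorted_list_of_set M), sorted_list_of_set (boxes f \<nu> - M)) of
        (a, b) \<Rightarrow> (fill f (a @ b), set a)) = p"
      using m(3,6) by (simp add: p)
    have "length ?a + length ?b = k"
      using area_fill[OF f m(5)] m(6) \<nu>(2) by simp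
    moreover have "?a \<in> ?W (length ?a)" unfolding words_def mem_Collect_eq m(3) using MX bx by auto
    moreover have "?b \<in> ?W (length ?b)" unfolding words_def mem_Collect_eq m(4) using bx by auto
    ultimately show "(case p of (\<nu>, M) \<Rightarrow> (rev (sorted_list_of_set M), sorted_list_of_set (boxes f \<nu> - M))) \<in> ?T"
      using m(1,2,5) by (simp only: p prod.case mem_Collect_eq simp_thms)
  qed
  also have "\<dots> = (\<Sum>\<nu> | shape \<nu> \<and> area \<nu> = area f + k \<and> strip f \<nu>. \<Sum>M\<in>marks f \<nu>. G \<nu>)"
  proof (rule sum.Sigma[symmetric])
    show "finite {\<nu>. shape \<nu> \<and> area \<nu> = area f + k \<and> strip f \<nu>}"
      by (rule finite_subset[OF _ finite_shapes_eq[of "area f + k"]]) auto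
    show "\<forall>\<nu>\<in>{\<nu>. shape \<nu> \<and> area \<nu> = area f + k \<and> strip f \<nu>}. finite (marks f \<nu>)"
    proof
      fix \<nu> assume "\<nu> \<in> {\<nu>. shape \<nu> \<and> area \<nu> = area f + k \<and> strip f \<nu>}"
      hence "finite (Pow (boxes f \<nu>))" using finite_boxes by auto
      thus "finite (marks f \<nu>)" by (rule rev_finite_subset) (auto simp: marks_def)
    qed
  qed
  also have "\<dots> = (\<Sum>\<nu> | shape \<nu> \<and> area \<nu> = area f + k \<and> strip f \<nu>. of_int (Q_weight f \<nu>) * G \<nu>)"
  proof (rule sum.cong[OF refl])
    fix \<nu> assume \<nu>: "\<nu> \<in> {\<nu>. shape \<nu> \<and> area \<nu> = area f + k \<and> strip f \<nu>}"
    hence "Q_weight f \<nu> = int (card (marks f \<nu>))" using card_marks(1)[of \<nu> f] by auto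
    thus "(\<Sum>M\<in>marks f \<nu>. G \<nu>) = of_int (Q_weight f \<nu>) * G \<nu>" by simp
  qed
  also have "\<dots> = (\<Sum>\<nu> | shape \<nu> \<and> area \<nu> = area f + k. of_int (Q_weight f \<nu>) * G \<nu>)"
    using finite_shapes_eq[of "area f + k"] by (intro sum.mono_neutral_left) (auto simp: Q_weight_def P_weight_def)
  finally show ?thesis .
qed

section \<open>Zigzag sums in commuting and noncommuting variables\<close>

definition monomial_of :: "('a \<Rightarrow> 'r::comm_ring_1) \<Rightarrow> 'a list \<Rightarrow> 'r" where
  "monomial_of x w = prod_list (map x w)"

lemma monomial_of_simps [simp]:
  "monomial_of x [] = 1" "monomial_of x (k # w) = x k * monomial_of x w"
  "monomial_of x (u @ v) = monomial_of x u * monomial_of x v"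
  by (simp_all add: monomial_of_def)

text \<open>The complete homogeneous polynomial of degree \<open>i\<close>, written with the
  complement of the relation \<open>(>)\<close> so that its words are the first runs of peakless
  words; \<open>esum\<close> is the elementary symmetric polynomial of the second runs.\<close>

definition hsum :: "(nat \<Rightarrow> 'r::comm_ring_1) \<Rightarrow> nat \<Rightarrow> nat \<Rightarrow> 'r" where
  "hsum x m i = (\<Sum>a | a \<in> words {1..m} i \<and> successively (\<lambda>x y. \<not> x > y) a. monomial_of x a)"

definition esum :: "(nat \<Rightarrow> 'r::comm_ring_1) \<Rightarrow> nat \<Rightarrow> nat \<Rightarrow> 'r" where
  "esum x m i = (\<Sum>b | b \<in> words {1..m} i \<and> successively (>) b. monomial_of x b)"

definition qsum :: "(nat \<Rightarrow> 'r::comm_ring_1) \<Rightarrow> nat \<Rightarrow> nat \<Rightarrow> 'r" where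
  "qsum x m k = (\<Sum>i\<le>k. hsum x m i * esum x m (k - i))"

lemma words_0_filter: "P [] \<Longrightarrow> {a. a \<in> words A 0 \<and> P a} = {[]}"
  by (auto simp: words_def)

lemma hsum_0: "hsum x m 0 = 1" and esum_0: "esum x m 0 = 1"
  by (simp_all add: hsum_def esum_def words_0_filter)

text \<open>A weakly increasing word that contains the largest letter ends with it, and the rest may
  contain it again.\<close>

lemma hsum_Suc: "hsum x (Suc m) (Suc i) = hsum x m (Suc i) + x (Suc m) * hsum x (Suc m) i"
proof -
  have S: "successively (\<lambda>x y. \<not> x > y) a \<longleftrightarrow> sorted a" for a :: "nat list"
    by (simp add: not_less successively_conv_sorted_wrt)
  let ?U = "{a. a \<in> words {1..Suc m} (Suc i) \<and> sorted a}"
  let ?V = "{a. a \<in> words {1..m} (Suc i) \<and> sorted a}"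
  let ?W = "{a. a \<in> words {1..Suc m} i \<and> sorted a}"
  have "?U = ?V \<union> (\<lambda>a. a @ [Suc m]) ` ?W"
  proof (intro set_eqI iffI)
    fix a assume a: "a \<in> ?U"
    then obtain b c where bc: "a = b @ [c]" by (cases a rule: rev_cases) (auto simp: words_def)
    show "a \<in> ?V \<union> (\<lambda>a. a @ [Suc m]) ` ?W"
    proof (cases "c = Suc m")
      case True
      thus ?thesis using a bc by (auto simp: words_def sorted_append)
    next
      case False
      hence "c \<le> m" using a bc by (auto simp: words_def)
      thus ?thesis using a bc by (fastforce simp: words_def sorted_append)
    qed
  qed (auto simp: words_def sorted_append subset_iff)
  moreover have "?V \<inter> (\<lambda>a. a @ [Suc m]) ` ?W = {}" by (auto simp: words_def)
  moreover have "inj_on (\<lambda>a. a @ [Suc m]) ?W" by (auto simp: inj_on_def)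
  ultimately have "sum (monomial_of x) ?U = sum (monomial_of x) ?V + (\<Sum>a\<in>?W. monomial_of x (a @ [Suc m]))"
    by (simp add: sum.union_disjoint finite_words sum.reindex)
  thus ?thesis unfolding hsum_def S by (simp add: sum_distrib_left mult.commute)
qed

text \<open>A strictly decreasing word that contains the largest letter begins with it and does not
  contain it again.\<close>

lemma esum_Suc: "esum x (Suc m) (Suc i) = esum x m (Suc i) + x (Suc m) * esum x m i"
proof -
  have S: "successively (>) a \<longleftrightarrow> sorted_wrt (>) a" for a :: "nat list"
    by (simp add: successively_conv_sorted_wrt transp_def)
  let ?U = "{a. a \<in> words {1..Suc m} (Suc i) \<and> sorted_wrt (>) a}"
  let ?V = "{a. a \<in> words {1..m} (Suc i) \<and> sorted_wrt (>) a}"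
  let ?W = "{a. a \<in> words {1..m} i \<and> sorted_wrt (>) a}"
  have "?U = ?V \<union> (#) (Suc m) ` ?W"
  proof (intro set_eqI iffI)
    fix a assume a: "a \<in> ?U"
    then obtain b c where bc: "a = c # b" by (cases a) (auto simp: words_def)
    show "a \<in> ?V \<union> (#) (Suc m) ` ?W"
    proof (cases "c = Suc m")
      case True
      hence "b \<in> ?W" using a bc by (fastforce simp: words_def)
      thus ?thesis using True bc by blast
    next
      case False
      hence "c \<le> m" using a bc by (auto simp: words_def)
      thus ?thesis using a bc by (fastforce simp: words_def)
    qed
  qed (auto simp: words_def subset_iff less_Suc_eq_le)
  moreover have "?V \<inter> (#) (Suc m) ` ?W = {}" by (auto simp: words_def)
  moreover have "inj_on ((#) (Suc m)) ?W" by (auto simp: inj_on_def)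
  ultimately have "sum (monomial_of x) ?U = sum (monomial_of x) ?V + (\<Sum>a\<in>?W. monomial_of x (Suc m # a))"
    by (simp add: sum.union_disjoint finite_words sum.reindex)
  thus ?thesis unfolding esum_def S by (simp add: sum_distrib_left)
qed

lemma qsum_0: "qsum x m 0 = 1"
  by (simp add: qsum_def hsum_0 esum_0)

lemma qsum_0_Suc: "qsum x 0 (Suc k) = 0"
  unfolding qsum_def
proof (rule sum.neutral, rule ballI)
  fix i
  have "words {1..0::nat} (Suc j) = {}" for j by (auto simp: words_def)
  hence z: "hsum x 0 (Suc j) = 0" "esum x 0 (Suc j) = 0" for j
    by (simp_all add: hsum_def esum_def)
  show "hsum x 0 i * esum x 0 (Suc k - i) = 0"
    using z by (cases i) auto
qed

text \<open>A new variable x divides the generating series of the \<open>hsum\<close> factor by 1 -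
  x t and multiplies that of the \<open>esum\<close> factor by 1 + x t. This is the recursion that
  \<open>pieri\<close> asks of \<open>q\<close>.\<close>

lemma qsum_Suc:
  "qsum x (Suc m) (Suc k) = x (Suc m) * qsum x (Suc m) k + qsum x m (Suc k) + x (Suc m) * qsum x m k"
proof -
  let ?X = "x (Suc m)" and ?h' = "hsum x (Suc m)" and ?e' = "esum x (Suc m)" and ?h = "hsum x m" and ?e = "esum x m"
  have 1: "(\<Sum>i\<le>Suc k. ?h' i * ?e' (Suc k - i)) = (\<Sum>i\<le>Suc k. ?h i * ?e' (Suc k - i)) + ?X * (\<Sum>i\<le>k. ?h' i * ?e' (k - i))"
    unfolding sum.atMost_Suc_shift
    by (simp add: hsum_Suc hsum_0 distrib_right sum.distrib sum_distrib_left mult.assoc)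
  have "(\<Sum>i\<le>k. ?h i * ?e' (Suc k - i)) = (\<Sum>i\<le>k. ?h i * ?e (Suc k - i) + ?X * (?h i * ?e (k - i)))"
  proof (rule sum.cong[OF refl])
    fix i assume "i \<in> {..k}"
    hence "Suc k - i = Suc (k - i)" by auto
    thus "?h i * ?e' (Suc k - i) = ?h i * ?e (Suc k - i) + ?X * (?h i * ?e (k - i))"
      by (simp add: esum_Suc algebra_simps)
  qed
  hence 2: "(\<Sum>i\<le>Suc k. ?h i * ?e' (Suc k - i)) = (\<Sum>i\<le>Suc k. ?h i * ?e (Suc k - i)) + ?X * (\<Sum>i\<le>k. ?h i * ?e (k - i))"
    by (simp add: esum_0 sum.distrib sum_distrib_left)
  show ?thesis unfolding qsum_def 1 2 by (simp only: add_ac)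
qed

lemma sum_peakless_monomials:
  assumes "0 < k"
  shows "(\<Sum>v | v \<in> words {1..m} k \<and> peakless (>) v. 2 * monomial_of x (u @ v)) = qsum x m k * monomial_of x u"
proof -
  have "(\<Sum>v | v \<in> words {1..m} k \<and> peakless (>) v. 2 * monomial_of x (u @ v))
      = monomial_of x u * (\<Sum>v | v \<in> words {1..m} k \<and> peakless (>) v. 2 * monomial_of x v)"
    unfolding sum_distrib_left by (rule sum.cong) (auto simp: algebra_simps)
  also have "(\<Sum>v | v \<in> words {1..m} k \<and> peakless (>) v. 2 * monomial_of x v) = qsum x m k"
    unfolding sum_peakless[OF finite_atLeastAtMost assms] qsum_def hsum_def esum_def
    by (simp add: sum_product)
  finally show ?thesis by (simp add: mult.commute)
qed

lemma P_poly_zero: "P_poly x m (\<lambda>_. 0) = 1"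
proof (induction m)
  case (Suc m)
  have "{h. shape h \<and> area h \<le> area (\<lambda>_. 0)} = {\<lambda>_. 0}"
    using area_eq_0 shape_const0 by (auto simp: area_zero)
  moreover have "P_weight (\<lambda>_. 0) (\<lambda>_. 0) = 1"
    by (simp add: P_weight_def strip_refl strip_starts_def)
  ultimately show ?case using Suc by simp
qed simp

text \<open>Content words that are not chains are given the value 0. On chains, appending peakless
  words adds a strip with weight \<open>Q_weight\<close>, and \<open>pieri\<close> turns this into
  the multiplier \<open>qsum x m k\<close> that also governs monomials.\<close>

theorem zigzag_words_eq_chains:
  fixes x :: "nat \<Rightarrow> 'r::{idom, ring_char_0}"
  assumes "odd N"
  shows "(\<Sum>w | w \<in> words {1..m} N \<and> zigzag (>) w. monomial_of x w) =
    (\<Sum>c | c \<in> words {..<N} N \<and> zigzag (<) c \<and> chain0 c. P_poly x m (fill0 c))"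
proof -
  let ?F = "\<lambda>c. if chain0 c then P_poly x m (fill0 c) else 0"
  have "(\<Sum>w | w \<in> words {1..m} N \<and> zigzag (>) w. monomial_of x w) =
      (\<Sum>c | c \<in> words {..<N} N \<and> zigzag (<) c. ?F c)"
  proof (rule zigzag_sum_determined[where q="qsum x m" and N=N, OF _ _ _ _ _ assms])
    fix u :: "nat list" and k :: nat
    assume k: "0 < k"
    show "(\<Sum>v | v \<in> words {1..m} k \<and> peakless (>) v. 2 * monomial_of x (u @ v)) = qsum x m k * monomial_of x u"
      by (rule sum_peakless_monomials[OF k])
    assume N: "length u + k \<le> N"
    show "(\<Sum>v | v \<in> words {..<N} k \<and> peakless (<) v. 2 * ?F (u @ v)) = qsum x m k * ?F u"
    proof (cases "chain0 u")
      case False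
      thus ?thesis by (simp add: chain_append)
    next
      case True
      define f where "f = fill0 u"
      have f: "shape f" and area: "area f = length u"
        using shape_fill[OF shape_const0 True] area_fill[OF shape_const0 True] by (simp_all add: f_def area_zero)
      have F: "?F (u @ v) = (if chain f v then P_poly x m (fill f v) else 0)" for v
        using True by (simp only: chain_append fill_append f_def simp_thms)
      have "(\<Sum>v | v \<in> words {..<N} k \<and> peakless (<) v. 2 * ?F (u @ v))
          = (\<Sum>\<nu> | shape \<nu> \<and> area \<nu> = area f + k. of_int (Q_weight f \<nu>) * P_poly x m \<nu>)"
        unfolding F by (subst sum_peakless[OF finite_lessThan k], rule sum_valley_chains[OF f])
          (use N area in simp)
      also have "\<dots> = qsum x m k * P_poly x m f"
        by (rule pieri[OF qsum_0 qsum_0_Suc qsum_Suc f])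
      finally show ?thesis using True by (simp only: if_True f_def)
    qed
  qed (simp_all add: P_poly_zero)
  also have "\<dots> = (\<Sum>c | (c \<in> words {..<N} N \<and> zigzag (<) c) \<and> chain0 c. P_poly x m (fill0 c))"
    using sum.inter_filter[of "{c \<in> words {..<N} N. zigzag (<) c}" "\<lambda>c. P_poly x m (fill0 c)" "chain0"]
    by (simp add: finite_words)
  finally show ?thesis by (simp add: conj_assoc)
qed

section \<open>Generating polynomials and the zigzag shape\<close>

definition var :: "nat \<Rightarrow> (nat \<Rightarrow>\<^sub>0 nat) \<Rightarrow>\<^sub>0 int" where
  "var i = Poly_Mapping.single (Poly_Mapping.single i 1) 1"

lemma prod_var:
  "finite D \<Longrightarrow> (\<Prod>c\<in>D. var (h c)) = Poly_Mapping.single (\<Sum>c\<in>D. Poly_Mapping.single (h c) 1) 1"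
  by (induction D rule: finite_induct) (simp_all add: var_def mult_single)

lemma lookup_sum_single:
  assumes "finite D"
  shows "Poly_Mapping.lookup (\<Sum>c\<in>D. Poly_Mapping.single (h c) (1::nat)) i = card {c \<in> D. h c = i}"
proof -
  have "Poly_Mapping.lookup (\<Sum>c\<in>D. Poly_Mapping.single (h c) (1::nat)) i = (\<Sum>c\<in>D. if h c = i then 1 else 0)"
    by (auto simp: lookup_sum lookup_single when_def intro!: sum.cong)
  also have "\<dots> = card {c \<in> D. h c = i}"
    using assms by (simp add: sum.inter_filter[symmetric])
  finally show ?thesis .
qed

text \<open>A tableau with an entry of index larger than \<open>m\<close> cannot have the weight
  \<open>a\<close>, so this coefficient of the series is a coefficient of a finite sum of
  monomials.\<close>

lemma tableau_series_eq_lookup: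
  fixes a :: monomial
  assumes D: "finite D" and S: "finite {T \<in> A. \<forall>c\<in>D. idx (T c) \<le> m}"
    and m: "Poly_Mapping.keys a \<subseteq> {..m}"
  shows "tableau_series D idx A a =
    Poly_Mapping.lookup (\<Sum>T | T \<in> A \<and> (\<forall>c\<in>D. idx (T c) \<le> m). \<Prod>c\<in>D. var (idx (T c))) a"
proof -
  let ?S = "{T \<in> A. \<forall>c\<in>D. idx (T c) \<le> m}"
  let ?e = "\<lambda>T. \<Sum>c\<in>D. Poly_Mapping.single (idx (T c)) (1::nat)"
  have e: "?e T = a \<longleftrightarrow> (\<forall>i. Poly_Mapping.lookup a i = card {c \<in> D. idx (T c) = i})" for T
    unfolding poly_mapping_eq_iff fun_eq_iff lookup_sum_single[OF D, of "\<lambda>c. idx (T c)"] by auto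
  have "idx (T c) \<le> m" if "?e T = a" "c \<in> D" for T c
  proof -
    have "{d \<in> D. idx (T d) = idx (T c)} \<noteq> {}" using that(2) by blast
    hence "card {d \<in> D. idx (T d) = idx (T c)} \<noteq> 0" using D by simp
    hence "idx (T c) \<in> Poly_Mapping.keys a" using that(1) unfolding e by (simp add: in_keys_iff)
    thus ?thesis using m by auto
  qed
  hence set: "{T \<in> A. \<forall>i. Poly_Mapping.lookup a i = card {c \<in> D. idx (T c) = i}} = {T \<in> ?S. ?e T = a}"
    unfolding e[symmetric] by blast
  have "Poly_Mapping.lookup (\<Sum>T\<in>?S. \<Prod>c\<in>D. var (idx (T c))) a
      = (\<Sum>T\<in>?S. if ?e T = a then 1 else 0)"
    by (auto simp: lookup_sum prod_var[OF D] lookup_single when_def intro!: sum.cong)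
  also have "\<dots> = int (card {T \<in> ?S. ?e T = a})"
    using S by (simp add: sum.inter_filter[symmetric])
  finally show ?thesis unfolding tableau_series_def set by simp
qed


text \<open>The zigzag shape is read from its bottom left to its top right cell.\<close>

definition zcell :: "nat \<Rightarrow> nat \<Rightarrow> cell" where
  "zcell n p = (n - Suc (Suc p div 2), p div 2)"

lemma staircase_length: "length (staircase k) = nat k"
  by (simp add: staircase_def)

lemma staircase_nth:
  assumes "i < nat k"
  shows "staircase k ! i = nat k - i"
proof -
  have "[1..k] ! (nat k - Suc i) = 1 + int (nat k - Suc i)"
    using assms by (intro nth_upto) linarith
  also have "\<dots> = int (nat k - i)" using assms by (simp add: of_nat_diff)
  finally have "nat ([1..k] ! (nat k - Suc i)) = nat k - i" by simp
  thus ?thesis using assms by (simp add: staircase_def rev_nth)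
qed

lemma diagram_staircase: "diagram (staircase k) = {(i, j). i + j < nat k}"
  by (auto simp: diagram_def staircase_length staircase_nth)

definition zigzag_cells :: "nat \<Rightarrow> cell set" where
  "zigzag_cells n = {(i, j). n \<le> i + j + 2 \<and> i + j < n}"

lemma zigzag_diagram: "diagram (staircase (int n)) - diagram (staircase (int n - 2)) = zigzag_cells n"
  by (auto simp: diagram_staircase zigzag_cells_def)

text \<open>The reading alternates between the antidiagonals \<open>i + j + 1 = n\<close> (even
  positions) and \<open>i + j + 2 = n\<close> (odd positions).\<close>

definition zpos :: "nat \<Rightarrow> cell \<Rightarrow> nat" where
  "zpos n = (\<lambda>(i, j). if i + j + 1 = n then 2 * j else 2 * j + 1)"

lemma zpos_less: "c \<in> zigzag_cells n \<Longrightarrow> zpos n c < 2 * n - 1"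
  by (auto simp: zpos_def zigzag_cells_def split: if_splits)

lemma zcell_in: "p < 2 * n - 1 \<Longrightarrow> zcell n p \<in> zigzag_cells n"
  by (auto simp: zcell_def zigzag_cells_def; presburger)

lemma zpos_zcell: "p < 2 * n - 1 \<Longrightarrow> zpos n (zcell n p) = p"
  by (auto simp: zcell_def zpos_def; presburger)

lemma zcell_zpos: "c \<in> zigzag_cells n \<Longrightarrow> zcell n (zpos n c) = c"
  by (auto simp: zcell_def zpos_def zigzag_cells_def)

text \<open>Rows and columns of the zigzag shape have at most two cells, which are neighbours in the
  reading. From an even position the reading goes up a column, where entries decrease strictly; from
  an odd one it goes right along a row, where they increase weakly.\<close>

lemma sum_SSYT_zigzag:
  fixes x :: "nat \<Rightarrow> 'r::comm_ring_1"
  shows "(\<Sum>T | T \<in> SSYT (zigzag_cells n) \<and> (\<forall>c\<in>zigzag_cells n. T c \<le> m). \<Prod>c\<in>zigzag_cells n. x (T c)) =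
    (\<Sum>w | w \<in> words {1..m} (2 * n - 1) \<and> zigzag (>) w. monomial_of x w)"
proof (rule sum.reindex_bij_witness[where i="\<lambda>w. \<lambda>c\<in>zigzag_cells n. w ! zpos n c"
      and j="\<lambda>T. map (\<lambda>p. T (zcell n p)) [0..<2 * n - 1]"])
  let ?Z = "zigzag_cells n" and ?N = "2 * n - 1"
  fix T assume T: "T \<in> {T. T \<in> SSYT ?Z \<and> (\<forall>c\<in>?Z. T c \<le> m)}"
  let ?w = "map (\<lambda>p. T (zcell n p)) [0..<?N]"
  have ext: "T \<in> extensional ?Z" and ge: "\<And>c. c \<in> ?Z \<Longrightarrow> 1 \<le> T c" and le: "\<And>c. c \<in> ?Z \<Longrightarrow> T c \<le> m"
    and row: "\<And>i j j'. (i, j) \<in> ?Z \<Longrightarrow> (i, j') \<in> ?Z \<Longrightarrow> j < j' \<Longrightarrow> T (i, j) \<le> T (i, j')"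
    and col: "\<And>i i' j. (i, j) \<in> ?Z \<Longrightarrow> (i', j) \<in> ?Z \<Longrightarrow> i < i' \<Longrightarrow> T (i, j) < T (i', j)"
    using T unfolding SSYT_def PiE_def by blast+
  show "(\<lambda>c\<in>?Z. ?w ! zpos n c) = T"
  proof
    fix c
    show "(\<lambda>c\<in>?Z. ?w ! zpos n c) c = T c"
    proof (cases "c \<in> ?Z")
      case True
      thus ?thesis using zpos_less[OF True] zcell_zpos[OF True] by simp
    next
      case False
      thus ?thesis using extensional_arb[OF ext False] by simp
    qed
  qed
  have "zigzag (>) ?w" unfolding zigzag_def
  proof (intro allI impI)
    fix p assume p: "Suc p < length ?w"
    hence p1: "p < ?N" and p2: "Suc p < ?N" by auto
    have w: "?w ! p = T (zcell n p)" "?w ! Suc p = T (zcell n (Suc p))" using p1 p2 by simp_all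
    note z = zcell_in[OF p1] zcell_in[OF p2]
    show "(?w ! p > ?w ! Suc p) = even p"
    proof (cases "even p")
      case True
      then obtain q where q: "p = 2 * q" by (auto elim: evenE)
      have e: "zcell n p = (n - Suc q, q)" "zcell n (Suc p) = (n - Suc (Suc q), q)"
        by (simp_all add: zcell_def q)
      have "n - Suc (Suc q) < n - Suc q" using p2 q by simp
      hence "T (zcell n (Suc p)) < T (zcell n p)"
        using z unfolding e by (intro col)
      thus ?thesis using True unfolding w by simp
    next
      case False
      then obtain q where q: "p = 2 * q + 1" by (auto elim: oddE)
      have e: "zcell n p = (n - Suc (Suc q), q)" "zcell n (Suc p) = (n - Suc (Suc q), Suc q)"
        by (simp_all add: zcell_def q)
      have "T (zcell n p) \<le> T (zcell n (Suc p))"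
        using z unfolding e by (rule row) simp
      thus ?thesis using False unfolding w by simp
    qed
  qed
  moreover have "T (zcell n p) \<in> {1..m}" if "p < ?N" for p
    using ge[OF zcell_in[OF that]] le[OF zcell_in[OF that]] by simp
  hence "set ?w \<subseteq> {1..m}" by auto
  ultimately show "?w \<in> {w. w \<in> words {1..m} ?N \<and> zigzag (>) w}" by (simp add: words_def)
  have bij: "bij_betw (zcell n) {..<?N} ?Z"
    by (rule bij_betw_byWitness[where f'="zpos n"])
      (use zpos_less[of _ n] zcell_in[of _ n] in \<open>auto simp: zpos_zcell zcell_zpos\<close>)
  have "monomial_of x ?w = (\<Prod>p<?N. x (T (zcell n p)))"
    unfolding monomial_of_def by (simp add: prod.list_conv_set_nth atLeast0LessThan)
  also have "\<dots> = (\<Prod>c\<in>?Z. x (T c))"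
    by (rule prod.reindex_bij_betw[OF bij])
  finally show "monomial_of x ?w = (\<Prod>c\<in>?Z. x (T c))" .
next
  let ?Z = "zigzag_cells n" and ?N = "2 * n - 1"
  fix w assume w: "w \<in> {w. w \<in> words {1..m} ?N \<and> zigzag (>) w}"
  let ?T = "\<lambda>c\<in>?Z. w ! zpos n c"
  have len: "length w = ?N" and wm: "set w \<subseteq> {1..m}" and zz: "zigzag (>) w" using w by (auto simp: words_def)
  show "map (\<lambda>p. ?T (zcell n p)) [0..<?N] = w"
  proof (rule nth_equalityI)
    fix p assume "p < length (map (\<lambda>p. ?T (zcell n p)) [0..<?N])"
    hence p: "p < ?N" by simp
    show "map (\<lambda>p. ?T (zcell n p)) [0..<?N] ! p = w ! p"
      using zcell_in[OF p] zpos_zcell[OF p] p by simp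
  qed (simp add: len)
  have val: "?T c = w ! zpos n c" if "c \<in> ?Z" for c using that by simp
  have bd: "?T c \<in> {1..m}" if "c \<in> ?Z" for c
  proof -
    have "w ! zpos n c \<in> set w" using zpos_less[OF that] len by (intro nth_mem) simp
    thus ?thesis unfolding val[OF that] using wm by blast
  qed
  have row: "?T (i, j) \<le> ?T (i, j')" if c: "(i, j) \<in> ?Z" "(i, j') \<in> ?Z" "j < j'" for i j j'
  proof -
    have j': "j' = Suc j" "i + j + 2 = n" using c by (auto simp: zigzag_cells_def)
    have "zpos n (i, j) = 2 * j + 1" "zpos n (i, j') = Suc (2 * j + 1)" using j' by (auto simp: zpos_def)
    moreover have "Suc (2 * j + 1) < length w" using j' len by auto
    ultimately show ?thesis
      using zz[unfolded zigzag_def, rule_format, of "2 * j + 1"] val[OF c(1)] val[OF c(2)] by simp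
  qed
  have col: "?T (i, j) < ?T (i', j)" if c: "(i, j) \<in> ?Z" "(i', j) \<in> ?Z" "i < i'" for i i' j
  proof -
    have i': "i' = Suc i" "i + j + 2 = n" using c by (auto simp: zigzag_cells_def)
    have "zpos n (i, j) = Suc (2 * j)" "zpos n (i', j) = 2 * j" using i' by (auto simp: zpos_def)
    moreover have "Suc (2 * j) < length w" using i' len by auto
    ultimately show ?thesis
      using zz[unfolded zigzag_def, rule_format, of "2 * j"] val[OF c(1)] val[OF c(2)] by simp
  qed
  have PE: "?T \<in> ?Z \<rightarrow>\<^sub>E {1..}" using bd by (auto simp: PiE_def)
  have "\<forall>c\<in>?Z. ?T c \<le> m" using bd by auto
  thus "?T \<in> {T. T \<in> SSYT ?Z \<and> (\<forall>c\<in>?Z. T c \<le> m)}"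
    unfolding SSYT_def using PE row col by blast
qed

section \<open>Marked shifted tableaux\<close>

definition cells :: "(nat \<Rightarrow> nat) \<Rightarrow> cell set" where
  "cells f = {(i, j). i \<le> j \<and> i < f (j - i)}"

lemma cells_iff [simp]: "(i, i + k) \<in> cells f \<longleftrightarrow> i < f k"
  by (simp add: cells_def)

lemma cellsE:
  assumes "c \<in> cells f"
  obtains i k where "c = (i, i + k)" "i < f k"
proof -
  obtain i j where c: "c = (i, j)" by (cases c)
  have "i \<le> j" "i < f (j - i)" using assms by (auto simp: c cells_def)
  thus ?thesis using that[of i "j - i"] by (simp add: c)
qed

lemma cells_eq_SIGMA:
  assumes "shape f" "f K = 0"
  shows "bij_betw (\<lambda>(k, i). (i, i + k)) (SIGMA k:{..<K}. {..<f k}) (cells f)"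
proof (rule bij_betwI')
  fix p q :: "nat \<times> nat"
  show "((case p of (k, i) \<Rightarrow> (i, i + k)) = (case q of (k, i) \<Rightarrow> (i, i + k))) = (p = q)"
    by (auto split: prod.splits)
next
  fix c assume "c \<in> cells f"
  then obtain i k where c: "c = (i, i + k)" "i < f k" by (rule cellsE)
  have "k < K" using shape_zero[OF assms, of k] c(2) by (cases "k < K") auto
  thus "\<exists>p\<in>SIGMA k:{..<K}. {..<f k}. c = (case p of (k, i) \<Rightarrow> (i, i + k))" using c by auto
qed auto

lemma
  assumes "shape f"
  shows finite_cells: "finite (cells f)" and card_cells: "card (cells f) = area f"
proof -
  obtain K where K: "f K = 0" using assms by (auto simp: shape_def)
  note b = cells_eq_SIGMA[OF assms K]
  show "finite (cells f)" using bij_betw_finite[OF b] by simp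
  show "card (cells f) = area f" using bij_betw_same_card[OF b] area_eq[OF assms K] by simp
qed

text \<open>Means \<open>x \<le> y\<close> without two equal primed letters, see
  \<open>row_ok_iff\<close>. Comparing with the rank of the unprimed letter of the index of
  \<open>x\<close> reduces all consequences to linear arithmetic; \<open>col_ok\<close> compares
  dually with the primed letter of the index of \<open>y\<close>.\<close>

definition row_ok :: "letter \<Rightarrow> letter \<Rightarrow> bool" where
  "row_ok x y \<longleftrightarrow> 2 * letter_index x + 1 \<le> letter_rank y"

definition col_ok :: "letter \<Rightarrow> letter \<Rightarrow> bool" where
  "col_ok x y \<longleftrightarrow> letter_rank x \<le> 2 * letter_index y"

lemma letter_rank_bounds: "2 * letter_index x \<le> letter_rank x" "letter_rank x \<le> 2 * letter_index x + 1"
  by (cases x; simp)+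

text \<open>
  The cell in row \<open>i\<close> with content \<open>k\<close> is \<open>(i, i + k)\<close>; its neighbours are \<open>(i, i + Suc k)\<close> on the right and,
  with content \<open>k - 1\<close>, \<open>(Suc i, i + k)\<close> below.
\<close>

definition marked_tabs :: "nat \<Rightarrow> (nat \<Rightarrow> nat) \<Rightarrow> letter filling set" where
  "marked_tabs m f = {T \<in> extensional (cells f).
     (\<forall>i k. i < f k \<longrightarrow> 1 \<le> letter_index (T (i, i + k)) \<and> letter_index (T (i, i + k)) \<le> m) \<and>
     (\<forall>i k. i < f (Suc k) \<longrightarrow> row_ok (T (i, i + k)) (T (i, i + Suc k))) \<and>
     (\<forall>i k. Suc i < f k \<longrightarrow> col_ok (T (i, i + Suc k)) (T (Suc i, Suc i + k))) \<and>
     (\<forall>i l. i < f 0 \<longrightarrow> T (i, i + 0) \<noteq> Primed l)}"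

lemma marked_tabsD:
  assumes "T \<in> marked_tabs m f"
  shows "T \<in> extensional (cells f)"
    and "i < f k \<Longrightarrow> 1 \<le> letter_index (T (i, i + k))"
    and "i < f k \<Longrightarrow> letter_index (T (i, i + k)) \<le> m"
    and "i < f (Suc k) \<Longrightarrow> row_ok (T (i, i + k)) (T (i, i + Suc k))"
    and "Suc i < f k \<Longrightarrow> col_ok (T (i, i + Suc k)) (T (Suc i, Suc i + k))"
    and "i < f 0 \<Longrightarrow> T (i, i + 0) \<noteq> Primed l"
  using assms unfolding marked_tabs_def by blast+

lemma marked_tabs_row:
  assumes "T \<in> marked_tabs m f" "i < f (Suc k)"
  shows "letter_index (T (i, i + k)) \<le> letter_index (T (i, i + Suc k))"
  using marked_tabsD(4)[OF assms] letter_rank_bounds(2)[of "T (i, i + Suc k)"] unfolding row_ok_def by linarith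

lemma marked_tabs_col:
  assumes "T \<in> marked_tabs m f" "Suc i < f k"
  shows "letter_index (T (i, i + Suc k)) \<le> letter_index (T (Suc i, Suc i + k))"
  using marked_tabsD(5)[OF assms] letter_rank_bounds(1)[of "T (i, i + Suc k)"] unfolding col_ok_def by linarith

text \<open>One step to the right followed by one step down raises the index. So an index occurs at
  most once on each diagonal, and the cells of small index form an initial segment of it.\<close>

lemma marked_tabs_diagonal:
  assumes "shape f" "T \<in> marked_tabs m f" "Suc i < f k"
  shows "letter_index (T (i, i + k)) < letter_index (T (Suc i, Suc i + k))"
proof -
  have "i < f (Suc k)" using shape_step(2)[OF assms(1), of k] assms(3) by simp
  thus ?thesis
    using marked_tabsD(4)[OF assms(2), of i k] marked_tabsD(5)[OF assms(2,3)] unfolding row_ok_def col_ok_def by linarith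
qed

definition inner :: "nat \<Rightarrow> (nat \<Rightarrow> nat) \<Rightarrow> letter filling \<Rightarrow> nat \<Rightarrow> nat" where
  "inner m f T k = card {i. i < f k \<and> letter_index (T (i, i + k)) \<le> m}"

text \<open>Allows a diagonal length to be defined as a cardinality and then used as a bound for row
  numbers.\<close>

lemma down_closed_nat:
  fixes S :: "nat set"
  assumes "finite S" "\<And>i. Suc i \<in> S \<Longrightarrow> i \<in> S"
  shows "i \<in> S \<longleftrightarrow> i < card S"
proof -
  have down: "i \<in> S" if "j \<in> S" "i \<le> j" for i j
    using that(2,1) by (induction rule: inc_induct) (auto intro: assms(2))
  show ?thesis
  proof
    assume "i \<in> S"
    hence "{..i} \<subseteq> S" using down by auto
    hence "card {..i} \<le> card S" by (rule card_mono[OF assms(1)])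
    thus "i < card S" by simp
  next
    assume "i < card S"
    show "i \<in> S"
    proof (rule ccontr)
      assume "i \<notin> S"
      have "S \<subseteq> {..<i}"
      proof
        fix j assume "j \<in> S"
        thus "j \<in> {..<i}" using down[of j i] \<open>i \<notin> S\<close> by (cases "i \<le> j") auto
      qed
      hence "card S \<le> card {..<i}" by (rule card_mono[rotated]) simp
      thus False using \<open>i < card S\<close> by simp
    qed
  qed
qed

lemma inner_iff:
  assumes "shape f" "T \<in> marked_tabs n f"
  shows "i < inner m f T k \<longleftrightarrow> i < f k \<and> letter_index (T (i, i + k)) \<le> m"
proof -
  let ?S = "{i. i < f k \<and> letter_index (T (i, i + k)) \<le> m}"
  have "i \<in> ?S \<longleftrightarrow> i < card ?S"
  proof (rule down_closed_nat)
    fix i assume "Suc i \<in> ?S"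
    thus "i \<in> ?S" using marked_tabs_diagonal[OF assms, of i k] by auto
  qed simp
  thus ?thesis unfolding inner_def by blast
qed

lemma nat_leI: "(\<And>i. i < a \<Longrightarrow> i < b) \<Longrightarrow> a \<le> (b::nat)"
  using not_le_imp_less by blast

context
  fixes f :: "nat \<Rightarrow> nat" and T :: "letter filling" and m :: nat
  assumes f: "shape f" and T: "T \<in> marked_tabs (Suc m) f"
begin

lemma shape_inner: "shape (inner m f T)"
  unfolding shape_def
proof (intro conjI allI)
  fix k
  show "inner m f T (Suc k) \<le> inner m f T k"
  proof (rule nat_leI)
    fix i assume "i < inner m f T (Suc k)"
    hence "i < f (Suc k)" "letter_index (T (i, i + Suc k)) \<le> m"
      unfolding inner_iff[OF f T] by auto
    thus "i < inner m f T k"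
      unfolding inner_iff[OF f T] using marked_tabs_row[OF T, of i k] shape_step(1)[OF f, of k] by auto
  qed
  show "inner m f T k \<le> Suc (inner m f T (Suc k))"
  proof (rule nat_leI)
    fix i assume i: "i < inner m f T k"
    show "i < Suc (inner m f T (Suc k))"
    proof (cases i)
      case (Suc j)
      hence "Suc j < f k" "letter_index (T (Suc j, Suc j + k)) \<le> m"
        using i unfolding inner_iff[OF f T] by auto
      hence "j < inner m f T (Suc k)"
        unfolding inner_iff[OF f T] using marked_tabs_col[OF T, of j k] shape_step(2)[OF f, of k] by auto
      thus ?thesis using Suc by simp
    qed simp
  qed
  obtain K where "f K = 0" using f by (auto simp: shape_def)
  hence "inner m f T K = 0" by (simp add: inner_def)
  thus "\<exists>K. inner m f T K = 0" ..
qed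

lemma strip_inner: "strip (inner m f T) f"
  unfolding strip_def
proof (intro conjI allI)
  fix k
  show "inner m f T k \<le> f k"
    by (rule nat_leI) (simp add: inner_iff[OF f T])
  show "f k \<le> Suc (inner m f T k)"
  proof (rule nat_leI)
    fix i assume i: "i < f k"
    show "i < Suc (inner m f T k)"
    proof (cases i)
      case (Suc j)
      have "letter_index (T (j, j + k)) < letter_index (T (i, i + k))"
        using marked_tabs_diagonal[OF f T, of j k] i unfolding Suc by blast
      hence "letter_index (T (j, j + k)) \<le> m" using marked_tabsD(3)[OF T i] by simp
      hence "j < inner m f T k" unfolding inner_iff[OF f T] using i Suc by simp
      thus ?thesis using Suc by simp
    qed simp
  qed
qed

lemma box_index:
  assumes "i < f k" "\<not> i < inner m f T k"
  shows "letter_index (T (i, i + k)) = Suc m" "i = inner m f T k" "k \<in> boxes (inner m f T) f"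
proof -
  show "letter_index (T (i, i + k)) = Suc m"
    using assms marked_tabsD(3)[OF T assms(1)] unfolding inner_iff[OF f T] by auto
  show "i = inner m f T k"
    using assms strip_inner[unfolded strip_def, rule_format, of k] by simp
  thus "k \<in> boxes (inner m f T) f" using assms(1) by (simp add: boxes_def)
qed

definition outer_marks :: "nat set" where
  "outer_marks = {k \<in> boxes (inner m f T) f. T (inner m f T k, inner m f T k + k) = Primed (Suc m)}"

text \<open>Two neighbours of the top index in a row exclude a primed right one, and in a column an
  unprimed upper one; the rule for the main diagonal excludes content 0.\<close>

lemma outer_marks_in: "outer_marks \<in> {M \<in> marks (inner m f T) f. 0 \<notin> M}"
proof -
  let ?g = "inner m f T"
  have gf: "?g k < f k" if "k \<in> boxes ?g f" for k using that by (simp add: boxes_def)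
  have "0 \<notin> outer_marks"
  proof
    assume "0 \<in> outer_marks"
    hence "0 \<in> boxes ?g f" "T (?g 0, ?g 0 + 0) = Primed (Suc m)" unfolding outer_marks_def by auto
    thus False using marked_tabsD(6)[OF T gf] by blast
  qed
  moreover have "Suc k \<in> outer_marks \<longleftrightarrow> ?g k \<noteq> ?g (Suc k)" if k: "k \<in> boxes ?g f" "Suc k \<in> boxes ?g f" for k
  proof (cases "?g k = ?g (Suc k)")
    case True
    have "row_ok (T (?g k, ?g k + k)) (T (?g k, ?g k + Suc k))"
      by (rule marked_tabsD(4)[OF T]) (use gf[OF k(2)] True in simp)
    moreover have "letter_index (T (?g k, ?g k + k)) = Suc m"
      by (rule box_index(1)[OF gf[OF k(1)]]) simp
    ultimately have "T (?g k, ?g k + Suc k) \<noteq> Primed (Suc m)"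
      by (auto simp: row_ok_def)
    thus ?thesis unfolding outer_marks_def using True by simp
  next
    case False
    hence gS: "?g k = Suc (?g (Suc k))"
      using shape_step[OF shape_inner, of k] by linarith
    have "col_ok (T (?g (Suc k), ?g (Suc k) + Suc k)) (T (Suc (?g (Suc k)), Suc (?g (Suc k)) + k))"
      by (rule marked_tabsD(5)[OF T]) (use gf[OF k(1)] gS in simp)
    moreover have "letter_index (T (?g k, ?g k + k)) = Suc m"
      by (rule box_index(1)[OF gf[OF k(1)]]) simp
    moreover have "letter_index (T (?g (Suc k), ?g (Suc k) + Suc k)) = Suc m"
      by (rule box_index(1)[OF gf[OF k(2)]]) simp
    ultimately have "T (?g (Suc k), ?g (Suc k) + Suc k) = Primed (Suc m)"
      unfolding gS col_ok_def by (cases "T (?g (Suc k), ?g (Suc k) + Suc k)") auto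
    thus ?thesis unfolding outer_marks_def using False k by simp
  qed
  moreover have "outer_marks \<subseteq> boxes ?g f" unfolding outer_marks_def by blast
  ultimately show ?thesis unfolding marks_def by blast
qed

lemma restrict_inner: "restrict T (cells (inner m f T)) \<in> marked_tabs m (inner m f T)"
proof -
  let ?g = "inner m f T"
  let ?R = "restrict T (cells ?g)"
  have gf: "i < f k" if "i < ?g k" for i k using that unfolding inner_iff[OF f T] by blast
  have R: "?R (i, i + k) = T (i, i + k)" if "i < ?g k" for i k using that by (simp add: restrict_def)
  show ?thesis unfolding marked_tabs_def
  proof (intro CollectI conjI allI impI)
    fix i k assume i: "i < ?g k"
    show "1 \<le> letter_index (?R (i, i + k))" unfolding R[OF i] by (rule marked_tabsD(2)[OF T gf[OF i]])
    show "letter_index (?R (i, i + k)) \<le> m" unfolding R[OF i] using i unfolding inner_iff[OF f T] by blast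
  next
    fix i k assume i: "i < ?g (Suc k)"
    hence i': "i < ?g k" using shape_step(1)[OF shape_inner, of k] by simp
    show "row_ok (?R (i, i + k)) (?R (i, i + Suc k))"
      unfolding R[OF i] R[OF i'] by (rule marked_tabsD(4)[OF T gf[OF i]])
  next
    fix i k assume i: "Suc i < ?g k"
    hence i': "i < ?g (Suc k)" using shape_step(2)[OF shape_inner, of k] by simp
    show "col_ok (?R (i, i + Suc k)) (?R (Suc i, Suc i + k))"
      unfolding R[OF i] R[OF i'] by (rule marked_tabsD(5)[OF T gf[OF i]])
  next
    fix i l assume i: "i < ?g 0"
    show "?R (i, i + 0) \<noteq> Primed l" unfolding R[OF i] by (rule marked_tabsD(6)[OF T gf[OF i]])
  qed simp
qed

end

text \<open>Puts back what \<open>inner\<close>, \<open>outer_marks\<close> and restriction take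
  apart; the mark of a new cell is looked up under its content \<open>snd c - fst c\<close>.\<close>

definition glue :: "nat \<Rightarrow> (nat \<Rightarrow> nat) \<Rightarrow> (nat \<Rightarrow> nat) \<Rightarrow> nat set \<Rightarrow> letter filling \<Rightarrow> letter filling" where
  "glue m f g M R = (\<lambda>c\<in>cells f. if c \<in> cells g then R c
     else if snd c - fst c \<in> M then Primed m else Unprimed m)"

lemma glue_simps:
  assumes "i < f k"
  shows "i < g k \<Longrightarrow> glue m f g M R (i, i + k) = R (i, i + k)"
    and "\<not> i < g k \<Longrightarrow> glue m f g M R (i, i + k) = (if k \<in> M then Primed m else Unprimed m)"
  using assms by (simp_all add: glue_def)

context
  fixes f g :: "nat \<Rightarrow> nat" and M :: "nat set" and R :: "letter filling" and m :: nat
  assumes f: "shape f" and g: "shape g" and s: "strip g f" and M: "M \<in> {M \<in> marks g f. 0 \<notin> M}"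
    and R: "R \<in> marked_tabs m g"
begin

text \<open>Neighbours on different sides of the boundary of \<open>g\<close> are settled by their
  indices, at most \<open>m\<close> and equal to \<open>Suc m\<close>. Only neighbours that are both
  outside \<open>g\<close> depend on the marking conditions.\<close>

lemma glue_in: "glue (Suc m) f g M R \<in> marked_tabs (Suc m) f"
proof -
  let ?T = "glue (Suc m) f g M R"
  have gf: "g k \<le> f k" "f k \<le> Suc (g k)" for k using s by (auto simp: strip_def)
  have Mk: "Suc k \<in> M \<longleftrightarrow> g k \<noteq> g (Suc k)" if "g k < f k" "g (Suc k) < f (Suc k)" for k
    using M that by (auto simp: marks_def boxes_def)
  note in_g = glue_simps(1)[where m="Suc m" and M=M and R=R]
  note out_g = glue_simps(2)[where m="Suc m" and M=M and R=R and f=f and g=g]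
  have idx: "letter_index (?T (i, i + k)) = Suc m" if "i < f k" "\<not> i < g k" for i k
    unfolding out_g[OF that] by simp
  show ?thesis unfolding marked_tabs_def
  proof (intro CollectI conjI allI impI)
    show "?T \<in> extensional (cells f)" by (simp add: glue_def)
  next
    fix i k assume i: "i < f k"
    have "1 \<le> letter_index (?T (i, i + k)) \<and> letter_index (?T (i, i + k)) \<le> Suc m"
    proof (cases "i < g k")
      case True
      show ?thesis unfolding in_g[of i f k g, OF i True] using marked_tabsD(2,3)[OF R True] by simp
    qed (simp add: idx[OF i])
    thus "1 \<le> letter_index (?T (i, i + k))" "letter_index (?T (i, i + k)) \<le> Suc m" by auto
  next
    fix i k assume i: "i < f (Suc k)"
    hence i': "i < f k" using shape_step(1)[OF f, of k] by simp
    show "row_ok (?T (i, i + k)) (?T (i, i + Suc k))"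
    proof (cases "i < g (Suc k)")
      case True
      hence "i < g k" using shape_step(1)[OF g, of k] by simp
      show ?thesis unfolding in_g[of i f k g, OF i' \<open>i < g k\<close>] in_g[of i f "Suc k" g, OF i True]
        by (rule marked_tabsD(4)[OF R True])
    next
      case False
      show ?thesis
      proof (cases "i < g k")
        case True
        have "letter_index (?T (i, i + k)) \<le> m"
          unfolding in_g[of i f k g, OF i' True] by (rule marked_tabsD(3)[OF R True])
        moreover have "letter_index (?T (i, i + Suc k)) = Suc m" by (rule idx[OF i False])
        ultimately show ?thesis
          using letter_rank_bounds(1)[of "?T (i, i + Suc k)"] unfolding row_ok_def by linarith
      next
        case gk: False
        have "i = g (Suc k)" "i = g k" using False gk i i' gf(2)[of k] gf(2)[of "Suc k"] by auto
        hence "Suc k \<notin> M" using Mk[of k] i i' by auto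
        thus ?thesis unfolding row_ok_def idx[OF i' gk] out_g[OF i False] by simp
      qed
    qed
  next
    fix i k assume i: "Suc i < f k"
    hence i': "i < f (Suc k)" using shape_step(2)[OF f, of k] by simp
    show "col_ok (?T (i, i + Suc k)) (?T (Suc i, Suc i + k))"
    proof (cases "Suc i < g k")
      case True
      hence "i < g (Suc k)" using shape_step(2)[OF g, of k] by simp
      show ?thesis unfolding in_g[of "Suc i" f k g, OF i True] in_g[of i f "Suc k" g, OF i' \<open>i < g (Suc k)\<close>]
        by (rule marked_tabsD(5)[OF R True])
    next
      case False
      show ?thesis
      proof (cases "i < g (Suc k)")
        case True
        have "letter_index (?T (i, i + Suc k)) \<le> m"
          unfolding in_g[of i f "Suc k" g, OF i' True] by (rule marked_tabsD(3)[OF R True])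
        moreover have "letter_index (?T (Suc i, Suc i + k)) = Suc m" by (rule idx[OF i False])
        ultimately show ?thesis
          using letter_rank_bounds(2)[of "?T (i, i + Suc k)"] unfolding col_ok_def by linarith
      next
        case gk: False
        have "Suc i = g k" "i = g (Suc k)" using False gk i i' gf(2)[of k] gf(2)[of "Suc k"] by auto
        hence "Suc k \<in> M" using Mk[of k] i i' by auto
        thus ?thesis unfolding col_ok_def idx[OF i False] out_g[OF i' gk] by simp
      qed
    qed
  next
    fix i l assume i: "i < f 0"
    show "?T (i, i + 0) \<noteq> Primed l"
    proof (cases "i < g 0")
      case True
      show ?thesis unfolding in_g[of i f 0 g, OF i True] by (rule marked_tabsD(6)[OF R True])
    next
      case False
      have "0 \<notin> M" using M by blast
      thus ?thesis unfolding out_g[OF i False] by simp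
    qed
  qed
qed

lemma inner_glue: "inner m f (glue (Suc m) f g M R) = g"
proof
  fix k
  let ?T = "glue (Suc m) f g M R"
  have "i < inner m f ?T k \<longleftrightarrow> i < g k" for i
  proof (cases "i < g k")
    case True
    hence i: "i < f k" using s[unfolded strip_def, rule_format, of k] by simp
    show ?thesis unfolding inner_iff[OF f glue_in] glue_simps(1)[of i f k g, OF i True]
      using i True marked_tabsD(3)[OF R True] by simp
  next
    case False
    have "letter_index (?T (i, i + k)) = Suc m" if "i < f k"
      unfolding glue_simps(2)[of i f k g, OF that False] by simp
    thus ?thesis unfolding inner_iff[OF f glue_in] using False by auto
  qed
  thus "inner m f ?T k = g k" by (meson less_irrefl linorder_neqE_nat)
qed

lemma marks_glue: "outer_marks f (glue (Suc m) f g M R) m = M"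
proof -
  have MX: "M \<subseteq> boxes g f" using M by (auto simp: marks_def)
  have "glue (Suc m) f g M R (g k, g k + k) = Primed (Suc m) \<longleftrightarrow> k \<in> M" if "k \<in> boxes g f" for k
  proof -
    have gk: "g k < f k" "\<not> g k < g k" using that by (auto simp: boxes_def)
    show ?thesis unfolding glue_simps(2)[of "g k" f k g, OF gk] by simp
  qed
  thus ?thesis unfolding outer_marks_def[OF f glue_in] inner_glue using MX by blast
qed

lemma restrict_glue: "restrict (glue (Suc m) f g M R) (cells g) = R"
proof
  fix c
  show "restrict (glue (Suc m) f g M R) (cells g) c = R c"
  proof (cases "c \<in> cells g")
    case True
    then obtain i k where c: "c = (i, i + k)" and i: "i < g k" by (rule cellsE)
    hence "i < f k" using s[unfolded strip_def, rule_format, of k] by simp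
    thus ?thesis using True glue_simps(1)[of i f k g, OF \<open>i < f k\<close> i] by (simp add: c)
  next
    case False
    thus ?thesis using extensional_arb[OF marked_tabsD(1)[OF R] False] by simp
  qed
qed

lemma cells_subset: "cells g \<subseteq> cells f"
proof
  fix c assume "c \<in> cells g"
  then obtain i k where c: "c = (i, i + k)" and i: "i < g k" by (rule cellsE)
  thus "c \<in> cells f" using s[unfolded strip_def, rule_format, of k] by simp
qed

lemma prod_glue:
  fixes x :: "nat \<Rightarrow> 'r::comm_ring_1"
  shows "(\<Prod>c\<in>cells f. x (letter_index (glue (Suc m) f g M R c))) =
    x (Suc m) ^ (area f - area g) * (\<Prod>c\<in>cells g. x (letter_index (R c)))"
proof -
  let ?T = "glue (Suc m) f g M R"
  have "(\<Prod>c\<in>cells f. x (letter_index (?T c)))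
      = (\<Prod>c\<in>cells f - cells g. x (letter_index (?T c))) * (\<Prod>c\<in>cells g. x (letter_index (?T c)))"
    by (rule prod.subset_diff[OF cells_subset finite_cells[OF f]])
  also have "(\<Prod>c\<in>cells f - cells g. x (letter_index (?T c))) = (\<Prod>c\<in>cells f - cells g. x (Suc m))"
    by (rule prod.cong) (auto simp: glue_def)
  also have "\<dots> = x (Suc m) ^ (area f - area g)"
    by (simp add: card_Diff_subset[OF finite_cells[OF g] cells_subset] card_cells[OF f] card_cells[OF g])
  also have "(\<Prod>c\<in>cells g. x (letter_index (?T c))) = (\<Prod>c\<in>cells g. x (letter_index (R c)))"
    by (rule prod.cong) (use cells_subset in \<open>auto simp: glue_def\<close>)
  finally show ?thesis .
qed

end

lemma glue_inner:
  assumes f: "shape f" and T: "T \<in> marked_tabs (Suc m) f"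
  shows "glue (Suc m) f (inner m f T) (outer_marks f T m) (restrict T (cells (inner m f T))) = T"
    (is "?G = T")
proof
  fix c
  show "?G c = T c"
  proof (cases "c \<in> cells f")
    case True
    then obtain i k where c: "c = (i, i + k)" and i: "i < f k" by (rule cellsE)
    show ?thesis
    proof (cases "i < inner m f T k")
      case True
      thus ?thesis unfolding c glue_simps(1)[of i f k "inner m f T", OF i True] by simp
    next
      case False
      note b = box_index[OF f T i False]
      have "T (i, i + k) = (if k \<in> outer_marks f T m then Primed (Suc m) else Unprimed (Suc m))"
        using b(1,3) unfolding outer_marks_def[OF f T] mem_Collect_eq b(2)[symmetric]
        by (cases "T (i, i + k)") auto
      thus ?thesis unfolding c glue_simps(2)[of i f k "inner m f T", OF i False] by simp
    qed
  next
    case False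
    thus ?thesis using extensional_arb[OF marked_tabsD(1)[OF T] False] by (simp add: glue_def)
  qed
qed

lemma finite_marked_tabs:
  assumes "shape f"
  shows "finite (marked_tabs m f)"
proof (rule finite_subset)
  let ?L = "Primed ` {..m} \<union> Unprimed ` {..m}"
  show "finite (cells f \<rightarrow>\<^sub>E ?L)" by (intro finite_PiE finite_cells[OF assms]) auto
  show "marked_tabs m f \<subseteq> cells f \<rightarrow>\<^sub>E ?L"
  proof
    fix T assume T: "T \<in> marked_tabs m f"
    have "T c \<in> ?L" if c_in: "c \<in> cells f" for c
    proof -
      obtain i k where c: "c = (i, i + k)" and i: "i < f k" using c_in by (rule cellsE)
      show ?thesis unfolding c using marked_tabsD(3)[OF T i] by (cases "T (i, i + k)") auto
    qed
    thus "T \<in> cells f \<rightarrow>\<^sub>E ?L" using marked_tabsD(1)[OF T] by (auto simp: PiE_def)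
  qed
qed

lemma finite_marks: "shape g \<Longrightarrow> finite (marks f g)"
  by (rule finite_subset[of _ "Pow (boxes f g)"]) (auto simp: marks_def finite_boxes)

text \<open>Deleting the cells of the largest index leaves a tableau with fewer letters and a marked
  strip. The markings of the strip that avoid content 0 are counted by \<open>P_weight\<close>,
  which is the branching rule of \<open>P_poly\<close>.\<close>

theorem sum_marked_tabs:
  fixes x :: "nat \<Rightarrow> 'r::comm_ring_1"
  assumes "shape f"
  shows "(\<Sum>T\<in>marked_tabs m f. \<Prod>c\<in>cells f. x (letter_index (T c))) = P_poly x m f"
  using assms
proof (induction m arbitrary: f)
  case 0
  note f = 0
  show ?case
  proof (cases "f = (\<lambda>_. 0)")
    case True
    have "marked_tabs 0 f = {\<lambda>_. undefined}" and "cells f = {}"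
      unfolding True by (auto simp: marked_tabs_def cells_def)
    thus ?thesis using True by simp
  next
    case False
    then obtain k where "f k \<noteq> 0" by auto
    hence k: "0 < f k" by simp
    have "marked_tabs 0 f = {}"
    proof (rule equals0I)
      fix T assume "T \<in> marked_tabs 0 f"
      thus False using marked_tabsD(2)[of T 0 f 0 k] marked_tabsD(3)[of T 0 f 0 k] k by simp
    qed
    thus ?thesis using False by simp
  qed
next
  case (Suc m)
  note f = Suc.prems
  let ?w = "\<lambda>g T. \<Prod>c\<in>cells g. x (letter_index (T c))"
  let ?G = "{g. shape g \<and> strip g f}"
  let ?P = "SIGMA g:?G. {M \<in> marks g f. 0 \<notin> M} \<times> marked_tabs m g"
  have G: "?G \<subseteq> {g. shape g \<and> area g \<le> area f}" using strip_area_le[OF _ f] by blast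
  have finG: "finite ?G" by (rule finite_subset[OF G finite_shapes])
  have finM: "finite {M \<in> marks g f. 0 \<notin> M}" for g
    using finite_marks[OF f, of g] by simp
  have "(\<Sum>T\<in>marked_tabs (Suc m) f. ?w f T)
      = (\<Sum>(g, M, R)\<in>?P. x (Suc m) ^ (area f - area g) * ?w g R)"
  proof (rule sum.reindex_bij_witness[where i="\<lambda>(g, M, R). glue (Suc m) f g M R"
        and j="\<lambda>T. (inner m f T, outer_marks f T m, restrict T (cells (inner m f T)))"])
    fix T assume T: "T \<in> marked_tabs (Suc m) f"
    let ?g = "inner m f T"
    show "(case (?g, outer_marks f T m, restrict T (cells ?g)) of (g, M, R) \<Rightarrow> glue (Suc m) f g M R) = T"
      using glue_inner[OF f T] by simp
    show "(?g, outer_marks f T m, restrict T (cells ?g)) \<in> ?P"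
      using shape_inner[OF f T] strip_inner[OF f T] outer_marks_in[OF f T] restrict_inner[OF f T] by blast
    show "(case (?g, outer_marks f T m, restrict T (cells ?g)) of (g, M, R) \<Rightarrow> x (Suc m) ^ (area f - area g) * ?w g R) = ?w f T"
      using prod_glue[OF f shape_inner[OF f T] strip_inner[OF f T] outer_marks_in[OF f T] restrict_inner[OF f T], of x]
      unfolding glue_inner[OF f T] prod.case by (rule sym)
  next
    fix p assume "p \<in> ?P"
    then obtain g M R where p: "p = (g, M, R)" and g: "shape g" "strip g f" "M \<in> {M \<in> marks g f. 0 \<notin> M}" "R \<in> marked_tabs m g"
      by blast
    show "(inner m f (case p of (g, M, R) \<Rightarrow> glue (Suc m) f g M R),
        outer_marks f (case p of (g, M, R) \<Rightarrow> glue (Suc m) f g M R) m,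
        restrict (case p of (g, M, R) \<Rightarrow> glue (Suc m) f g M R)
          (cells (inner m f (case p of (g, M, R) \<Rightarrow> glue (Suc m) f g M R)))) = p"
      unfolding p prod.case inner_glue[OF f g] marks_glue[OF f g] restrict_glue[OF f g] ..
    show "(case p of (g, M, R) \<Rightarrow> glue (Suc m) f g M R) \<in> marked_tabs (Suc m) f"
      unfolding p prod.case by (rule glue_in[OF f g])
  qed
  also have "\<dots> = (\<Sum>g\<in>?G. \<Sum>(M, R)\<in>{M \<in> marks g f. 0 \<notin> M} \<times> marked_tabs m g. x (Suc m) ^ (area f - area g) * ?w g R)"
    by (subst sum.Sigma) (use finG finM finite_marked_tabs in \<open>auto simp: split_def\<close>)
  also have "\<dots> = (\<Sum>g\<in>?G. \<Sum>M | M \<in> marks g f \<and> 0 \<notin> M. \<Sum>R\<in>marked_tabs m g. x (Suc m) ^ (area f - area g) * ?w g R)"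
    by (simp only: sum.cartesian_product)
  also have "\<dots> = (\<Sum>g\<in>?G. of_int (P_weight g f) * x (Suc m) ^ (area f - area g) * P_poly x m g)"
  proof (rule sum.cong[OF refl])
    fix g assume g: "g \<in> ?G"
    have "(\<Sum>M | M \<in> marks g f \<and> 0 \<notin> M. \<Sum>R\<in>marked_tabs m g. x (Suc m) ^ (area f - area g) * ?w g R)
        = (\<Sum>M | M \<in> marks g f \<and> 0 \<notin> M. x (Suc m) ^ (area f - area g) * P_poly x m g)"
      using Suc.IH[of g] g by (simp add: sum_distrib_left[symmetric])
    also have "\<dots> = of_nat (card {M \<in> marks g f. 0 \<notin> M}) * (x (Suc m) ^ (area f - area g) * P_poly x m g)"
      by (rule sum_constant)
    also have "of_nat (card {M \<in> marks g f. 0 \<notin> M}) = (of_int (P_weight g f) :: 'r)"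
      using card_marks(2)[OF f, of g] g by (metis mem_Collect_eq of_int_of_nat_eq)
    finally show "(\<Sum>M | M \<in> marks g f \<and> 0 \<notin> M. \<Sum>R\<in>marked_tabs m g. x (Suc m) ^ (area f - area g) * ?w g R)
        = of_int (P_weight g f) * x (Suc m) ^ (area f - area g) * P_poly x m g" by (simp only: mult.assoc)
  qed
  also have "\<dots> = P_poly x (Suc m) f" unfolding P_poly.simps
    by (rule sum.mono_neutral_left[OF finite_shapes G]) (auto simp: P_weight_eq_0)
  finally show ?case .
qed


section \<open>Strict partitions and their diagonal lengths\<close>

definition diag_lengths :: "nat list \<Rightarrow> nat \<Rightarrow> nat" where
  "diag_lengths lam k = card {i. i < length lam \<and> k < lam ! i}"

lemma diag_lengths_iff:
  assumes "strict_partition lam"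
  shows "i < diag_lengths lam k \<longleftrightarrow> i < length lam \<and> k < lam ! i"
proof -
  let ?S = "{i. i < length lam \<and> k < lam ! i}"
  have "i \<in> ?S \<longleftrightarrow> i < card ?S"
  proof (rule down_closed_nat)
    fix i assume i: "Suc i \<in> ?S"
    hence "lam ! Suc i < lam ! i"
      using assms by (auto simp: strict_partition_def sorted_wrt_iff_nth_less)
    thus "i \<in> ?S" using i by auto
  qed simp
  thus ?thesis unfolding diag_lengths_def by blast
qed

lemma shape_diag_lengths:
  assumes "strict_partition lam"
  shows "shape (diag_lengths lam)"
  unfolding shape_def
proof (intro conjI allI)
  fix k
  show "diag_lengths lam (Suc k) \<le> diag_lengths lam k" by (rule nat_leI) (simp add: diag_lengths_iff[OF assms])
  show "diag_lengths lam k \<le> Suc (diag_lengths lam (Suc k))"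
  proof (rule nat_leI)
    fix i assume i: "i < diag_lengths lam k"
    show "i < Suc (diag_lengths lam (Suc k))"
    proof (cases i)
      case (Suc j)
      have "Suc j < length lam" "k < lam ! Suc j" using i unfolding diag_lengths_iff[OF assms] Suc by auto
      moreover from this have "lam ! Suc j < lam ! j"
        using assms by (auto simp: strict_partition_def sorted_wrt_iff_nth_less)
      ultimately have "j < diag_lengths lam (Suc k)" unfolding diag_lengths_iff[OF assms] by simp
      thus ?thesis using Suc by simp
    qed simp
  qed
  have "lam ! i \<le> sum_list lam" if "i < length lam" for i
    using that by (rule elem_le_sum_list)
  hence "{i. i < length lam \<and> sum_list lam < lam ! i} = {}" using leD by blast
  hence "diag_lengths lam (sum_list lam) = 0" unfolding diag_lengths_def by (simp only: card.empty)
  thus "\<exists>K. diag_lengths lam K = 0" ..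
qed

lemma cells_diag_lengths:
  assumes "strict_partition lam"
  shows "cells (diag_lengths lam) = shifted_diagram lam"
  by (auto simp: cells_def shifted_diagram_def diag_lengths_iff[OF assms])

lemma area_diag_lengths:
  assumes "strict_partition lam"
  shows "area (diag_lengths lam) = sum_list lam"
proof -
  have "shifted_diagram lam = (SIGMA i:{..<length lam}. {i..<i + lam ! i})"
    by (auto simp: shifted_diagram_def)
  hence "card (shifted_diagram lam) = (\<Sum>i<length lam. lam ! i)" by simp
  thus ?thesis using card_cells[OF shape_diag_lengths[OF assms]] cells_diag_lengths[OF assms]
    by (simp add: sum_list_sum_nth atLeast0LessThan)
qed

section \<open>Neighbour conditions against conditions on whole rows and columns\<close>

lemma row_ok_iff: "row_ok x y \<longleftrightarrow> x \<le> y \<and> \<not> (\<exists>l. x = Primed l \<and> y = Primed l)"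
  by (cases x; cases y) (auto simp: row_ok_def less_eq_letter_def)

lemma col_ok_iff: "col_ok x y \<longleftrightarrow> x \<le> y \<and> \<not> (\<exists>l. x = Unprimed l \<and> y = Unprimed l)"
  by (cases x; cases y) (auto simp: col_ok_def less_eq_letter_def)

lemma row_ok_trans: "row_ok x y \<Longrightarrow> row_ok y z \<Longrightarrow> row_ok x z"
  using letter_rank_bounds(2)[of y] unfolding row_ok_def by linarith

lemma col_ok_trans: "col_ok x y \<Longrightarrow> col_ok y z \<Longrightarrow> col_ok x z"
  using letter_rank_bounds(1)[of y] unfolding col_ok_def by linarith

lemma marked_tabs_tabs_row_ok:
  assumes f: "shape f" and T: "T \<in> marked_tabs m f" and "k < l" "i < f l"
  shows "row_ok (T (i, i + k)) (T (i, i + l))"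
proof -
  have "Suc k \<le> l" using assms(3) by simp
  thus ?thesis using assms(4)
  proof (induction rule: dec_induct)
    case base
    thus ?case by (rule marked_tabsD(4)[OF T])
  next
    case (step l)
    have "i < f l" using step.prems shape_step(1)[OF f, of l] by simp
    thus ?case using row_ok_trans[OF step.IH marked_tabsD(4)[OF T step.prems]] by simp
  qed
qed

text \<open>Going down a column lowers the content by one in each row. The induction on the distance
  therefore changes \<open>k\<close> while the column stays fixed.\<close>

lemma marked_tabs_tabs_col_ok:
  assumes f: "shape f" and T: "T \<in> marked_tabs m f" and "i + Suc d < f k"
  shows "col_ok (T (i, i + Suc d + k)) (T (i + Suc d, i + Suc d + k))"
  using assms(3)
proof (induction d arbitrary: k)
  case 0
  thus ?case using marked_tabsD(5)[OF T, of i k] by simp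
next
  case (Suc d)
  have "i + Suc d < f (Suc k)" using Suc.prems shape_step(2)[OF f, of k] by simp
  from col_ok_trans[OF Suc.IH[OF this]] marked_tabsD(5)[OF T, of "i + Suc d" k] Suc.prems
  show ?case by simp
qed

lemma ShSSYT_marked_tabs:
  assumes "strict_partition lam"
  shows "{T \<in> ShSSYT lam. \<forall>c\<in>shifted_diagram lam. letter_index (T c) \<le> m} = marked_tabs m (diag_lengths lam)"
proof (intro set_eqI iffI)
  let ?f = "diag_lengths lam"
  note f = shape_diag_lengths[OF assms]
  have D: "shifted_diagram lam = cells ?f" by (rule cells_diag_lengths[OF assms, symmetric])
  {
    fix T assume T: "T \<in> {T \<in> ShSSYT lam. \<forall>c\<in>shifted_diagram lam. letter_index (T c) \<le> m}"
    have ext: "T \<in> extensional (cells ?f)" and ge: "\<And>c. c \<in> cells ?f \<Longrightarrow> 1 \<le> letter_index (T c)"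
      and le: "\<And>c. c \<in> cells ?f \<Longrightarrow> letter_index (T c) \<le> m"
      and row: "\<And>i j j'. (i, j) \<in> cells ?f \<Longrightarrow> (i, j') \<in> cells ?f \<Longrightarrow> j < j' \<Longrightarrow> T (i, j) \<le> T (i, j')"
      and col: "\<And>i i' j. (i, j) \<in> cells ?f \<Longrightarrow> (i', j) \<in> cells ?f \<Longrightarrow> i < i' \<Longrightarrow> T (i, j) \<le> T (i', j)"
      and un: "\<And>k i i' j. (i, j) \<in> cells ?f \<Longrightarrow> (i', j) \<in> cells ?f \<Longrightarrow> T (i, j) = Unprimed k \<Longrightarrow> T (i', j) = Unprimed k \<Longrightarrow> i = i'"
      and pr: "\<And>k i j j'. (i, j) \<in> cells ?f \<Longrightarrow> (i, j') \<in> cells ?f \<Longrightarrow> T (i, j) = Primed k \<Longrightarrow> T (i, j') = Primed k \<Longrightarrow> j = j'"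
      and dg: "\<And>k i. (i, i) \<in> cells ?f \<Longrightarrow> T (i, i) \<noteq> Primed k"
      using T unfolding ShSSYT_def Let_def D PiE_def by blast+
    show "T \<in> marked_tabs m ?f" unfolding marked_tabs_def
    proof (intro CollectI conjI allI impI ext)
      fix i k assume "i < ?f k"
      hence "(i, i + k) \<in> cells ?f" by simp
      thus "1 \<le> letter_index (T (i, i + k))" "letter_index (T (i, i + k)) \<le> m" by (rule ge, rule le)
    next
      fix i k assume i: "i < ?f (Suc k)"
      hence c: "(i, i + Suc k) \<in> cells ?f" "(i, i + k) \<in> cells ?f"
        using shape_step(1)[OF f, of k] unfolding cells_iff by linarith+
      show "row_ok (T (i, i + k)) (T (i, i + Suc k))" unfolding row_ok_iff
        using row[OF c(2,1)] pr[OF c(2,1)] by force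
    next
      fix i k assume i: "Suc i < ?f k"
      hence "i < ?f (Suc k)" using shape_step(2)[OF f, of k] by simp
      hence c: "(i, i + Suc k) \<in> cells ?f" "(Suc i, i + Suc k) \<in> cells ?f"
        using i cells_iff[of i "Suc k" ?f] cells_iff[of "Suc i" k ?f] by simp_all
      show "col_ok (T (i, i + Suc k)) (T (Suc i, Suc i + k))" unfolding col_ok_iff
        using col[OF c] un[OF c] by auto
    next
      fix i l assume "i < ?f 0"
      hence "(i, i) \<in> cells ?f" using cells_iff[of i 0 ?f] by simp
      thus "T (i, i + 0) \<noteq> Primed l" using dg by simp
    qed
  }
  {
    fix T assume T: "T \<in> marked_tabs m ?f"
    have R: "row_ok (T (i, j)) (T (i, j'))" if "(i, j) \<in> cells ?f" "(i, j') \<in> cells ?f" "j < j'" for i j j'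
    proof -
      have "i \<le> j" "i \<le> j'" "i < ?f (j' - i)" using that by (auto simp: cells_def)
      thus ?thesis using marked_tabs_tabs_row_ok[OF f T, of "j - i" "j' - i" i] that(3) by simp
    qed
    have C: "col_ok (T (i, j)) (T (i', j))" if "(i, j) \<in> cells ?f" "(i', j) \<in> cells ?f" "i < i'" for i i' j
    proof -
      have "i' \<le> j" "i' < ?f (j - i')" using that by (auto simp: cells_def)
      thus ?thesis using marked_tabs_tabs_col_ok[OF f T, of i "i' - Suc i" "j - i'"] that(3) by simp
    qed
    have B: "1 \<le> letter_index (T c) \<and> letter_index (T c) \<le> m" if "c \<in> cells ?f" for c
      using that marked_tabsD(2,3)[OF T] by (auto elim!: cellsE)
    have dg: "T (i, i) \<noteq> Primed k" if "(i, i) \<in> cells ?f" for i k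
      using that marked_tabsD(6)[OF T, of i k] cells_iff[of i 0 ?f] by simp
    show "T \<in> {T \<in> ShSSYT lam. \<forall>c\<in>shifted_diagram lam. letter_index (T c) \<le> m}"
      unfolding ShSSYT_def Let_def D
    proof (intro CollectI conjI allI impI ballI)
      show "T \<in> cells ?f \<rightarrow>\<^sub>E {x. 1 \<le> letter_index x}"
        using B marked_tabsD(1)[OF T] by (auto simp: PiE_def)
    next
      fix i j j' assume "(i, j) \<in> cells ?f \<and> (i, j') \<in> cells ?f \<and> j < j'"
      thus "T (i, j) \<le> T (i, j')" using R row_ok_iff by blast
    next
      fix i i' j assume "(i, j) \<in> cells ?f \<and> (i', j) \<in> cells ?f \<and> i < i'"
      thus "T (i, j) \<le> T (i', j)" using C col_ok_iff by blast
    next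
      fix k i i' j assume a: "(i, j) \<in> cells ?f \<and> (i', j) \<in> cells ?f \<and> T (i, j) = Unprimed k \<and> T (i', j) = Unprimed k"
      show "i = i'"
        using a C[of i j i'] C[of i' j i] unfolding col_ok_iff by (metis linorder_neqE_nat)
    next
      fix k i j j' assume a: "(i, j) \<in> cells ?f \<and> (i, j') \<in> cells ?f \<and> T (i, j) = Primed k \<and> T (i, j') = Primed k"
      show "j = j'"
        using a R[of i j j'] R[of i j' j] unfolding row_ok_iff by (metis linorder_neqE_nat)
    next
      fix k i assume "(i, i) \<in> cells ?f"
      thus "T (i, i) \<noteq> Primed k" by (rule dg)
    next
      fix c assume "c \<in> cells ?f"
      thus "letter_index (T c) \<le> m" using B by blast
    qed
  }
qed

section \<open>Alternating standard tableaux as zigzag words of contents\<close>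

text \<open>Row \<open>i\<close> meets exactly the diagonals that are longer than \<open>i\<close>,
  so their number is its length.\<close>

definition partition_of :: "(nat \<Rightarrow> nat) \<Rightarrow> nat list" where
  "partition_of f = map (\<lambda>i. card {k. i < f k}) [0..<f 0]"

lemma partition_of_less:
  assumes f: "shape f"
  shows "k < card {k. i < f k} \<longleftrightarrow> i < f k"
proof -
  have "k \<in> {k. i < f k} \<longleftrightarrow> k < card {k. i < f k}"
  proof (rule down_closed_nat)
    obtain K where K: "f K = 0" using f by (auto simp: shape_def)
    have "{k. i < f k} \<subseteq> {..<K}"
    proof
      fix k assume "k \<in> {k. i < f k}"
      thus "k \<in> {..<K}" using shape_zero[OF f K, of k] by (cases "K \<le> k") auto
    qed
    thus "finite {k. i < f k}" by (rule finite_subset) simp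
    fix k assume "Suc k \<in> {k. i < f k}"
    thus "k \<in> {k. i < f k}" using shape_step(1)[OF f, of k] by simp
  qed
  thus ?thesis by simp
qed

text \<open>Diagonal lengths drop by at most one: the last cell of row \<open>j\<close> has content
  \<open>?l j - 1\<close>, so the next diagonal still reaches every row above row
  \<open>j\<close>.\<close>

lemma strict_partition_of:
  assumes f: "shape f"
  shows "strict_partition (partition_of f)"
proof -
  let ?l = "\<lambda>i. card {k. i < f k}"
  have "?l j < ?l i" if "i < j" "j < f 0" for i j
  proof -
    have pos: "0 < ?l j" using partition_of_less[OF f, of 0 j] that(2) by simp
    hence "j < f (?l j - 1)" using partition_of_less[OF f, of "?l j - 1" j] by simp
    moreover have "f (?l j - 1) \<le> Suc (f (?l j))" using shape_step(2)[OF f, of "?l j - 1"] pos by simp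
    ultimately have "i < f (?l j)" using that(1) by simp
    thus ?thesis using partition_of_less[OF f, of "?l j" i] by simp
  qed
  moreover have "0 < ?l i" if "i < f 0" for i
    using partition_of_less[OF f, of 0 i] that by simp
  hence "0 \<notin> set (partition_of f)" unfolding partition_of_def by fastforce
  ultimately show ?thesis
    by (auto simp: strict_partition_def partition_of_def sorted_wrt_iff_nth_less)
qed

lemma diag_lengths_partition_of:
  assumes f: "shape f"
  shows "diag_lengths (partition_of f) = f"
proof
  fix k
  have "i < diag_lengths (partition_of f) k \<longleftrightarrow> i < f k" for i
    unfolding diag_lengths_iff[OF strict_partition_of[OF f]]
    using shape_antimono[OF f, of 0 k] by (auto simp: partition_of_def partition_of_less[OF f])
  thus "diag_lengths (partition_of f) k = f k" by (meson less_irrefl linorder_neqE_nat)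
qed

lemma diag_lengths_inject:
  assumes l: "strict_partition l" and l': "strict_partition l'" and eq: "diag_lengths l = diag_lengths l'"
  shows "l = l'"
proof (rule nth_equalityI)
  have pos: "i < diag_lengths l 0 \<longleftrightarrow> i < length l" if "strict_partition l" for i l
    unfolding diag_lengths_iff[OF that] using that by (auto simp: strict_partition_def in_set_conv_nth)
  have "i < length l \<longleftrightarrow> i < length l'" for i using pos[OF l, of i] pos[OF l', of i] eq by simp
  thus len: "length l = length l'" by (meson less_irrefl linorder_neqE_nat)
  fix i assume i: "i < length l"
  have "k < l ! i \<longleftrightarrow> k < l' ! i" for k
    using diag_lengths_iff[OF l, of i k] diag_lengths_iff[OF l', of i k] eq i len by simp
  thus "l ! i = l' ! i" by (meson less_irrefl linorder_neqE_nat)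
qed

lemma partition_of_diag_lengths: "strict_partition l \<Longrightarrow> partition_of (diag_lengths l) = l"
  by (rule diag_lengths_inject[OF strict_partition_of[OF shape_diag_lengths]]) (simp_all add: diag_lengths_partition_of shape_diag_lengths)

section \<open>The standard filling of a chain\<close>

definition cell_at :: "nat list \<Rightarrow> nat \<Rightarrow> cell" where
  "cell_at c p = (fill0 (take p c) (c ! p), fill0 (take p c) (c ! p) + c ! p)"

text \<open>Positions in a word start at 0 and entries of a tableau at 1, hence the
  \<open>Suc\<close>.\<close>

definition tableau_of :: "nat list \<Rightarrow> nat filling" where
  "tableau_of c = (\<lambda>x\<in>cells (fill0 c). Suc (inv_into {..<length c} (cell_at c) x))"

lemma fill0_take_Suc: "p < length c \<Longrightarrow> fill0 (take (Suc p) c) k = fill0 (take p c) k + of_bool (c ! p = k)"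
  by (simp add: fill_def take_Suc_conv_app_nth)

lemma fill0_take_mono: "p \<le> q \<Longrightarrow> fill0 (take p c) k \<le> fill0 (take q c) k"
proof -
  assume "p \<le> q"
  hence "take q c = take p c @ take (q - p) (drop p c)" by (metis le_add_diff_inverse take_add)
  thus ?thesis by (simp add: fill_def)
qed

lemma fill0_take_le: "fill0 (take p c) k \<le> fill0 c k"
  using fill0_take_mono[of p "max p (length c)" c k] by simp

context
  fixes c :: "nat list"
  assumes c: "chain0 c"
begin

lemma shape_prefix: "shape (fill0 (take p c))"
proof (rule shape_fill[OF shape_const0])
  have "chain0 (take p c @ drop p c)" using c by simp
  thus "chain0 (take p c)" unfolding chain_append by blast
qed

lemma shape_fill0: "shape (fill0 c)"
  by (rule shape_fill[OF shape_const0 c])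

lemma area_fill0: "area (fill0 c) = length c"
  using area_fill[OF shape_const0 c] by (simp add: area_zero)

lemma cell_at_bij: "bij_betw (cell_at c) {..<length c} (cells (fill0 c))"
proof -
  have neq: "cell_at c p \<noteq> cell_at c q" if "p < q" "q < length c" for p q
  proof
    assume e: "cell_at c p = cell_at c q"
    hence k: "c ! p = c ! q" and r: "fill0 (take p c) (c ! p) = fill0 (take q c) (c ! q)"
      by (auto simp: cell_at_def)
    have "fill0 (take (Suc p) c) (c ! p) \<le> fill0 (take q c) (c ! p)"
      by (rule fill0_take_mono) (use that in simp)
    thus False using fill0_take_Suc[of p c "c ! p"] that r k by simp
  qed
  have inj: "inj_on (cell_at c) {..<length c}"
  proof (rule inj_onI)
    fix p q assume "p \<in> {..<length c}" "q \<in> {..<length c}" "cell_at c p = cell_at c q"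
    thus "p = q" using neq[of p q] neq[of q p] by (cases p q rule: linorder_cases) auto
  qed
  have sub: "cell_at c ` {..<length c} \<subseteq> cells (fill0 c)"
  proof (rule image_subsetI)
    fix p assume p: "p \<in> {..<length c}"
    have "fill0 (take p c) (c ! p) < fill0 (take (Suc p) c) (c ! p)"
      using fill0_take_Suc[of p c "c ! p"] p by simp
    also have "\<dots> \<le> fill0 c (c ! p)" by (rule fill0_take_le)
    finally show "cell_at c p \<in> cells (fill0 c)" unfolding cell_at_def cells_iff .
  qed
  have "card (cell_at c ` {..<length c}) = card (cells (fill0 c))"
    using card_image[OF inj] card_cells[OF shape_fill0] area_fill0 by simp
  hence "cell_at c ` {..<length c} = cells (fill0 c)"
    by (rule card_subset_eq[OF finite_cells[OF shape_fill0] sub])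
  thus ?thesis using inj by (simp add: bij_betw_def)
qed

lemma cell_at_cases:
  assumes "x \<in> cells (fill0 c)"
  obtains p where "p < length c" "x = cell_at c p"
proof -
  have "x \<in> cell_at c ` {..<length c}"
    unfolding bij_betw_imp_surj_on[OF cell_at_bij] by (rule assms)
  thus ?thesis using that by blast
qed

lemma tableau_of_cell_at: "p < length c \<Longrightarrow> tableau_of c (cell_at c p) = Suc p"
  using cell_at_bij bij_betw_inv_into_left[OF cell_at_bij, of p]
  by (auto simp: tableau_of_def bij_betw_def)

lemma tableau_of_eq_Suc:
  assumes "x \<in> cells (fill0 c)" "tableau_of c x = Suc p"
  shows "p < length c" "x = cell_at c p"
proof -
  obtain q where q: "q < length c" "x = cell_at c q"
    using assms(1) cell_at_bij by (auto simp: bij_betw_def)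
  thus "p < length c" "x = cell_at c p" using assms(2) tableau_of_cell_at[OF q(1)] by auto
qed

lemma tableau_of_le:
  assumes "i < fill0 c k"
  shows "tableau_of c (i, i + k) \<le> q \<longleftrightarrow> i < fill0 (take q c) k"
proof -
  have x: "(i, i + k) \<in> cells (fill0 c)" using assms by simp
  obtain p where p: "p < length c" "(i, i + k) = cell_at c p"
    using x by (rule cell_at_cases)
  have k: "c ! p = k" and i: "fill0 (take p c) k = i" using p(2) by (auto simp: cell_at_def)
  have S: "fill0 (take (Suc p) c) k = Suc i" using fill0_take_Suc[OF p(1), of k] k i by simp
  have "Suc p \<le> q \<longleftrightarrow> i < fill0 (take q c) k"
  proof
    assume "Suc p \<le> q"
    thus "i < fill0 (take q c) k" using fill0_take_mono[of "Suc p" q c k] S by simp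
  next
    assume "i < fill0 (take q c) k"
    thus "Suc p \<le> q" using fill0_take_mono[of q p c k] i by (cases "Suc p \<le> q") auto
  qed
  thus ?thesis unfolding p(2) tableau_of_cell_at[OF p(1)] .
qed

text \<open>When the second cell is added on diagonal \<open>k'\<close>, the other diagonal
  \<open>k\<close> does not change. So the first cell, present in every prefix that contains the
  second, was there before. Rows and columns are instances, by the two inequalities between
  diagonals of a shape.\<close>

lemma tableau_of_less:
  assumes x: "i < fill0 c k" and y: "i' < fill0 c k'" and "k \<noteq> k'"
    and dom: "\<And>q. i' < fill0 (take q c) k' \<Longrightarrow> i < fill0 (take q c) k"
  shows "tableau_of c (i, i + k) < tableau_of c (i', i' + k')"
proof -
  have "(i', i' + k') \<in> cells (fill0 c)" using y by simp
  then obtain p where p: "p < length c" "(i', i' + k') = cell_at c p"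
    by (rule cell_at_cases)
  have v: "tableau_of c (i', i' + k') = Suc p" unfolding p(2) by (rule tableau_of_cell_at[OF p(1)])
  have kp: "c ! p = k'" using p(2) by (auto simp: cell_at_def)
  have "i' < fill0 (take (Suc p) c) k'" using tableau_of_le[OF y, of "Suc p"] v by simp
  hence "i < fill0 (take (Suc p) c) k" by (rule dom)
  hence "i < fill0 (take p c) k" using fill0_take_Suc[OF p(1), of k] kp assms(3) by simp
  hence "tableau_of c (i, i + k) \<le> p" using tableau_of_le[OF x, of p] by simp
  thus ?thesis using v by simp
qed

lemma tableau_of_row:
  assumes "(i, j) \<in> cells (fill0 c)" "(i, j') \<in> cells (fill0 c)" "j < j'"
  shows "tableau_of c (i, j) < tableau_of c (i, j')"
proof -
  obtain k where k: "j = i + k" "i < fill0 c k" using assms(1) by (auto elim: cellsE)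
  obtain l where l: "j' = i + l" "i < fill0 c l" using assms(2) by (auto elim: cellsE)
  have "k < l" using assms(3) k l by simp
  show ?thesis unfolding k(1) l(1)
  proof (rule tableau_of_less[OF k(2) l(2)])
    fix q assume "i < fill0 (take q c) l"
    thus "i < fill0 (take q c) k"
      using shape_antimono[OF shape_prefix[of q], of k l] \<open>k < l\<close> by simp
  qed (use \<open>k < l\<close> in simp)
qed

lemma tableau_of_col:
  assumes "(i, j) \<in> cells (fill0 c)" "(i', j) \<in> cells (fill0 c)" "i < i'"
  shows "tableau_of c (i, j) < tableau_of c (i', j)"
proof -
  obtain k where k: "j = i + k" "i < fill0 c k" using assms(1) by (auto elim: cellsE)
  obtain l where l: "j = i' + l" "i' < fill0 c l" using assms(2) by (auto elim: cellsE)
  have kl: "l < k" "k - l = i' - i" using assms(3) k l by simp_all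
  have "tableau_of c (i, i + k) < tableau_of c (i', i' + l)"
  proof (rule tableau_of_less[OF k(2) l(2)])
    fix q assume "i' < fill0 (take q c) l"
    thus "i < fill0 (take q c) k"
      using shape_drop[OF shape_prefix[of q], of l k] kl assms(3) by simp
  qed (use kl in simp)
  thus ?thesis using k(1) l(1) by simp
qed

lemma tableau_of_bij: "bij_betw (tableau_of c) (cells (fill0 c)) {1..length c}"
proof -
  have "bij_betw (Suc \<circ> inv_into {..<length c} (cell_at c)) (cells (fill0 c)) {1..length c}"
  proof (rule bij_betw_trans[OF bij_betw_inv_into[OF cell_at_bij]])
    show "bij_betw Suc {..<length c} {1..length c}"
      by (rule bij_betwI[where g="\<lambda>n. n - 1"]) auto
  qed
  thus ?thesis by (rule bij_betw_cong[THEN iffD1, rotated]) (simp add: tableau_of_def)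
qed

lemma tableau_of_ShSYT: "(partition_of (fill0 c), tableau_of c) \<in> ShSYT (length c)"
proof -
  let ?l = "partition_of (fill0 c)"
  have l: "strict_partition ?l" and diag_lengths: "diag_lengths ?l = fill0 c"
    using strict_partition_of[OF shape_fill0] diag_lengths_partition_of[OF shape_fill0] by auto
  have D: "shifted_diagram ?l = cells (fill0 c)" using cells_diag_lengths[OF l] diag_lengths by simp
  have "sum_list ?l = length c" using area_diag_lengths[OF l] diag_lengths area_fill0 by simp
  moreover have "tableau_of c \<in> extensional (cells (fill0 c))" by (simp add: tableau_of_def)
  ultimately show ?thesis
    unfolding ShSYT_def Let_def mem_Collect_eq prod.case D
    using l tableau_of_bij tableau_of_row tableau_of_col by blast
qed

text \<open>Of the two coordinate inequalities, one comes from the shape before the second box and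
  the other from the shape after it. So ascents and descents of the tableau are those of the content
  word, and equal contents do not occur.\<close>

lemma consecutive_cells:
  assumes p: "Suc p < length c"
  defines "r \<equiv> fill0 (take p c) (c ! p)" and "r' \<equiv> fill0 (take (Suc p) c) (c ! Suc p)"
  shows "c ! p < c ! Suc p \<Longrightarrow> r' \<le> r \<and> r + c ! p < r' + c ! Suc p"
    and "c ! Suc p < c ! p \<Longrightarrow> r < r' \<and> r' + c ! Suc p \<le> r + c ! p"
    and "c ! p \<noteq> c ! Suc p"
proof -
  let ?k = "c ! p" and ?k' = "c ! Suc p"
  let ?f = "fill0 (take (Suc p) c)" and ?g = "fill0 (take (Suc (Suc p)) c)"
  have f: "shape ?f" and g: "shape ?g" by (rule shape_prefix)+
  have fk: "?f ?k = Suc r" using fill0_take_Suc[of p c ?k] p by (simp add: r_def)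
  have gk': "?g ?k' = Suc r'" using fill0_take_Suc[OF p, of ?k'] by (simp add: r'_def)
  have gk: "?g ?k = Suc r" if "?k \<noteq> ?k'" using fill0_take_Suc[OF p, of ?k] fk that by simp
  have fk': "?f ?k' = r'" by (simp add: r'_def)
  show "r' \<le> r \<and> r + ?k < r' + ?k'" if "?k < ?k'"
    using shape_antimono[OF g, of ?k ?k'] shape_drop[OF f, of ?k ?k'] gk gk' fk fk' that by simp
  show "r < r' \<and> r' + ?k' \<le> r + ?k" if "?k' < ?k"
    using shape_antimono[OF f, of ?k' ?k] shape_drop[OF g, of ?k' ?k] gk gk' fk fk' that by simp
  show "?k \<noteq> ?k'"
    using chain_no_repeat[OF shape_const0 c] p unfolding successively_iff_nth by blast
qed

lemma
  assumes p: "Suc p < length c"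
  shows ascent_iff: "is_ascent (partition_of (fill0 c), tableau_of c) (Suc p) \<longleftrightarrow> c ! p < c ! Suc p"
    and descent_iff: "is_descent (partition_of (fill0 c), tableau_of c) (Suc p) \<longleftrightarrow> c ! Suc p < c ! p"
proof -
  let ?D = "cells (fill0 c)" and ?T = "tableau_of c"
  have D: "shifted_diagram (partition_of (fill0 c)) = ?D"
    using cells_diag_lengths[OF strict_partition_of[OF shape_fill0]] diag_lengths_partition_of[OF shape_fill0] by simp
  have p1: "p < length c" using p by simp
  have in_D: "cell_at c q \<in> ?D" if "q < length c" for q
    using that cell_at_bij by (auto simp: bij_betw_def)
  obtain r where r: "cell_at c p = (r, r + c ! p)" "r = fill0 (take p c) (c ! p)"
    by (simp add: cell_at_def)
  obtain r' where r': "cell_at c (Suc p) = (r', r' + c ! Suc p)" "r' = fill0 (take (Suc p) c) (c ! Suc p)"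
    by (simp add: cell_at_def)
  have u1: "(a, b) \<in> ?D \<and> ?T (a, b) = Suc p \<longleftrightarrow> a = r \<and> b = r + c ! p" for a b
    using tableau_of_eq_Suc[of "(a, b)" p] tableau_of_cell_at[OF p1] in_D[OF p1] r(1) by auto
  have u2: "(a, b) \<in> ?D \<and> ?T (a, b) = Suc p + 1 \<longleftrightarrow> a = r' \<and> b = r' + c ! Suc p" for a b
    using tableau_of_eq_Suc[of "(a, b)" "Suc p"] tableau_of_cell_at[OF p] in_D[OF p] r'(1) by auto
  have "is_ascent (partition_of (fill0 c), ?T) (Suc p) \<longleftrightarrow>
      (\<exists>a b a' b'. ((a, b) \<in> ?D \<and> ?T (a, b) = Suc p) \<and> ((a', b') \<in> ?D \<and> ?T (a', b') = Suc p + 1) \<and> a' \<le> a \<and> b < b')"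
    unfolding is_ascent_def fst_conv snd_conv D by blast
  hence "is_ascent (partition_of (fill0 c), ?T) (Suc p) \<longleftrightarrow> r' \<le> r \<and> r + c ! p < r' + c ! Suc p"
    unfolding u1 u2 by auto
  thus "is_ascent (partition_of (fill0 c), ?T) (Suc p) \<longleftrightarrow> c ! p < c ! Suc p"
    using consecutive_cells(1)[OF p] unfolding r(2)[symmetric] r'(2)[symmetric] by auto
  have "is_descent (partition_of (fill0 c), ?T) (Suc p) \<longleftrightarrow>
      (\<exists>a b a' b'. ((a, b) \<in> ?D \<and> ?T (a, b) = Suc p) \<and> ((a', b') \<in> ?D \<and> ?T (a', b') = Suc p + 1) \<and> a < a' \<and> b' \<le> b)"
    unfolding is_descent_def fst_conv snd_conv D by blast
  hence "is_descent (partition_of (fill0 c), ?T) (Suc p) \<longleftrightarrow> r < r' \<and> r' + c ! Suc p \<le> r + c ! p"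
    unfolding u1 u2 by auto
  thus "is_descent (partition_of (fill0 c), ?T) (Suc p) \<longleftrightarrow> c ! Suc p < c ! p"
    using consecutive_cells(2)[OF p] unfolding r(2)[symmetric] r'(2)[symmetric] by auto
qed

lemma alternating_iff_zigzag:
  "(\<forall>i\<in>{1..length c - 1}. (odd i \<longrightarrow> is_ascent (partition_of (fill0 c), tableau_of c) i) \<and>
      (even i \<longrightarrow> is_descent (partition_of (fill0 c), tableau_of c) i)) \<longleftrightarrow> zigzag (<) c"
proof
  assume *: "\<forall>i\<in>{1..length c - 1}. (odd i \<longrightarrow> is_ascent (partition_of (fill0 c), tableau_of c) i) \<and>
      (even i \<longrightarrow> is_descent (partition_of (fill0 c), tableau_of c) i)"
  show "zigzag (<) c" unfolding zigzag_def
  proof (intro allI impI)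
    fix p assume p: "Suc p < length c"
    hence "Suc p \<in> {1..length c - 1}" by auto
    with * have "(odd (Suc p) \<longrightarrow> is_ascent (partition_of (fill0 c), tableau_of c) (Suc p)) \<and>
      (even (Suc p) \<longrightarrow> is_descent (partition_of (fill0 c), tableau_of c) (Suc p))" by blast
    thus "(c ! p < c ! Suc p) = even p"
      unfolding ascent_iff[OF p] descent_iff[OF p] by auto
  qed
next
  assume z: "zigzag (<) c"
  show "\<forall>i\<in>{1..length c - 1}. (odd i \<longrightarrow> is_ascent (partition_of (fill0 c), tableau_of c) i) \<and>
      (even i \<longrightarrow> is_descent (partition_of (fill0 c), tableau_of c) i)"
  proof
    fix i assume i: "i \<in> {1..length c - 1}"
    then obtain p where ip: "i = Suc p" and p: "Suc p < length c" by (cases i) auto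
    have "(c ! p < c ! Suc p) = even p" using z p unfolding zigzag_def by blast
    thus "(odd i \<longrightarrow> is_ascent (partition_of (fill0 c), tableau_of c) i) \<and>
      (even i \<longrightarrow> is_descent (partition_of (fill0 c), tableau_of c) i)"
      unfolding ip ascent_iff[OF p] descent_iff[OF p] using consecutive_cells(3)[OF p] by auto
  qed
qed

end

lemma tableau_of_inject:
  assumes c: "chain0 c" and c': "chain0 c'" and shape: "fill0 c = fill0 c'" and tab: "tableau_of c = tableau_of c'"
  shows "c = c'"
proof (rule nth_equalityI)
  show "length c = length c'" using area_fill0[OF c] area_fill0[OF c'] shape by simp
  fix p assume p: "p < length c"
  have "cell_at c p \<in> cells (fill0 c')"
    using bij_betw_apply[OF cell_at_bij[OF c], of p] p shape by simp
  moreover have "tableau_of c' (cell_at c p) = Suc p"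
    using tableau_of_cell_at[OF c p] tab by simp
  ultimately have "cell_at c p = cell_at c' p" by (rule tableau_of_eq_Suc(2)[OF c'])
  thus "c ! p = c' ! p" by (auto simp: cell_at_def)
qed

text \<open>A standard filling is read off as the sequence of contents of the cells with entries \<open>1, 2, \<dots>\<close>.\<close>

lemma ShSYT_is_tableau_of:
  assumes U: "(lam, T) \<in> ShSYT N"
  obtains c where "length c = N" "chain0 c" "partition_of (fill0 c) = lam" "tableau_of c = T"
proof -
  let ?D = "cells (diag_lengths lam)"
  have l: "strict_partition lam" using U by (simp add: ShSYT_def)
  have N: "sum_list lam = N" using U by (simp add: ShSYT_def)
  have D: "shifted_diagram lam = ?D" by (rule cells_diag_lengths[OF l, symmetric])
  have T_ext: "T \<in> extensional ?D" and bij: "bij_betw T ?D {1..N}"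
    and row: "\<And>i j j'. (i, j) \<in> ?D \<Longrightarrow> (i, j') \<in> ?D \<Longrightarrow> j < j' \<Longrightarrow> T (i, j) < T (i, j')"
    and col: "\<And>i i' j. (i, j) \<in> ?D \<Longrightarrow> (i', j) \<in> ?D \<Longrightarrow> i < i' \<Longrightarrow> T (i, j) < T (i', j)"
    using U unfolding ShSYT_def Let_def mem_Collect_eq prod.case D by blast+
  define f where "f = diag_lengths lam"
  have f: "shape f" unfolding f_def by (rule shape_diag_lengths[OF l])
  have row': "T (i, i + k) < T (i, i + Suc k)" if "i < f (Suc k)" for i k
  proof (rule row)
    show "(i, i + Suc k) \<in> ?D" "(i, i + k) \<in> ?D"
      using that shape_step(1)[OF f, of k] unfolding cells_iff f_def by simp_all
  qed simp
  have col': "T (i, i + Suc k) < T (Suc i, Suc i + k)" if "Suc i < f k" for i k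
  proof -
    have a: "(i, i + Suc k) \<in> ?D"
      using that shape_step(2)[OF f, of k] unfolding cells_iff f_def by simp
    have b: "(Suc i, Suc i + k) \<in> ?D" using that unfolding cells_iff f_def .
    show ?thesis using col[of i "i + Suc k" "Suc i"] a b by simp
  qed
  \<comment> \<open>\<open>g p\<close> is the shape formed by the entries at most \<open>p\<close>.
    Entries increase along diagonals, so counting them gives an initial segment.\<close>
  define g where "g p k = card {i. i < f k \<and> T (i, i + k) \<le> p}" for p k
  have g: "i < g p k \<longleftrightarrow> i < f k \<and> T (i, i + k) \<le> p" for i p k
  proof -
    let ?S = "{i. i < f k \<and> T (i, i + k) \<le> p}"
    have "i \<in> ?S \<longleftrightarrow> i < card ?S"
    proof (rule down_closed_nat)
      fix i assume i: "Suc i \<in> ?S"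
      hence "T (i, i + k) < T (i, i + Suc k)" using shape_step(2)[OF f, of k] by (intro row') simp
      also have "\<dots> < T (Suc i, Suc i + k)" by (rule col') (use i in simp)
      finally show "i \<in> ?S" using i by simp
    qed simp
    thus ?thesis unfolding g_def by simp
  qed
  have shape_g: "shape (g p)" for p unfolding shape_def
  proof (intro conjI allI)
    fix k
    show "g p (Suc k) \<le> g p k"
    proof (rule nat_leI)
      fix i assume "i < g p (Suc k)"
      thus "i < g p k" unfolding g using row'[of i k] shape_step(1)[OF f, of k] by auto
    qed
    show "g p k \<le> Suc (g p (Suc k))"
    proof (rule nat_leI)
      fix i assume i: "i < g p k"
      show "i < Suc (g p (Suc k))"
      proof (cases i)
        case (Suc j)
        have "j < g p (Suc k)"
          using i Suc col'[of j k] shape_step(2)[OF f, of k] unfolding g by auto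
        thus ?thesis using Suc by simp
      qed simp
    qed
    obtain K where "f K = 0" using f by (auto simp: shape_def)
    hence "g p K = 0" by (simp add: g_def)
    thus "\<exists>K. g p K = 0" ..
  qed
  define S where "S p = inv_into ?D T (Suc p)" for p
  have S: "S p \<in> ?D" "T (S p) = Suc p" if "p < N" for p
  proof -
    have "Suc p \<in> T ` ?D" using that bij_betw_imp_surj_on[OF bij] by simp
    thus "S p \<in> ?D" "T (S p) = Suc p" unfolding S_def by (rule inv_into_into, rule f_inv_into_f)
  qed
  have S_eq: "x = S p" if "x \<in> ?D" "T x = Suc p" for x p
    unfolding S_def using inv_into_f_f[OF bij_betw_imp_inj_on[OF bij] that(1)] that(2) by simp
  define c where "c = map (\<lambda>p. snd (S p) - fst (S p)) [0..<N]"
  have len: "length c = N" by (simp add: c_def)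
  have T_pos: "1 \<le> T (i, i + k)" "T (i, i + k) \<le> N" if "i < f k" for i k
    using bij_betw_apply[OF bij, of "(i, i + k)"] that by (auto simp: f_def)
  \<comment> \<open>From \<open>p\<close> to \<open>Suc p\<close> only the cell \<open>S p\<close>
    is new, and it lies at the end of its diagonal. So its row is the previous length of that
    diagonal, as in \<open>cell_at\<close>.\<close>
  have S_cell: "S p = (g p (c ! p), g p (c ! p) + c ! p) \<and> g (Suc p) = (g p)(c ! p := Suc (g p (c ! p)))" if p: "p < N" for p
  proof -
    obtain i k where ik: "S p = (i, i + k)" and i: "i < f k" using S(1)[OF p] unfolding f_def by (rule cellsE)
    have cp: "c ! p = k" using p ik by (simp add: c_def)
    have Ti: "T (i, i + k) = Suc p" using S(2)[OF p] ik by simp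
    have set: "{j. j < f l \<and> T (j, j + l) \<le> Suc p} = {j. j < f l \<and> T (j, j + l) \<le> p} \<union> (if l = k then {i} else {})" for l
    proof (intro set_eqI iffI)
      fix j assume j: "j \<in> {j. j < f l \<and> T (j, j + l) \<le> Suc p}"
      show "j \<in> {j. j < f l \<and> T (j, j + l) \<le> p} \<union> (if l = k then {i} else {})"
      proof (cases "T (j, j + l) = Suc p")
        case True
        have "(j, j + l) = S p" by (rule S_eq) (use True j in \<open>simp_all add: f_def\<close>)
        thus ?thesis using ik by simp
      qed (use j in auto)
    qed (use Ti i in \<open>auto split: if_splits\<close>)
    have gS: "g (Suc p) l = g p l + of_bool (l = k)" for l
      using Ti unfolding g_def set by (cases "l = k") simp_all
    have "\<not> i < g p k" "i < g (Suc p) k" unfolding g using Ti i by simp_all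
    hence "g p k = i" using gS[of k] by simp
    thus ?thesis using ik gS by (auto simp: cp)
  qed
  have prefix: "chain0 (take p c) \<and> fill0 (take p c) = g p" if "p \<le> N" for p
    using that
  proof (induction p)
    case 0
    have "g 0 = (\<lambda>_. 0)"
    proof
      fix k
      have "\<not> i < g 0 k" for i unfolding g using T_pos(1)[of i k] by auto
      thus "g 0 k = 0" by blast
    qed
    thus ?case by simp
  next
    case (Suc p)
    hence p: "p < N" and IH: "chain0 (take p c)" "fill0 (take p c) = g p" by auto
    have t: "take (Suc p) c = take p c @ [c ! p]" using p len by (simp add: take_Suc_conv_app_nth)
    have G: "(g p)(c ! p := Suc (g p (c ! p))) = g (Suc p)" using S_cell[OF p] by simp
    show ?case unfolding t chain_append fill_append IH(2) chain.simps fill_Cons fill_Nil G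
      using IH(1) shape_g by simp
  qed
  have c: "chain0 c" and fc: "fill0 c = f"
  proof -
    show "chain0 c" using prefix[of N] len by simp
    have "i < g N k \<longleftrightarrow> i < f k" for i k unfolding g using T_pos(2) by blast
    hence "g N k = f k" for k by (meson less_irrefl linorder_neqE_nat)
    hence "g N = f" by (rule ext)
    thus "fill0 c = f" using prefix[of N] len by simp
  qed
  have "tableau_of c = T"
  proof
    fix x
    show "tableau_of c x = T x"
    proof (cases "x \<in> ?D")
      case True
      hence "x \<in> cells (fill0 c)" by (simp add: fc f_def)
      then obtain p where p: "p < length c" "x = cell_at c p" by (rule cell_at_cases[OF c])
      have "cell_at c p = S p" using S_cell[of p] prefix[of p] p(1) len by (simp add: cell_at_def)
      thus ?thesis using tableau_of_cell_at[OF c p(1)] p S(2)[of p] len by simp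
    next
      case False
      thus ?thesis using extensional_arb[OF T_ext False] by (simp add: tableau_of_def fc f_def)
    qed
  qed
  moreover have "partition_of (fill0 c) = lam" unfolding fc f_def by (rule partition_of_diag_lengths[OF l])
  ultimately show ?thesis using that len c by blast
qed

section \<open>Alternating tableaux and zigzag chains\<close>

lemma chain_words:
  assumes "chain0 c" "length c = N"
  shows "c \<in> words {..<N} N"
proof -
  have "k < N" if k: "k \<in> set c" for k
  proof -
    have "fill0 c k \<noteq> 0" using k by (simp add: fill_def count_list_0_iff)
    thus ?thesis using shape_support[OF shape_fill0[OF assms(1)]] area_fill0[OF assms(1)] assms(2) by auto
  qed
  thus ?thesis using assms(2) by (auto simp: words_def)
qed

text \<open>The diagonal lengths recover the final shape from the partition, and the cell of each
  entry then recovers the content at its position. The alphabet below \<open>N\<close> is large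
  enough by \<open>chain_words\<close>.\<close>

lemma AltShSYT_bij:
  "bij_betw (\<lambda>c. (partition_of (fill0 c), tableau_of c))
     {c. c \<in> words {..<N} N \<and> zigzag (<) c \<and> chain0 c} (AltShSYT N)"
  (is "bij_betw ?\<psi> ?C _")
proof -
  have "inj_on ?\<psi> ?C"
  proof (rule inj_onI)
    fix c c' assume c: "c \<in> ?C" and c': "c' \<in> ?C" and eq: "?\<psi> c = ?\<psi> c'"
    have "diag_lengths (partition_of (fill0 c)) = diag_lengths (partition_of (fill0 c'))" using eq by simp
    hence "fill0 c = fill0 c'" using diag_lengths_partition_of shape_fill0 c c' by simp
    thus "c = c'" using eq c c' by (intro tableau_of_inject) auto
  qed
  moreover have "?\<psi> ` ?C = AltShSYT N"
  proof (intro set_eqI iffI)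
    fix U assume "U \<in> ?\<psi> ` ?C"
    then obtain c where U: "U = ?\<psi> c" and c: "chain0 c" "length c = N" "zigzag (<) c"
      by (auto simp: words_def)
    have "?\<psi> c \<in> ShSYT N" using tableau_of_ShSYT[OF c(1)] c(2) by simp
    moreover have "\<forall>i\<in>{1..N - 1}. (odd i \<longrightarrow> is_ascent (?\<psi> c) i) \<and> (even i \<longrightarrow> is_descent (?\<psi> c) i)"
      using iffD2[OF alternating_iff_zigzag[OF c(1)] c(3)] c(2) by simp
    ultimately show "U \<in> AltShSYT N" unfolding U AltShSYT_def by blast
  next
    fix U assume U: "U \<in> AltShSYT N"
    obtain lam T where lT: "U = (lam, T)" by (cases U)
    have "(lam, T) \<in> ShSYT N" using U lT by (simp add: AltShSYT_def)
    then obtain c where c: "length c = N" "chain0 c" "partition_of (fill0 c) = lam" "tableau_of c = T"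
      by (rule ShSYT_is_tableau_of)
    have U\<psi>: "U = ?\<psi> c" using lT c by simp
    have "zigzag (<) c"
      using U unfolding U\<psi> AltShSYT_def by (intro iffD1[OF alternating_iff_zigzag[OF c(2)]]) (simp add: c(1))
    thus "U \<in> ?\<psi> ` ?C" using U\<psi> c chain_words[OF c(2,1)] by blast
  qed
  ultimately show ?thesis by (simp add: bij_betw_def)
qed

section \<open>Comparison of coefficients\<close>

lemma sum_power_series_apply:
  fixes F :: "'a \<Rightarrow> power_series"
  assumes "finite A"
  shows "(\<Sum>U\<in>A. F U) a = (\<Sum>U\<in>A. F U a)"
  using assms by (induction A rule: finite_induct) auto

theorem theorem4p3:
  fixes n :: nat
  assumes "n \<ge> 1"
  shows "skew_schur (staircase (int n)) (staircase (int n - 2)) =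
           (\<Sum>U\<in>AltShSYT (2 * n - 1). schur_P (sh U))"
proof
  fix a :: monomial
  define N where "N = 2 * n - 1"
  have N: "odd N" using assms by (simp add: N_def)
  \<comment> \<open>All variables of the monomial \<open>a\<close> have index at most
    \<open>m\<close>, so the same \<open>m\<close> truncates the skew Schur function and every
    P-function.\<close>
  obtain m where m: "Poly_Mapping.keys a \<subseteq> {..m}"
    using finite_nat_set_iff_bounded_le[of "Poly_Mapping.keys a"] by auto
  let ?Z = "zigzag_cells n"
  let ?C = "{c. c \<in> words {..<N} N \<and> zigzag (<) c \<and> chain0 c}"
  have finZ: "finite ?Z"
    by (rule finite_subset[of _ "{..n} \<times> {..n}"]) (auto simp: zigzag_cells_def)
  have "finite {T \<in> SSYT ?Z. \<forall>c\<in>?Z. id (T c) \<le> m}"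
  proof (rule finite_subset)
    show "finite (?Z \<rightarrow>\<^sub>E {..m})" by (rule finite_PiE[OF finZ]) simp
  qed (auto simp: SSYT_def PiE_def)
  hence "skew_schur (staircase (int n)) (staircase (int n - 2)) a =
      Poly_Mapping.lookup (\<Sum>T | T \<in> SSYT ?Z \<and> (\<forall>c\<in>?Z. T c \<le> m). \<Prod>c\<in>?Z. var (T c)) a"
    unfolding skew_schur_def Let_def zigzag_diagram
    using tableau_series_eq_lookup[OF finZ _ m, of "SSYT ?Z" id] by simp
  also have "\<dots> = Poly_Mapping.lookup (\<Sum>c\<in>?C. P_poly var m (fill0 c)) a"
    unfolding sum_SSYT_zigzag N_def[symmetric] zigzag_words_eq_chains[OF N] ..
  also have "\<dots> = (\<Sum>c\<in>?C. Poly_Mapping.lookup (P_poly var m (fill0 c)) a)"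
    by (rule lookup_sum)
  also have "\<dots> = (\<Sum>c\<in>?C. schur_P (sh (partition_of (fill0 c), tableau_of c)) a)"
  proof (rule sum.cong[OF refl])
    fix c assume "c \<in> ?C"
    hence c: "shape (fill0 c)" by (intro shape_fill0) simp
    let ?l = "partition_of (fill0 c)"
    have l: "strict_partition ?l" and diag_lengths: "diag_lengths ?l = fill0 c"
      using strict_partition_of[OF c] diag_lengths_partition_of[OF c] by auto
    note marked_tabs = ShSSYT_marked_tabs[OF l, of m, unfolded diag_lengths]
    have "schur_P ?l a = Poly_Mapping.lookup (\<Sum>T\<in>marked_tabs m (fill0 c).
        \<Prod>x\<in>shifted_diagram ?l. var (letter_index (T x))) a"
      unfolding schur_P_def marked_tabs[symmetric]
      by (rule tableau_series_eq_lookup[OF finite_shifted_diagram _ m])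
        (simp only: marked_tabs finite_marked_tabs[OF c])
    also have "shifted_diagram ?l = cells (fill0 c)" using cells_diag_lengths[OF l] diag_lengths by simp
    finally show "Poly_Mapping.lookup (P_poly var m (fill0 c)) a = schur_P (sh (?l, tableau_of c)) a"
      unfolding sum_marked_tabs[OF c] fst_conv by (rule sym)
  qed
  also have "\<dots> = (\<Sum>U\<in>AltShSYT N. schur_P (sh U) a)"
    by (rule sum.reindex_bij_betw[OF AltShSYT_bij])
  also have "\<dots> = (\<Sum>U\<in>AltShSYT N. schur_P (sh U)) a"
    by (rule sum_power_series_apply[OF finite_AltShSYT, symmetric])
  finally show "skew_schur (staircase (int n)) (staircase (int n - 2)) a =
      (\<Sum>U\<in>AltShSYT (2 * n - 1). schur_P (sh U)) a"
    unfolding N_def .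
qed

end
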